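(* Let $w\in\mathfrak{S}_n$ and let $Y_w$ be the closure of a generic $T$-orbit in the Schubert variety $X_w$. For $u\le w$, $Y_w$ is smooth at the $T$-fixed point $uB$ if and only if the graph $\Gamma_w(u)$ is a forest. Consequently, $Y_w$ is smooth if and only if $\Gamma_w(u)$ is a forest for every $u\le w$.
   Context: Let $G=\mathrm{GL}_n(\mathbb{C})$, $B$ the upper triangular Borel subgroup, $T$ the diagonal torus acting on $G/B$ by left multiplication; permutations $w\in\mathfrak{S}_n$ (one-line notation $w(1)\cdots w(n)$) are identified with the permutation matrices with $i$-th column $e_{w(i)}$. $\le$ is Bruhat order, $\ell$ is length. $X_w=\overline{BwB/B}$ is the Schubert variety, whose $T$-fixed points are $uB$, $u\le w$. A $T$-orbit in $X_w$ is generic if its closure contains all $T$-fixed points of $X_w$; $Y_w$ is the closure of a generic $T$-orbit in $X_w$. For $a\ne b$, $t_{a,b}$ is the transposition of $a$ and $b$ (so $t_{a,b}u$ is obtained from $u$ by swapping the values $a$ and $b$ in its one-line notation). For $u\le w$ let $\widetilde{E}_w(u)=\{(u(i),u(j)) : 1\le i<j\le n,\ t_{u(i),u(j)}u\le w,\ |\ell(u)-\ell(t_{u(i),u(j)}u)|=1\}$. With the rule $(a,b)+(b,c)=(a,c)$, an element of $\widetilde{E}_w(u)$ is decomposable if it is a sum of some other elements of $\widetilde{E}_w(u)$, and indecomposable otherwise; $E_w(u)$ is the set of indecomposable elements of $\widetilde{E}_w(u)$. $\Gamma_w(u)$ is the graph whose vertices are the integers appearing in pairs of $E_w(u)$ and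 whose edges are the elements $(a,b)\in E_w(u)$; "forest" refers to the underlying undirected graph. *)

theory Defs
  imports
    "HOL-Library.Extended_Nat"
    "HOL-Library.Function_Algebras"
    "HOL-Combinatorics.Permutations"
    "HOL-Analysis.Abstract_Topology"
    "HOL-Algebra.Left_Coset"
    "Jordan_Normal_Form.Matrix"
begin

section \<open>Spaces with functions: Zariski tangent space, dimension, smoothness\<close>

text \<open>
  A variety over the complex numbers is given by its Zariski topology \<open>X\<close> and its structure sheaf
  \<open>F\<close>, where \<open>F U f\<close> says that \<open>f\<close> is a regular function on the open set \<open>U\<close>. Only the values of
  \<open>f\<close> on \<open>U\<close> matter.
\<close>

type_synonym 'a function_sheaf = "'a set \<Rightarrow> ('a \<Rightarrow> complex) \<Rightarrow> bool"

definition subspace_sheaf :: "'a topology \<Rightarrow> 'a function_sheaf \<Rightarrow> 'a set \<Rightarrow> 'a function_sheaf" where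
  "subspace_sheaf X F Y U f \<longleftrightarrow>
     openin (subtopology X Y) U \<and>
     (\<forall>y\<in>U. \<exists>V g. openin X V \<and> y \<in> V \<and> F V g \<and> (\<forall>z\<in>V \<inter> U. f z = g z))"

definition regular_near :: "'a topology \<Rightarrow> 'a function_sheaf \<Rightarrow> 'a \<Rightarrow> ('a \<Rightarrow> complex) set" where
  "regular_near X F x = {f. \<exists>U. openin X U \<and> x \<in> U \<and> F U f}"

definition same_germ :: "'a topology \<Rightarrow> 'a \<Rightarrow> ('a \<Rightarrow> complex) \<Rightarrow> ('a \<Rightarrow> complex) \<Rightarrow> bool" where
  "same_germ X x f g \<longleftrightarrow> (\<exists>U. openin X U \<and> x \<in> U \<and> (\<forall>z\<in>U. f z = g z))"

text \<open>
  The Zariski tangent space at \<open>x\<close>: the complex-valued point derivations of the local ring at \<open>x\<close>.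
  An element of the local ring is represented by any function having that germ; \<open>D\<close> depends on
  the germ only, and is normalised to \<open>0\<close> on functions that are not regular near \<open>x\<close>.
\<close>

definition tangent_space :: "'a topology \<Rightarrow> 'a function_sheaf \<Rightarrow> 'a \<Rightarrow> (('a \<Rightarrow> complex) \<Rightarrow> complex) set"
  where "tangent_space X F x = {D.
     (\<forall>f\<in>regular_near X F x. \<forall>g\<in>regular_near X F x.
        D (\<lambda>z. f z + g z) = D f + D g \<and>
        D (\<lambda>z. f z * g z) = f x * D g + g x * D f \<and>
        (same_germ X x f g \<longrightarrow> D f = D g)) \<and>
     (\<forall>c. \<forall>f\<in>regular_near X F x. D (\<lambda>z. c * f z) = c * D f) \<and>
     (\<forall>f. f \<notin> regular_near X F x \<longrightarrow> D f = 0)}"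

interpretation cfun: vector_space "\<lambda>(c::complex) (D :: 'b \<Rightarrow> complex) z. c * D z"
  by unfold_locales (auto simp: fun_eq_iff algebra_simps)

definition has_complex_dim :: "('b \<Rightarrow> complex) set \<Rightarrow> nat \<Rightarrow> bool" where
  "has_complex_dim V d \<longleftrightarrow>
     (\<exists>S. finite S \<and> card S = d \<and> cfun.independent S \<and> cfun.span S = V)"

definition irreducible_closedin :: "'a topology \<Rightarrow> 'a set \<Rightarrow> bool" where
  "irreducible_closedin X Z \<longleftrightarrow> closedin X Z \<and> Z \<noteq> {} \<and>
     (\<forall>A B. closedin X A \<and> closedin X B \<and> Z = A \<union> B \<longrightarrow> Z = A \<or> Z = B)"

text \<open>
  The dimension at \<open>x\<close> is the supremum of the lengths of chains of irreducible closed sets through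
  \<open>x\<close>, which is the Krull dimension of the local ring at \<open>x\<close>.
\<close>

definition local_dim :: "'a topology \<Rightarrow> 'a \<Rightarrow> enat" where
  "local_dim X x = Sup {enat d | d. \<exists>Z :: nat \<Rightarrow> 'a set.
     (\<forall>i\<le>d. irreducible_closedin X (Z i) \<and> x \<in> Z i) \<and> (\<forall>i<d. Z i \<subset> Z (Suc i))}"

text \<open>Smooth at \<open>x\<close>: the local ring at \<open>x\<close> is regular.\<close>

definition smooth_at :: "'a topology \<Rightarrow> 'a function_sheaf \<Rightarrow> 'a \<Rightarrow> bool" where
  "smooth_at X F x \<longleftrightarrow> (\<exists>d. has_complex_dim (tangent_space X F x) d \<and> local_dim X x = enat d)"

section \<open>The general linear group and the flag variety\<close>

text \<open>Rows and columns of \<open>n \<times> n\<close> matrices are indexed by \<open>0, \<dots>, n - 1\<close>.\<close>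

definition GL :: "nat \<Rightarrow> complex mat monoid" where
  "GL n = units_of (ring_mat TYPE(complex) n ())"

definition borel_group :: "nat \<Rightarrow> complex mat set" where
  "borel_group n = {b \<in> carrier (GL n). upper_triangular b}"

definition diag_torus :: "nat \<Rightarrow> complex mat set" where
  "diag_torus n = {t \<in> carrier (GL n). diagonal_mat t}"

inductive_set poly_fun :: "nat \<Rightarrow> (complex mat \<Rightarrow> complex) set" for n where
  const: "(\<lambda>_. c) \<in> poly_fun n"
| entry: "i < n \<Longrightarrow> j < n \<Longrightarrow> (\<lambda>A. A $$ (i, j)) \<in> poly_fun n"
| add: "p \<in> poly_fun n \<Longrightarrow> q \<in> poly_fun n \<Longrightarrow> (\<lambda>A. p A + q A) \<in> poly_fun n"
| mult: "p \<in> poly_fun n \<Longrightarrow> q \<in> poly_fun n \<Longrightarrow> (\<lambda>A. p A * q A) \<in> poly_fun n"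

definition GL_open :: "nat \<Rightarrow> complex mat set \<Rightarrow> bool" where
  "GL_open n U \<longleftrightarrow> (\<exists>P \<subseteq> poly_fun n. U = {g \<in> carrier (GL n). \<exists>p\<in>P. p g \<noteq> 0})"

lemma GL_open_iff:
  "GL_open n U \<longleftrightarrow> U \<subseteq> carrier (GL n) \<and>
     (\<forall>g\<in>U. \<exists>p\<in>poly_fun n. p g \<noteq> 0 \<and> (\<forall>h\<in>carrier (GL n). p h \<noteq> 0 \<longrightarrow> h \<in> U))"
  (is "_ \<longleftrightarrow> ?R")
proof
  assume "GL_open n U"
  then obtain P where "P \<subseteq> poly_fun n" "U = {g \<in> carrier (GL n). \<exists>p\<in>P. p g \<noteq> 0}"
    unfolding GL_open_def by blast
  then show ?R by blast
next
  assume R: ?R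
  let ?P = "{p \<in> poly_fun n. \<forall>h\<in>carrier (GL n). p h \<noteq> 0 \<longrightarrow> h \<in> U}"
  have "U = {g \<in> carrier (GL n). \<exists>p\<in>?P. p g \<noteq> 0}" (is "_ = ?V")
  proof (rule subset_antisym)
    show "U \<subseteq> ?V" using R by blast
    show "?V \<subseteq> U" by blast
  qed
  moreover have "?P \<subseteq> poly_fun n" by blast
  ultimately show "GL_open n U" unfolding GL_open_def by blast
qed

lemma istopology_GL_open: "istopology (GL_open n)"
  unfolding istopology_def
proof (rule conjI; intro allI impI)
  fix S T assume S: "GL_open n S" and T: "GL_open n T"
  show "GL_open n (S \<inter> T)" unfolding GL_open_iff
  proof (intro conjI ballI)
    show "S \<inter> T \<subseteq> carrier (GL n)" using S unfolding GL_open_iff by blast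
    fix g assume g: "g \<in> S \<inter> T"
    obtain p where p: "p \<in> poly_fun n" "p g \<noteq> 0" "\<forall>h\<in>carrier (GL n). p h \<noteq> 0 \<longrightarrow> h \<in> S"
      using S g unfolding GL_open_iff by blast
    obtain q where q: "q \<in> poly_fun n" "q g \<noteq> 0" "\<forall>h\<in>carrier (GL n). q h \<noteq> 0 \<longrightarrow> h \<in> T"
      using T g unfolding GL_open_iff by blast
    show "\<exists>p\<in>poly_fun n. p g \<noteq> 0 \<and> (\<forall>h\<in>carrier (GL n). p h \<noteq> 0 \<longrightarrow> h \<in> S \<inter> T)"
      by (rule bexI[where x = "\<lambda>A. p A * q A"], use p q in simp)
        (rule poly_fun.mult[OF p(1) q(1)])
  qed
next
  fix K assume "\<forall>S\<in>K. GL_open n S"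
  then have K: "\<And>S. S \<in> K \<Longrightarrow> S \<subseteq> carrier (GL n)"
    "\<And>S g. S \<in> K \<Longrightarrow> g \<in> S \<Longrightarrow>
      \<exists>p\<in>poly_fun n. p g \<noteq> 0 \<and> (\<forall>h\<in>carrier (GL n). p h \<noteq> 0 \<longrightarrow> h \<in> S)"
    unfolding GL_open_iff by simp_all
  show "GL_open n (\<Union>K)" unfolding GL_open_iff
  proof (intro conjI ballI)
    show "\<Union>K \<subseteq> carrier (GL n)" using K(1) by (rule Union_least)
    fix g assume "g \<in> \<Union>K"
    then obtain S where S: "S \<in> K" "g \<in> S" by (rule UnionE)
    from K(2)[OF S] obtain p where "p \<in> poly_fun n" "p g \<noteq> 0"
      "\<forall>h\<in>carrier (GL n). p h \<noteq> 0 \<longrightarrow> h \<in> S" by (elim bexE conjE)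
    with S(1) show "\<exists>p\<in>poly_fun n. p g \<noteq> 0 \<and> (\<forall>h\<in>carrier (GL n). p h \<noteq> 0 \<longrightarrow> h \<in> \<Union>K)"
      by (intro bexI[where x = p] conjI ballI impI UnionI[of S]) simp_all
  qed
qed

definition GL_top :: "nat \<Rightarrow> complex mat topology" where
  "GL_top n = topology (GL_open n)"

lemma openin_GL_top: "openin (GL_top n) = GL_open n"
  unfolding GL_top_def by (rule topology_inverse'[OF istopology_GL_open])

definition GL_sheaf :: "nat \<Rightarrow> complex mat function_sheaf" where
  "GL_sheaf n U f \<longleftrightarrow> openin (GL_top n) U \<and>
     (\<forall>g\<in>U. \<exists>V p q. openin (GL_top n) V \<and> g \<in> V \<and> V \<subseteq> U \<and> p \<in> poly_fun n \<and> q \<in> poly_fun n \<and>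
        (\<forall>h\<in>V. q h \<noteq> 0 \<and> f h = p h / q h))"

text \<open>A point of the flag variety is a left coset of the Borel subgroup.\<close>

definition coset_of :: "nat \<Rightarrow> complex mat \<Rightarrow> complex mat set" where
  "coset_of n g = g <#\<^bsub>GL n\<^esub> borel_group n"

definition flags :: "nat \<Rightarrow> complex mat set set" where
  "flags n = lcosets\<^bsub>GL n\<^esub> (borel_group n)"

definition flag_open :: "nat \<Rightarrow> complex mat set set \<Rightarrow> bool" where
  "flag_open n U \<longleftrightarrow> U \<subseteq> flags n \<and> openin (GL_top n) {g \<in> carrier (GL n). coset_of n g \<in> U}"

lemma istopology_flag_open: "istopology (flag_open n)"
  unfolding istopology_def
proof (rule conjI; intro allI impI)
  fix S T assume S: "flag_open n S" and T: "flag_open n T"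
  have *: "{g \<in> carrier (GL n). coset_of n g \<in> S \<inter> T} =
      {g \<in> carrier (GL n). coset_of n g \<in> S} \<inter> {g \<in> carrier (GL n). coset_of n g \<in> T}"
    by blast
  show "flag_open n (S \<inter> T)"
    using S T unfolding flag_open_def * by (simp add: openin_Int le_infI1)
next
  fix K assume "\<forall>S\<in>K. flag_open n S"
  then have K: "\<And>S. S \<in> K \<Longrightarrow> S \<subseteq> flags n"
    "\<And>S. S \<in> K \<Longrightarrow> openin (GL_top n) {g \<in> carrier (GL n). coset_of n g \<in> S}"
    unfolding flag_open_def by simp_all
  have *: "{g \<in> carrier (GL n). coset_of n g \<in> \<Union>K} =
      \<Union>((\<lambda>S. {g \<in> carrier (GL n). coset_of n g \<in> S}) ` K)"
    by blast
  have "openin (GL_top n) {g \<in> carrier (GL n). coset_of n g \<in> \<Union>K}"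
    unfolding * by (rule openin_Union) (use K(2) in \<open>elim imageE; simp\<close>)
  moreover have "\<Union>K \<subseteq> flags n" using K(1) by (rule Union_least)
  ultimately show "flag_open n (\<Union>K)" unfolding flag_open_def by (rule conjI[rotated])
qed

definition flag_top :: "nat \<Rightarrow> complex mat set topology" where
  "flag_top n = topology (flag_open n)"

lemma openin_flag_top: "openin (flag_top n) = flag_open n"
  unfolding flag_top_def by (rule topology_inverse'[OF istopology_flag_open])

text \<open>
  The structure sheaf of the quotient: regular functions are those whose pullbacks to the group
  are regular.
\<close>

definition flag_sheaf :: "nat \<Rightarrow> complex mat set function_sheaf" where
  "flag_sheaf n U f \<longleftrightarrow> openin (flag_top n) U \<and>
     GL_sheaf n {g \<in> carrier (GL n). coset_of n g \<in> U} (\<lambda>g. f (coset_of n g))"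

text \<open>Smoothness of a closed subvariety of the flag variety, with its reduced structure.\<close>

definition smooth_at_point :: "nat \<Rightarrow> complex mat set set \<Rightarrow> complex mat set \<Rightarrow> bool" where
  "smooth_at_point n Y y \<longleftrightarrow>
     smooth_at (subtopology (flag_top n) Y) (subspace_sheaf (flag_top n) (flag_sheaf n) Y) y"

definition smooth_subvariety :: "nat \<Rightarrow> complex mat set set \<Rightarrow> bool" where
  "smooth_subvariety n Y \<longleftrightarrow> (\<forall>y\<in>Y. smooth_at_point n Y y)"

section \<open>Permutations, Bruhat order and Schubert varieties\<close>

text \<open>
  Elements of the symmetric group are functions \<open>w\<close> with \<open>w permutes {0..<n}\<close>; the one-line
  notation is \<open>w 0, \<dots>, w (n - 1)\<close>.
\<close>

definition perm_length :: "nat \<Rightarrow> (nat \<Rightarrow> nat) \<Rightarrow> nat" where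
  "perm_length n w = card {(i, j). i < j \<and> j < n \<and> w j < w i}"

definition bruhat_step :: "nat \<Rightarrow> (nat \<Rightarrow> nat) \<Rightarrow> (nat \<Rightarrow> nat) \<Rightarrow> bool" where
  "bruhat_step n u v \<longleftrightarrow>
     (\<exists>a<n. \<exists>b<n. v = Transposition.transpose a b \<circ> u \<and> perm_length n u < perm_length n v)"

definition bruhat_le :: "nat \<Rightarrow> (nat \<Rightarrow> nat) \<Rightarrow> (nat \<Rightarrow> nat) \<Rightarrow> bool" where
  "bruhat_le n = (bruhat_step n)\<^sup>*\<^sup>*"

text \<open>The \<open>j\<close>-th column is the standard basis vector with index \<open>w j\<close>.\<close>

definition perm_mat :: "nat \<Rightarrow> (nat \<Rightarrow> nat) \<Rightarrow> complex mat" where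
  "perm_mat n w = mat n n (\<lambda>(i, j). if i = w j then 1 else 0)"

definition perm_point :: "nat \<Rightarrow> (nat \<Rightarrow> nat) \<Rightarrow> complex mat set" where
  "perm_point n w = coset_of n (perm_mat n w)"

text \<open>The set \<open>t <# x\<close> is the left translate of the coset \<open>x\<close> by \<open>t\<close>.\<close>

definition schubert_variety :: "nat \<Rightarrow> (nat \<Rightarrow> nat) \<Rightarrow> complex mat set set" where
  "schubert_variety n w =
     flag_top n closure_of {b <#\<^bsub>GL n\<^esub> perm_point n w | b. b \<in> borel_group n}"

definition torus_orbit :: "nat \<Rightarrow> complex mat set \<Rightarrow> complex mat set set" where
  "torus_orbit n x = {t <#\<^bsub>GL n\<^esub> x | t. t \<in> diag_torus n}"

definition torus_fixed_points :: "nat \<Rightarrow> complex mat set set \<Rightarrow> complex mat set set" where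
  "torus_fixed_points n X = {x \<in> X. \<forall>t\<in>diag_torus n. t <#\<^bsub>GL n\<^esub> x = x}"

definition generic_torus_orbit :: "nat \<Rightarrow> (nat \<Rightarrow> nat) \<Rightarrow> complex mat set set \<Rightarrow> bool" where
  "generic_torus_orbit n w Orb \<longleftrightarrow>
     (\<exists>x\<in>schubert_variety n w. Orb = torus_orbit n x) \<and>
     torus_fixed_points n (schubert_variety n w) \<subseteq> flag_top n closure_of Orb"

section \<open>The graph attached to a pair of permutations\<close>

definition Etilde :: "nat \<Rightarrow> (nat \<Rightarrow> nat) \<Rightarrow> (nat \<Rightarrow> nat) \<Rightarrow> (nat \<times> nat) set" where
  "Etilde n w u = {(u i, u j) | i j. i < j \<and> j < n \<and>
     bruhat_le n (Transposition.transpose (u i) (u j) \<circ> u) w \<and>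
     \<bar>int (perm_length n u) - int (perm_length n (Transposition.transpose (u i) (u j) \<circ> u))\<bar> = 1}"

text \<open>
  With \<open>(a, b) + (b, c) = (a, c)\<close>, the sums of one or more elements of a set \<open>S\<close> of pairs form the
  transitive closure of \<open>S\<close>.
\<close>

definition decomposable :: "(nat \<times> nat) set \<Rightarrow> nat \<times> nat \<Rightarrow> bool" where
  "decomposable S e \<longleftrightarrow> e \<in> (S - {e})\<^sup>+"

definition Eindec :: "nat \<Rightarrow> (nat \<Rightarrow> nat) \<Rightarrow> (nat \<Rightarrow> nat) \<Rightarrow> (nat \<times> nat) set" where
  "Eindec n w u = {e \<in> Etilde n w u. \<not> decomposable (Etilde n w u) e}"

text \<open>Directed graphs are pairs of a vertex set and an edge set.\<close>

definition Gamma :: "nat \<Rightarrow> (nat \<Rightarrow> nat) \<Rightarrow> (nat \<Rightarrow> nat) \<Rightarrow> nat set \<times> (nat \<times> nat) set" where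
  "Gamma n w u = (fst ` Eindec n w u \<union> snd ` Eindec n w u, Eindec n w u)"

text \<open>
  The underlying undirected graph is taken to be simple: opposite edges do not count as a cycle.
  (\<open>Gamma n w u\<close> has neither loops nor opposite edges.)
\<close>

definition is_forest :: "'v set \<times> ('v \<times> 'v) set \<Rightarrow> bool" where
  "is_forest G \<longleftrightarrow> \<not> (\<exists>vs. 3 \<le> length vs \<and> distinct vs \<and> set vs \<subseteq> fst G \<and>
     (\<forall>i<length vs. let a = vs ! i; b = vs ! (Suc i mod length vs)
        in (a, b) \<in> snd G \<or> (b, a) \<in> snd G))"

end

theory Submission
  imports Defs "Jordan_Normal_Form.Determinant"
begin

text \<open>
  Around the fixed point of \<open>u\<close> the flag variety is the affine space \<open>u U\<^sup>-\<close>, on which the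
  torus scales the coordinate belonging to a pair of values \<open>(b, a)\<close> by \<open>t a / t b\<close>. So \<open>Y\<close> is
  there the toric variety of the semigroup generated by the pairs in the support of a point of the
  orbit. The coordinates in the support are minors, which compares the support with the Bruhat
  order: it contains \<open>Etilde\<close>, and an indecomposable pair in the support spans a torus-stable curve
  in \<open>Y\<close> joining the fixed points of \<open>u\<close> and \<open>t\<^sub>a\<^sub>b u\<close>, hence lies in \<open>Etilde\<close>. Both sets
  therefore have the same indecomposable pairs.

  The indecomposable pairs contribute independent tangent vectors at the fixed point (along the
  torus-stable curves), whereas the local dimension is at most the rank of the lattice spanned by
  the pairs: a chain of irreducible sets yields algebraically independent functions, and these are
  Laurent polynomials in the characters of a spanning set. A cycle makes the rank smaller than the
  number of indecomposable pairs. For a forest the edge coordinates are independent and identify the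
  whole chart of \<open>Y\<close> with an affine space. Finally every point of \<open>Y\<close> lies in the chart of some
  fixed point of \<open>Y\<close>, because Gaussian elimination puts it in some chart, which contracts to its
  fixed point under the torus.
\<close>

section \<open>The general linear group and its flag variety\<close>

text \<open>The comparison with \<open>Etilde\<close> goes through indecomposable pairs because the
  support may also contain pairs whose swap changes the length by more than one; these are missing
  from \<open>Etilde\<close>. The dimension is bounded from above by counting. The d functions
  attached to a chain of length d have (k + 1) ^ d linearly independent monomials with exponents at
  most k. Pulled back to the torus, they all lie in the span of (C * k + 1) ^ r Laurent monomials,
  and letting k grow forces d \<le> r. The unknown degrees of the chain functions only enter C. The
  same bound serves both directions: with all edges for a forest, and without one edge of a cycle
  otherwise. Limits are taken algebraically: a curve with polynomial entries that lies in a closed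
  set for all but finitely many parameters lies in it entirely. Identities between coordinates are
  checked on the orbit and carried to the whole chart of \<open>Y\<close> by density.\<close>

lemma carrier_GL: "carrier (GL n) = {A \<in> carrier_mat n n. det A \<noteq> 0}"
proof -
  have "Units (ring_mat TYPE(complex) n ()) \<subseteq> carrier_mat n n"
    by (auto simp: Units_def ring_mat_def)
  then show ?thesis
    using unit_imp_det_non_zero[where 'a = complex and n = n and b = "()"]
      det_non_zero_imp_unit[where 'a = complex and n = n and b = "()"]
    by (auto simp: GL_def units_of_def)
qed

lemma GL_carrier_mat: "A \<in> carrier (GL n) \<Longrightarrow> A \<in> carrier_mat n n"
  by (simp add: carrier_GL)

lemma GL_mult: "x \<otimes>\<^bsub>GL n\<^esub> y = x * y"
  by (simp add: GL_def units_of_def ring_mat_def)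

lemma GL_mult_closed: "A \<in> carrier (GL n) \<Longrightarrow> B \<in> carrier (GL n) \<Longrightarrow> A * B \<in> carrier (GL n)"
  by (auto simp: carrier_GL det_mult)

lemma borel_group_eq:
  "borel_group n = {b \<in> carrier_mat n n. det b \<noteq> 0 \<and> (\<forall>i<n. \<forall>j<i. b $$ (i, j) = 0)}"
  by (auto simp: borel_group_def carrier_GL upper_triangular_def)

lemma borel_GL: "b \<in> borel_group n \<Longrightarrow> b \<in> carrier (GL n)"
  by (simp add: borel_group_def)

lemma borel_carrier_mat: "b \<in> borel_group n \<Longrightarrow> b \<in> carrier_mat n n"
  by (simp add: borel_group_eq)

lemma borel_diag_nonzero:
  assumes "b \<in> borel_group n" "i < n" shows "b $$ (i, i) \<noteq> 0"
proof -
  have b: "b \<in> carrier_mat n n" "upper_triangular b" "det b \<noteq> 0"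
    using assms by (auto simp: borel_group_def carrier_GL)
  have "0 \<notin> set (diag_mat b)"
    using upper_triangular_imp_det_eq_0_iff[OF b(1,2)] b(3) by blast
  then show ?thesis using assms(2) b(1) by (auto simp: diag_mat_def)
qed

lemma borelI:
  assumes "b \<in> carrier_mat n n" "\<And>i j. j < i \<Longrightarrow> i < n \<Longrightarrow> b $$ (i, j) = 0"
    "\<And>i. i < n \<Longrightarrow> b $$ (i, i) \<noteq> 0"
  shows "b \<in> borel_group n"
proof -
  have ut: "upper_triangular b" using assms by auto
  have "0 \<notin> set (diag_mat b)" using assms by (auto simp: diag_mat_def)
  then have "det b \<noteq> 0" using upper_triangular_imp_det_eq_0_iff[OF assms(1) ut] by blast
  then show ?thesis using assms by (auto simp: borel_group_eq)
qed

lemma index_mult_mat_sum: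
  assumes "A \<in> carrier_mat n n" "B \<in> carrier_mat n n" "i < n" "j < n"
  shows "(A * B) $$ (i, j) = (\<Sum>k<n. A $$ (i, k) * B $$ (k, j))"
  using assms by (auto simp: scalar_prod_def atLeast0LessThan intro!: sum.cong)

lemma borel_mult:
  assumes "b \<in> borel_group n" "c \<in> borel_group n" shows "b * c \<in> borel_group n"
proof -
  have b: "b \<in> carrier_mat n n" "c \<in> carrier_mat n n" "det (b * c) \<noteq> 0"
    using assms by (auto simp: borel_group_eq det_mult)
  have "(b * c) $$ (i, j) = 0" if "i < n" "j < i" for i j
  proof -
    have "(b * c) $$ (i, j) = (\<Sum>k<n. b $$ (i, k) * c $$ (k, j))"
      using index_mult_mat_sum[OF b(1,2)] that by simp
    also have "\<dots> = 0"
    proof (intro sum.neutral ballI)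
      fix k assume "k \<in> {..<n}"
      show "b $$ (i, k) * c $$ (k, j) = 0"
        using assms that \<open>k \<in> {..<n}\<close> by (cases "k < i") (auto simp: borel_group_eq)
    qed
    finally show ?thesis .
  qed
  then show ?thesis using b by (auto simp: borel_group_eq)
qed

lemma one_mat_borel: "1\<^sub>m n \<in> borel_group n"
  by (auto simp: borel_group_eq)

text \<open>The inverse in the matrix ring is triangular too: in row \<open>i\<close> of
  \<open>c * b = 1\<close>, once the entries of \<open>c\<close> to the left of column
  \<open>j\<close> vanish, the product at \<open>(i, j)\<close> reduces to
  \<open>c $$ (i, j) * b $$ (j, j)\<close>.\<close>

lemma borel_inverse:
  assumes "b \<in> borel_group n"
  obtains c where "c \<in> borel_group n" "b * c = 1\<^sub>m n" "c * b = 1\<^sub>m n"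
proof -
  have b: "b \<in> carrier_mat n n" "det b \<noteq> 0" using assms by (auto simp: borel_group_eq)
  from det_non_zero_imp_unit[OF b, where b = "()"]
  obtain c where c: "c \<in> carrier_mat n n" "b * c = 1\<^sub>m n" "c * b = 1\<^sub>m n"
    by (auto simp: Units_def ring_mat_def)
  have "c $$ (i, j) = 0" if "j < i" "i < n" for i j
    using that
  proof (induction j rule: less_induct)
    case (less j)
    have "(\<Sum>k<n. c $$ (i, k) * b $$ (k, j)) = 0"
      using index_mult_mat_sum[OF c(1) b(1), of i j] c(3) less.prems by simp
    moreover have "(\<Sum>k<n. c $$ (i, k) * b $$ (k, j)) = (\<Sum>k\<in>{j}. c $$ (i, k) * b $$ (k, j))"
    proof (rule sum.mono_neutral_right)
      show "\<forall>k\<in>{..<n} - {j}. c $$ (i, k) * b $$ (k, j) = 0"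
      proof
        fix k assume k: "k \<in> {..<n} - {j}"
        show "c $$ (i, k) * b $$ (k, j) = 0"
        proof (cases "k < j")
          case True
          then show ?thesis using less.IH[of k] less.prems by simp
        next
          case False
          then show ?thesis using k assms by (auto simp: borel_group_eq)
        qed
      qed
    qed (use less.prems in auto)
    ultimately show ?case using borel_diag_nonzero[OF assms, of j] less.prems by auto
  qed
  moreover have "det c \<noteq> 0" using arg_cong[OF c(2), of det] b c(1) by (auto simp: det_mult)
  ultimately have "c \<in> borel_group n" using c by (auto simp: borel_group_eq)
  then show ?thesis using that c by blast
qed

lemma coset_of_eq: "coset_of n g = (\<lambda>b. g * b) ` borel_group n"
  by (auto simp: coset_of_def l_coset_def GL_mult)

lemma translate_eq: "t <#\<^bsub>GL n\<^esub> X = (\<lambda>x. t * x) ` X"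
  by (auto simp: l_coset_def GL_mult)

lemma translate_coset_of:
  assumes "t \<in> carrier_mat n n" "g \<in> carrier_mat n n"
  shows "t <#\<^bsub>GL n\<^esub> coset_of n g = coset_of n (t * g)"
  unfolding translate_eq coset_of_eq image_image
  by (intro image_cong refl assoc_mult_mat[OF assms borel_carrier_mat, symmetric])

lemma coset_of_mult_borel:
  assumes g: "g \<in> carrier_mat n n" and b: "b \<in> borel_group n"
  shows "coset_of n (g * b) = coset_of n g"
proof -
  obtain c where c: "c \<in> borel_group n" "b * c = 1\<^sub>m n" using borel_inverse[OF b] by blast
  have 1: "(g * b) * x = g * (b * x)" if "x \<in> borel_group n" for x
    by (rule assoc_mult_mat[OF g borel_carrier_mat[OF b] borel_carrier_mat[OF that]])
  have "g * x = (g * b) * (c * x)" if "x \<in> borel_group n" for x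
  proof -
    have m: "b \<in> carrier_mat n n" "c \<in> carrier_mat n n" "x \<in> carrier_mat n n"
      using that b c by (auto simp: borel_carrier_mat)
    have "(g * b) * (c * x) = g * (b * (c * x))" using m g by (intro assoc_mult_mat) auto
    also have "b * (c * x) = (b * c) * x" using m by (intro assoc_mult_mat[symmetric])
    also have "\<dots> = x" using c m by simp
    finally show ?thesis by simp
  qed
  then have "g * x \<in> (*) (g * b) ` borel_group n" if "x \<in> borel_group n" for x
    using that borel_mult[OF c(1) that] by auto
  moreover have "g * b * x \<in> (*) g ` borel_group n" if "x \<in> borel_group n" for x
    using 1[OF that] borel_mult[OF b that] by auto
  ultimately show ?thesis unfolding coset_of_eq by blast
qed

lemma coset_of_eqD:
  assumes "h \<in> carrier_mat n n" "coset_of n g = coset_of n h"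
  obtains b where "b \<in> borel_group n" "h = g * b"
proof -
  have "h * 1\<^sub>m n \<in> coset_of n h" using one_mat_borel by (auto simp: coset_of_eq)
  then have "h \<in> coset_of n g" using assms by simp
  then show ?thesis using that by (auto simp: coset_of_eq)
qed

lemma flags_eq: "flags n = coset_of n ` carrier (GL n)"
  by (auto simp: flags_def LCOSETS_def coset_of_def)

section \<open>Minors in the leading columns\<close>

text \<open>These are Pluecker coordinates of the flag: only leading columns are used, because right
  multiplication by the Borel group merely rescales such minors. The rows are listed by a function,
  so that one row can be exchanged by a function update.\<close>

definition minor :: "nat \<Rightarrow> (nat \<Rightarrow> nat) \<Rightarrow> complex mat \<Rightarrow> complex" where
  "minor m \<sigma> g = det (mat m m (\<lambda>(r, c). g $$ (\<sigma> r, c)))"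

lemma poly_fun_sum: "finite I \<Longrightarrow> (\<And>i. i \<in> I \<Longrightarrow> f i \<in> poly_fun n) \<Longrightarrow> (\<lambda>A. \<Sum>i\<in>I. f i A) \<in> poly_fun n"
  by (induction I rule: finite_induct) (auto intro: poly_fun.intros)

lemma poly_fun_prod: "finite I \<Longrightarrow> (\<And>i. i \<in> I \<Longrightarrow> f i \<in> poly_fun n) \<Longrightarrow> (\<lambda>A. \<Prod>i\<in>I. f i A) \<in> poly_fun n"
  by (induction I rule: finite_induct) (auto intro: poly_fun.intros)

lemma poly_fun_diff: "p \<in> poly_fun n \<Longrightarrow> q \<in> poly_fun n \<Longrightarrow> (\<lambda>A. p A - q A) \<in> poly_fun n"
proof -
  assume "p \<in> poly_fun n" "q \<in> poly_fun n"
  from poly_fun.add[OF this(1) poly_fun.mult[OF poly_fun.const[of "-1"] this(2)]]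
  show ?thesis by simp
qed

lemma minor_leibniz:
  "minor m \<sigma> g = (\<Sum>\<pi> | \<pi> permutes {0..<m}. signof \<pi> * (\<Prod>i=0..<m. g $$ (\<sigma> i, \<pi> i)))"
proof -
  have "(\<Prod>i=0..<m. mat m m (\<lambda>(r, c). g $$ (\<sigma> r, c)) $$ (i, \<pi> i)) = (\<Prod>i=0..<m. g $$ (\<sigma> i, \<pi> i))"
    if "\<pi> permutes {0..<m}" for \<pi>
    using permutes_in_image[OF that] by (intro prod.cong) auto
  then show ?thesis
    unfolding minor_def by (subst det_def'[where n = m]) (auto intro!: sum.cong)
qed

lemma minor_poly_fun:
  assumes "m \<le> n" "\<And>r. r < m \<Longrightarrow> \<sigma> r < n"
  shows "minor m \<sigma> \<in> poly_fun n"
proof -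
  have "(\<lambda>g. \<Sum>\<pi> | \<pi> permutes {0..<m}. signof \<pi> * (\<Prod>i=0..<m. g $$ (\<sigma> i, \<pi> i))) \<in> poly_fun n"
  proof (intro poly_fun_sum poly_fun.mult poly_fun_prod poly_fun.const poly_fun.entry)
    fix \<pi> i assume "\<pi> \<in> {\<pi>. \<pi> permutes {0..<m}}" "i \<in> {0..<m}"
    then have "\<pi> i < m" using permutes_in_image[of \<pi> "{0..<m}" i] by simp
    then show "\<pi> i < n" using assms(1) by simp
    show "\<sigma> i < n" using assms(2) \<open>i \<in> {0..<m}\<close> by simp
  qed (auto simp: finite_permutations)
  then show ?thesis by (simp add: minor_leibniz[abs_def])
qed

text \<open>An upper triangular \<open>b\<close> mixes the first \<open>m\<close> columns only among
  themselves, so the submatrix of \<open>g * b\<close> is that of \<open>g\<close> times the leading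
  block of \<open>b\<close>.\<close>

lemma minor_mult_borel:
  assumes g: "g \<in> carrier_mat n n" and b: "b \<in> borel_group n" and m: "m \<le> n"
    and \<sigma>: "\<And>r. r < m \<Longrightarrow> \<sigma> r < n"
  shows "minor m \<sigma> (g * b) = minor m \<sigma> g * (\<Prod>c<m. b $$ (c, c))"
proof -
  let ?G = "mat m m (\<lambda>(r, c). g $$ (\<sigma> r, c))" and ?B = "mat m m (\<lambda>(r, c). b $$ (r, c))"
  have "mat m m (\<lambda>(r, c). (g * b) $$ (\<sigma> r, c)) = ?G * ?B"
  proof (rule eq_matI)
    fix i j assume ij: "i < dim_row (?G * ?B)" "j < dim_col (?G * ?B)"
    have "(g * b) $$ (\<sigma> i, j) = (\<Sum>k<n. g $$ (\<sigma> i, k) * b $$ (k, j))"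
      using index_mult_mat_sum[OF g borel_carrier_mat[OF b]] ij m \<sigma> by simp
    also have "\<dots> = (\<Sum>k<m. g $$ (\<sigma> i, k) * b $$ (k, j))"
      using b ij m by (intro sum.mono_neutral_right) (auto simp: borel_group_eq)
    also have "\<dots> = (?G * ?B) $$ (i, j)"
      using index_mult_mat_sum[of ?G m ?B i j] ij by simp
    finally show "mat m m (\<lambda>(r, c). (g * b) $$ (\<sigma> r, c)) $$ (i, j) = (?G * ?B) $$ (i, j)"
      using ij by simp
  qed auto
  moreover have "det ?B = (\<Prod>c<m. b $$ (c, c))"
  proof -
    have "upper_triangular ?B" using b m by (auto simp: borel_group_eq)
    then have "det ?B = prod_list (diag_mat ?B)" by (rule det_upper_triangular) auto
    then show ?thesis by (simp add: prod_list_diag_prod atLeast0LessThan)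
  qed
  ultimately show ?thesis unfolding minor_def by (simp add: det_mult[where n = m])
qed

section \<open>Slices and charts\<close>

text \<open>The slice at \<open>u\<close> is \<open>u U\<^sup>-\<close> with \<open>U\<^sup>-\<close> the lower unitriangular matrices; cosets of its
  elements form the open chart around the fixed point of \<open>u\<close>.\<close>

definition slice :: "nat \<Rightarrow> (nat \<Rightarrow> nat) \<Rightarrow> complex mat set" where
  "slice n u = {A \<in> carrier_mat n n. \<forall>i<n. \<forall>j<n. i \<le> j \<longrightarrow> A $$ (u i, j) = (if i = j then 1 else 0)}"

text \<open>A quotient of minors of equal size is constant on cosets, and on a slice matrix it is
  the entry \<open>(a, j)\<close> over 1. So this recovers the slice representative from any matrix
  of its coset. The update \<open>u(j := a)\<close> exchanges the last of the rows
  \<open>u 0, ..., u j\<close>.\<close>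

definition chart_coord :: "nat \<Rightarrow> (nat \<Rightarrow> nat) \<Rightarrow> complex mat \<Rightarrow> complex mat" where
  "chart_coord n u g = mat n n (\<lambda>(a, j). minor (Suc j) (u(j := a)) g / minor (Suc j) u g)"

lemma slice_carrier_mat: "A \<in> slice n u \<Longrightarrow> A \<in> carrier_mat n n"
  by (simp add: slice_def)

lemma minor_lower_triangular:
  assumes "\<And>i j. i < j \<Longrightarrow> j < m \<Longrightarrow> A $$ (\<sigma> i, j) = 0"
  shows "minor m \<sigma> A = (\<Prod>c<m. A $$ (\<sigma> c, c))"
proof -
  let ?M = "mat m m (\<lambda>(r, c). A $$ (\<sigma> r, c))"
  have "det ?M = prod_list (diag_mat ?M)"
    by (rule det_lower_triangular[where n = m]) (use assms in auto)
  then show ?thesis by (simp add: minor_def prod_list_diag_prod atLeast0LessThan)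
qed

lemma permutes_lessD:
  fixes n :: nat
  shows "u permutes {0..<n} \<Longrightarrow> i < n \<Longrightarrow> u i < n"
  using permutes_in_image[of u "{0..<n}" i] by simp

text \<open>The chosen rows form a lower triangular matrix with diagonal
  \<open>1, ..., 1, A $$ (a, j)\<close>: the exchanged row is the last one, so it has no entry above
  the diagonal.\<close>

lemma minor_slice_update:
  assumes "A \<in> slice n u" "j < n"
  shows "minor (Suc j) (u(j := a)) A = A $$ (a, j)"
proof -
  have "minor (Suc j) (u(j := a)) A = (\<Prod>c<Suc j. A $$ ((u(j := a)) c, c))"
    by (rule minor_lower_triangular) (use assms in \<open>auto simp: slice_def\<close>)
  also have "\<dots> = A $$ (a, j) * (\<Prod>c<j. A $$ (u c, c))" by (simp add: lessThan_Suc)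
  also have "(\<Prod>c<j. A $$ (u c, c)) = 1"
    using assms by (intro prod.neutral) (auto simp: slice_def)
  finally show ?thesis by (simp only: mult_1_right)
qed

lemma minor_slice:
  assumes "A \<in> slice n u" "m \<le> n"
  shows "minor m u A = 1"
proof -
  have "minor m u A = (\<Prod>c<m. A $$ (u c, c))"
    by (rule minor_lower_triangular) (use assms in \<open>auto simp: slice_def\<close>)
  also have "\<dots> = 1" using assms by (intro prod.neutral) (auto simp: slice_def)
  finally show ?thesis .
qed

lemma slice_GL:
  assumes "u permutes {0..<n}" "A \<in> slice n u" shows "A \<in> carrier (GL n)"
proof -
  have "1 = signof u * det A"
    using det_permute_rows[of A n u] minor_slice[OF assms(2), of n] assms
    by (simp add: minor_def slice_carrier_mat)
  then show ?thesis using slice_carrier_mat[OF assms(2)] by (auto simp: carrier_GL)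
qed

lemma chart_coord_slice_borel:
  assumes u: "u permutes {0..<n}" and A: "A \<in> slice n u" and b: "b \<in> borel_group n"
  shows "chart_coord n u (A * b) = A"
proof (rule eq_matI)
  have Ac: "A \<in> carrier_mat n n" using A by (simp add: slice_carrier_mat)
  fix a j assume aj: "a < dim_row A" "j < dim_col A"
  then have aj: "a < n" "j < n" using Ac by auto
  have "minor (Suc j) (u(j := a)) (A * b) = minor (Suc j) (u(j := a)) A * (\<Prod>c<Suc j. b $$ (c, c))"
    by (rule minor_mult_borel[OF Ac b]) (use aj permutes_lessD[OF u] in auto)
  moreover have "minor (Suc j) u (A * b) = minor (Suc j) u A * (\<Prod>c<Suc j. b $$ (c, c))"
    by (rule minor_mult_borel[OF Ac b]) (use aj permutes_lessD[OF u] in auto)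
  moreover have "(\<Prod>c<Suc j. b $$ (c, c)) \<noteq> 0" using aj borel_diag_nonzero[OF b] by auto
  ultimately show "chart_coord n u (A * b) $$ (a, j) = A $$ (a, j)"
    using aj minor_slice_update[OF A] minor_slice[OF A, of "Suc j"] by (simp add: chart_coord_def)
qed (use slice_carrier_mat[OF A] in \<open>auto simp: chart_coord_def\<close>)

lemma minor_slice_borel_nonzero:
  assumes u: "u permutes {0..<n}" and A: "A \<in> slice n u" and b: "b \<in> borel_group n" and "m \<le> n"
  shows "minor m u (A * b) \<noteq> 0"
  using minor_mult_borel[OF slice_carrier_mat[OF A] b \<open>m \<le> n\<close>, of u] minor_slice[OF A \<open>m \<le> n\<close>]
    borel_diag_nonzero[OF b] permutes_lessD[OF u] \<open>m \<le> n\<close> by auto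

lemma coset_of_slice_inj:
  assumes u: "u permutes {0..<n}" and "A \<in> slice n u" "B \<in> slice n u" "coset_of n A = coset_of n B"
  shows "A = B"
proof -
  obtain b where b: "b \<in> borel_group n" "B = A * b"
    using coset_of_eqD[OF slice_carrier_mat[OF assms(3)] assms(4)] by blast
  have "chart_coord n u (B * 1\<^sub>m n) = B" by (rule chart_coord_slice_borel[OF u assms(3) one_mat_borel])
  moreover have "B * 1\<^sub>m n = B" using slice_carrier_mat[OF assms(3)] by simp
  ultimately show ?thesis using chart_coord_slice_borel[OF u assms(2) b(1)] b(2) by metis
qed

text \<open>The state of Gaussian elimination by columns after \<open>r\<close> pivots. Only the
  values of \<open>u\<close> below \<open>r\<close> matter, so pivot rows can be recorded as they
  are found.\<close>

definition partial_slice :: "nat \<Rightarrow> (nat \<Rightarrow> nat) \<Rightarrow> nat \<Rightarrow> complex mat set" where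
  "partial_slice n u r = {A \<in> carrier_mat n n.
     \<forall>i<r. u i < n \<and> (\<forall>j<n. i \<le> j \<longrightarrow> A $$ (u i, j) = (if i = j then 1 else 0))}"

text \<open>Normalising the pivot and clearing its row to the right only adds multiples of column
  \<open>r\<close> to later columns, which is right multiplication by an upper triangular matrix.
  Earlier pivot rows survive because they vanish in column \<open>r\<close>.\<close>

lemma elimination_step:
  assumes h: "h \<in> partial_slice n u r" and r: "r < n" and p: "p < n" and piv: "h $$ (p, r) \<noteq> 0"
  obtains b where "b \<in> borel_group n" "h * b \<in> partial_slice n (u(r := p)) (Suc r)"
proof
  define b where "b = mat n n (\<lambda>(i, c). if i = c then (if c = r then 1 / h $$ (p, r) else 1)
    else if i = r \<and> r < c then - h $$ (p, c) / h $$ (p, r) else 0)"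
  show b: "b \<in> borel_group n" by (rule borelI) (use piv in \<open>auto simp: b_def\<close>)
  have hc: "h \<in> carrier_mat n n" using h by (simp add: partial_slice_def)
  have hb: "(h * b) $$ (i, c) = (if c < r then h $$ (i, c) else if c = r then h $$ (i, r) / h $$ (p, r)
      else h $$ (i, c) - h $$ (i, r) * h $$ (p, c) / h $$ (p, r))" if "i < n" "c < n" for i c
  proof -
    have "(h * b) $$ (i, c) = (\<Sum>k<n. h $$ (i, k) * b $$ (k, c))"
      using index_mult_mat_sum[OF hc borel_carrier_mat[OF b]] that by simp
    also have "\<dots> = (\<Sum>k\<in>{c, r}. h $$ (i, k) * b $$ (k, c))"
      using that r by (intro sum.mono_neutral_right) (auto simp: b_def)
    also have "\<dots> = (if c < r then h $$ (i, c) else if c = r then h $$ (i, r) / h $$ (p, r)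
      else h $$ (i, c) - h $$ (i, r) * h $$ (p, c) / h $$ (p, r))"
      using that r by (cases "c = r") (auto simp: b_def)
    finally show ?thesis .
  qed
  show "h * b \<in> partial_slice n (u(r := p)) (Suc r)"
    using h hb p r piv borel_carrier_mat[OF b] hc
    by (auto simp: partial_slice_def less_Suc_eq)
qed

text \<open>Elimination with the prescribed pivot rows \<open>u 0, u 1, ...\<close>. After
  \<open>r\<close> steps the minor of size \<open>Suc r\<close> is a product of diagonal entries
  containing the next pivot, and it is still nonzero because Borel factors only rescale it.\<close>

lemma LU_decomposition:
  assumes u: "u permutes {0..<n}" and g: "g \<in> carrier_mat n n"
    and nz: "\<And>j. j < n \<Longrightarrow> minor (Suc j) u g \<noteq> 0"
  obtains b where "b \<in> borel_group n" "g * b \<in> slice n u"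
proof -
  have "\<exists>b\<in>borel_group n. g * b \<in> partial_slice n u r" if "r \<le> n" for r
    using that
  proof (induction r)
    case 0
    then show ?case using one_mat_borel g by (auto simp: partial_slice_def intro!: bexI[of _ "1\<^sub>m n"])
  next
    case (Suc r)
    then obtain b where b: "b \<in> borel_group n" "g * b \<in> partial_slice n u r" by auto
    have "minor (Suc r) u (g * b) = (\<Prod>c<Suc r. (g * b) $$ (u c, c))"
      by (rule minor_lower_triangular) (use b Suc.prems in \<open>auto simp: partial_slice_def\<close>)
    moreover have "minor (Suc r) u (g * b) = minor (Suc r) u g * (\<Prod>c<Suc r. b $$ (c, c))"
      by (rule minor_mult_borel[OF g b(1)]) (use Suc.prems permutes_lessD[OF u] in auto)
    moreover have "\<dots> \<noteq> 0" using nz[of r] Suc.prems borel_diag_nonzero[OF b(1)] by auto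
    ultimately have "(g * b) $$ (u r, r) \<noteq> 0" by (auto simp del: index_mult_mat)
    then obtain c where c: "c \<in> borel_group n" "(g * b) * c \<in> partial_slice n (u(r := u r)) (Suc r)"
      using elimination_step[OF b(2), of "u r"] Suc.prems permutes_lessD[OF u] by auto
    moreover have "g * b * c = g * (b * c)"
      by (rule assoc_mult_mat[OF g borel_carrier_mat[OF b(1)] borel_carrier_mat[OF c(1)]])
    ultimately show ?case using borel_mult[OF b(1) c(1)] by (metis fun_upd_triv)
  qed
  from this[OF order_refl] obtain b where "b \<in> borel_group n" "g * b \<in> partial_slice n u n" by blast
  then show ?thesis using that by (auto simp: partial_slice_def slice_def)
qed

text \<open>With a free choice of pivot rows, invertibility suffices: a zero column would kill the
  determinant. Distinct steps use distinct rows, since an earlier pivot row vanishes in the later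
  pivot column.\<close>

lemma PLU_decomposition:
  assumes g: "g \<in> carrier (GL n)"
  obtains u b where "u permutes {0..<n}" "b \<in> borel_group n" "g * b \<in> slice n u"
proof -
  have gc: "g \<in> carrier_mat n n" using g by (simp add: GL_carrier_mat)
  have "\<exists>u. \<exists>b\<in>borel_group n. g * b \<in> partial_slice n u r" if "r \<le> n" for r
    using that
  proof (induction r)
    case 0
    then show ?case using one_mat_borel gc by (auto simp: partial_slice_def intro!: bexI[of _ "1\<^sub>m n"])
  next
    case (Suc r)
    then obtain u b where b: "b \<in> borel_group n" "g * b \<in> partial_slice n u r" by auto
    have "\<exists>p<n. (g * b) $$ (p, r) \<noteq> 0"
    proof (rule ccontr)
      assume *: "\<not> (\<exists>p<n. (g * b) $$ (p, r) \<noteq> 0)"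
      have gb: "g * b \<in> carrier_mat n n" "det (g * b) \<noteq> 0"
        using GL_mult_closed[OF g borel_GL[OF b(1)]] by (auto simp: carrier_GL)
      have "det (g * b) = 0"
        unfolding det_col[OF gb(1)]
      proof (intro sum.neutral ballI)
        fix p assume "p \<in> {p. p permutes {0..<n}}"
        then have "p permutes {0..<n}" by simp
        then have "p r < n" using permutes_lessD Suc.prems by simp
        then have "(\<Prod>j<n. (g * b) $$ (p j, j)) = 0"
          using * Suc.prems by (intro prod_zero) (auto simp del: index_mult_mat intro!: bexI[of _ r])
        then show "signof p * (\<Prod>j<n. (g * b) $$ (p j, j)) = 0" by simp
      qed
      then show False using gb by simp
    qed
    then obtain p where p: "p < n" "(g * b) $$ (p, r) \<noteq> 0" by blast
    then obtain c where c: "c \<in> borel_group n" "(g * b) * c \<in> partial_slice n (u(r := p)) (Suc r)"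
      using elimination_step[OF b(2), of p] Suc.prems by auto
    moreover have "g * b * c = g * (b * c)"
      by (rule assoc_mult_mat[OF gc borel_carrier_mat[OF b(1)] borel_carrier_mat[OF c(1)]])
    ultimately show ?case using borel_mult[OF b(1) c(1)] by metis
  qed
  from this[OF order_refl] obtain u b where b: "b \<in> borel_group n" "g * b \<in> partial_slice n u n" by blast
  \<comment> \<open>The pivot function is arbitrary beyond \<open>n\<close>, whereas
    \<open>permutes\<close> asks for the identity there.\<close>
  define v where "v i = (if i < n then u i else i)" for i
  have inj: "inj_on u {0..<n}"
  proof (rule linorder_inj_onI)
    fix i j assume ij: "i < j" "i \<in> {0..<n}" "j \<in> {0..<n}"
    then have "(g * b) $$ (u i, j) = 0" "(g * b) $$ (u j, j) = 1"
      using b(2) by (auto simp: partial_slice_def simp del: index_mult_mat)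
    then show "u i \<noteq> u j" by (auto simp del: index_mult_mat)
  qed auto
  have "v permutes {0..<n}"
  proof (rule bij_imp_permutes)
    have "u ` {0..<n} \<subseteq> {0..<n}" using b(2) by (auto simp: partial_slice_def)
    then have "bij_betw u {0..<n} {0..<n}"
      using inj by (simp add: bij_betw_def endo_inj_surj)
    then show "bij_betw v {0..<n} {0..<n}" by (rule bij_betw_cong[THEN iffD1, rotated]) (simp add: v_def)
  qed (simp add: v_def)
  moreover have "g * b \<in> slice n v" using b(2) by (auto simp: partial_slice_def slice_def v_def)
  ultimately show ?thesis using that b(1) by blast
qed

section \<open>The Zariski topology and regular functions in a chart\<close>

lemma GL_nbhd:
  assumes "openin (GL_top n) U" "g \<in> U"
  obtains p where "p \<in> poly_fun n" "p g \<noteq> 0" "\<And>h. h \<in> carrier (GL n) \<Longrightarrow> p h \<noteq> 0 \<Longrightarrow> h \<in> U"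
proof -
  have "\<exists>p\<in>poly_fun n. p g \<noteq> 0 \<and> (\<forall>h\<in>carrier (GL n). p h \<noteq> 0 \<longrightarrow> h \<in> U)"
    using assms unfolding openin_GL_top GL_open_iff by simp
  then show ?thesis using that by auto
qed

lemma openin_flagI:
  assumes "U \<subseteq> flags n"
    and "\<And>g. g \<in> carrier (GL n) \<Longrightarrow> coset_of n g \<in> U \<Longrightarrow>
      \<exists>p\<in>poly_fun n. p g \<noteq> 0 \<and> (\<forall>h\<in>carrier (GL n). p h \<noteq> 0 \<longrightarrow> coset_of n h \<in> U)"
  shows "openin (flag_top n) U"
  unfolding openin_flag_top flag_open_def openin_GL_top GL_open_iff
proof (intro conjI ballI)
  fix g assume "g \<in> {g \<in> carrier (GL n). coset_of n g \<in> U}"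
  then show "\<exists>p\<in>poly_fun n. p g \<noteq> 0 \<and>
      (\<forall>h\<in>carrier (GL n). p h \<noteq> 0 \<longrightarrow> h \<in> {g \<in> carrier (GL n). coset_of n g \<in> U})"
    using assms(2)[of g] by simp
qed (use assms(1) in auto)

lemma flag_nbhd:
  assumes "openin (flag_top n) U" "g \<in> carrier (GL n)" "coset_of n g \<in> U"
  obtains p where "p \<in> poly_fun n" "p g \<noteq> 0"
    "\<And>h. h \<in> carrier (GL n) \<Longrightarrow> p h \<noteq> 0 \<Longrightarrow> coset_of n h \<in> U"
proof -
  have "openin (GL_top n) {g \<in> carrier (GL n). coset_of n g \<in> U}"
    using assms(1) unfolding openin_flag_top flag_open_def by simp
  moreover have "g \<in> {g \<in> carrier (GL n). coset_of n g \<in> U}" using assms by simp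
  ultimately show ?thesis using that GL_nbhd by (metis (no_types, lifting) mem_Collect_eq)
qed

lemma topspace_flag_top [simp]: "topspace (flag_top n) = flags n"
proof
  show "topspace (flag_top n) \<subseteq> flags n"
    unfolding topspace_def openin_flag_top flag_open_def by auto
  have "openin (flag_top n) (flags n)"
    by (rule openin_flagI) (auto simp: flags_eq intro!: bexI[of _ "\<lambda>_. 1"] poly_fun.const)
  then show "flags n \<subseteq> topspace (flag_top n)" by (rule openin_subset)
qed

lemma closedin_flag_nbhd:
  assumes "closedin (flag_top n) C" "g \<in> carrier (GL n)" "coset_of n g \<notin> C"
  obtains p where "p \<in> poly_fun n" "p g \<noteq> 0"
    "\<And>h. h \<in> carrier (GL n) \<Longrightarrow> p h \<noteq> 0 \<Longrightarrow> coset_of n h \<notin> C"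
proof -
  have "openin (flag_top n) (flags n - C)" using assms(1) by (simp add: closedin_def)
  moreover have "coset_of n g \<in> flags n - C" using assms by (simp add: flags_eq)
  ultimately show ?thesis using flag_nbhd assms(2) that by (metis DiffD2)
qed

definition chart :: "nat \<Rightarrow> (nat \<Rightarrow> nat) \<Rightarrow> complex mat set set" where
  "chart n u = coset_of n ` slice n u"

lemma coset_of_in_chart_iff:
  assumes u: "u permutes {0..<n}" and g: "g \<in> carrier (GL n)"
  shows "coset_of n g \<in> chart n u \<longleftrightarrow> (\<forall>j<n. minor (Suc j) u g \<noteq> 0)"
proof
  assume "coset_of n g \<in> chart n u"
  then obtain A where A: "A \<in> slice n u" "coset_of n A = coset_of n g" by (auto simp: chart_def)
  then obtain b where "b \<in> borel_group n" "g = A * b"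
    using coset_of_eqD[OF GL_carrier_mat[OF g]] by metis
  then show "\<forall>j<n. minor (Suc j) u g \<noteq> 0" using minor_slice_borel_nonzero[OF u A(1)] by simp
next
  assume "\<forall>j<n. minor (Suc j) u g \<noteq> 0"
  then obtain b where b: "b \<in> borel_group n" "g * b \<in> slice n u"
    using LU_decomposition[OF u GL_carrier_mat[OF g]] by blast
  then show "coset_of n g \<in> chart n u"
    using coset_of_mult_borel[OF GL_carrier_mat[OF g] b(1)] by (metis chart_def imageI)
qed

lemma chart_coord_coset:
  assumes u: "u permutes {0..<n}" and g: "g \<in> carrier (GL n)" and A: "A \<in> slice n u"
    and "coset_of n A = coset_of n g"
  shows "chart_coord n u g = A"
proof -
  obtain b where "b \<in> borel_group n" "g = A * b"
    using coset_of_eqD[OF GL_carrier_mat[OF g] assms(4)] by blast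
  then show ?thesis using chart_coord_slice_borel[OF u A] by simp
qed

text \<open>This connects the chart with the quotient structure: a polynomial in the chart
  coordinates becomes, on the group, a fraction whose denominator has no zero over the
  chart.\<close>

lemma poly_fun_chart_coord:
  assumes u: "u permutes {0..<n}" and "p \<in> poly_fun n"
  shows "\<exists>P\<in>poly_fun n. \<exists>Q\<in>poly_fun n. \<forall>g. (\<forall>j<n. minor (Suc j) u g \<noteq> 0) \<longrightarrow>
    Q g \<noteq> 0 \<and> p (chart_coord n u g) = P g / Q g"
  using assms(2)
proof induction
  case (const c)
  then show ?case
    by (intro rev_bexI[OF poly_fun.const[of c]] rev_bexI[OF poly_fun.const[of 1]]) auto
next
  case (entry i j)
  then show ?case
    using permutes_lessD[OF u]
    by (intro rev_bexI[OF minor_poly_fun[of "Suc j" n "u(j := i)"]] rev_bexI[OF minor_poly_fun[of "Suc j" n u]])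
      (auto simp: chart_coord_def)
next
  case (add p q)
  from add.IH(1) obtain P Q where PQ: "P \<in> poly_fun n" "Q \<in> poly_fun n"
    "\<forall>g. (\<forall>j<n. minor (Suc j) u g \<noteq> 0) \<longrightarrow> Q g \<noteq> 0 \<and> p (chart_coord n u g) = P g / Q g"
    by blast
  from add.IH(2) obtain P' Q' where PQ': "P' \<in> poly_fun n" "Q' \<in> poly_fun n"
    "\<forall>g. (\<forall>j<n. minor (Suc j) u g \<noteq> 0) \<longrightarrow> Q' g \<noteq> 0 \<and> q (chart_coord n u g) = P' g / Q' g"
    by blast
  show ?case
  proof (rule bexI[of _ "\<lambda>g. P g * Q' g + P' g * Q g"], rule bexI[of _ "\<lambda>g. Q g * Q' g"], intro allI impI)
    fix g assume "\<forall>j<n. minor (Suc j) u g \<noteq> 0"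
    then show "Q g * Q' g \<noteq> 0 \<and> p (chart_coord n u g) + q (chart_coord n u g) =
        (P g * Q' g + P' g * Q g) / (Q g * Q' g)"
      using PQ(3) PQ'(3) by (simp add: add_frac_eq)
  qed (intro poly_fun.add poly_fun.mult PQ PQ')+
next
  case (mult p q)
  from mult.IH(1) obtain P Q where PQ: "P \<in> poly_fun n" "Q \<in> poly_fun n"
    "\<forall>g. (\<forall>j<n. minor (Suc j) u g \<noteq> 0) \<longrightarrow> Q g \<noteq> 0 \<and> p (chart_coord n u g) = P g / Q g"
    by blast
  from mult.IH(2) obtain P' Q' where PQ': "P' \<in> poly_fun n" "Q' \<in> poly_fun n"
    "\<forall>g. (\<forall>j<n. minor (Suc j) u g \<noteq> 0) \<longrightarrow> Q' g \<noteq> 0 \<and> q (chart_coord n u g) = P' g / Q' g"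
    by blast
  show ?case
  proof (rule bexI[of _ "\<lambda>g. P g * P' g"], rule bexI[of _ "\<lambda>g. Q g * Q' g"], intro allI impI)
    fix g assume "\<forall>j<n. minor (Suc j) u g \<noteq> 0"
    then show "Q g * Q' g \<noteq> 0 \<and> p (chart_coord n u g) * q (chart_coord n u g) =
        (P g * P' g) / (Q g * Q' g)"
      using PQ(3) PQ'(3) by simp
  qed (intro poly_fun.mult PQ PQ')+
qed

text \<open>The polynomial is evaluated on the slice representative only. On other matrices of the
  same coset it may behave differently, so this is not simply the image of a basic open set of the
  group.\<close>

definition chart_basic :: "nat \<Rightarrow> (nat \<Rightarrow> nat) \<Rightarrow> (complex mat \<Rightarrow> complex) \<Rightarrow> complex mat set set" where
  "chart_basic n u p = {coset_of n A | A. A \<in> slice n u \<and> p A \<noteq> 0}"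

lemma coset_of_in_chart_basic_iff:
  assumes "u permutes {0..<n}" "A \<in> slice n u"
  shows "coset_of n A \<in> chart_basic n u p \<longleftrightarrow> p A \<noteq> 0"
  using coset_of_slice_inj[OF assms(1) _ assms(2)] assms(2) by (auto simp: chart_basic_def)

lemma openin_chart_basic:
  assumes u: "u permutes {0..<n}" and p: "p \<in> poly_fun n"
  shows "openin (flag_top n) (chart_basic n u p)"
proof (rule openin_flagI)
  show "chart_basic n u p \<subseteq> flags n"
    using slice_GL[OF u] by (auto simp: chart_basic_def flags_eq)
  fix g assume g: "g \<in> carrier (GL n)" "coset_of n g \<in> chart_basic n u p"
  obtain P Q where PQ: "P \<in> poly_fun n" "Q \<in> poly_fun n"
    "\<And>g. \<forall>j<n. minor (Suc j) u g \<noteq> 0 \<Longrightarrow> Q g \<noteq> 0 \<and> p (chart_coord n u g) = P g / Q g"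
    using poly_fun_chart_coord[OF u p] by metis
  \<comment> \<open>The minors cut out the preimage of the chart, and there the numerator
    \<open>P\<close> decides whether \<open>p\<close> vanishes.\<close>
  let ?r = "\<lambda>g. (\<Prod>j<n. minor (Suc j) u g) * P g"
  have iff: "?r h \<noteq> 0 \<longleftrightarrow> coset_of n h \<in> chart_basic n u p" if h: "h \<in> carrier (GL n)" for h
  proof
    assume "?r h \<noteq> 0"
    then have nz: "\<forall>j<n. minor (Suc j) u h \<noteq> 0" "P h \<noteq> 0" by auto
    then have "coset_of n h \<in> chart n u" using coset_of_in_chart_iff[OF u h] by simp
    then obtain A where A: "A \<in> slice n u" "coset_of n A = coset_of n h" by (auto simp: chart_def)
    then have "p A \<noteq> 0" using PQ(3)[OF nz(1)] nz(2) chart_coord_coset[OF u h A] by simp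
    then show "coset_of n h \<in> chart_basic n u p" using A by (auto simp: chart_basic_def)
  next
    assume "coset_of n h \<in> chart_basic n u p"
    then obtain A where A: "A \<in> slice n u" "coset_of n A = coset_of n h" "p A \<noteq> 0"
      by (auto simp: chart_basic_def)
    then have "coset_of n h \<in> chart n u" unfolding chart_def by (metis imageI)
    then have nz: "\<forall>j<n. minor (Suc j) u h \<noteq> 0" using coset_of_in_chart_iff[OF u h] by simp
    then show "?r h \<noteq> 0" using PQ(3)[OF nz] A(3) chart_coord_coset[OF u h A(1,2)] by auto
  qed
  have "?r \<in> poly_fun n"
    using permutes_lessD[OF u] by (intro poly_fun.mult poly_fun_prod PQ minor_poly_fun) auto
  then show "\<exists>p'\<in>poly_fun n. p' g \<noteq> 0 \<and>
      (\<forall>h\<in>carrier (GL n). p' h \<noteq> 0 \<longrightarrow> coset_of n h \<in> chart_basic n u p)"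
    using iff g by (intro bexI[of _ ?r]) auto
qed

lemma chart_eq_chart_basic: "chart n u = chart_basic n u (\<lambda>_. 1)"
  by (auto simp: chart_def chart_basic_def)

lemma openin_chart: "u permutes {0..<n} \<Longrightarrow> openin (flag_top n) (chart n u)"
  unfolding chart_eq_chart_basic by (intro openin_chart_basic poly_fun.const)

text \<open>Nonvanishing on the slice is an open condition, so it cannot occur at a point of the
  closure without occurring on \<open>S\<close>. It is used in contrapositive form to extend
  polynomial identities from \<open>S\<close> to its closure.\<close>

lemma closure_of_chart_nonzero:
  assumes u: "u permutes {0..<n}" and "p \<in> poly_fun n" and A: "A \<in> slice n u" and "p A \<noteq> 0"
    and "coset_of n A \<in> flag_top n closure_of S"
  obtains B where "B \<in> slice n u" "coset_of n B \<in> S" "p B \<noteq> 0"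
proof -
  have "openin (flag_top n) (chart_basic n u p)" "coset_of n A \<in> chart_basic n u p"
    using assms by (auto simp: openin_chart_basic coset_of_in_chart_basic_iff)
  then obtain y where "y \<in> S" "y \<in> chart_basic n u p"
    using assms(5) unfolding in_closure_of by blast
  then show ?thesis using that by (auto simp: chart_basic_def)
qed

text \<open>Unlike a general polynomial, a leading minor is nonzero on all of a coset or on none of
  it. Its nonvanishing is therefore an open condition on flags without reference to a chart.\<close>

lemma closure_of_minor_nonzero:
  assumes m: "m \<le> n" and \<sigma>: "\<And>r. r < m \<Longrightarrow> \<sigma> r < n" and g: "g \<in> carrier (GL n)" "minor m \<sigma> g \<noteq> 0"
    and cl: "coset_of n g \<in> flag_top n closure_of S"
  obtains h where "h \<in> carrier (GL n)" "coset_of n h \<in> S" "minor m \<sigma> h \<noteq> 0"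
proof -
  let ?U = "{coset_of n h | h. h \<in> carrier (GL n) \<and> minor m \<sigma> h \<noteq> 0}"
  have "openin (flag_top n) ?U"
  proof (rule openin_flagI)
    fix k assume k: "k \<in> carrier (GL n)" "coset_of n k \<in> ?U"
    then obtain h where h: "h \<in> carrier (GL n)" "minor m \<sigma> h \<noteq> 0" "coset_of n h = coset_of n k"
      by auto
    then obtain b where b: "b \<in> borel_group n" "k = h * b"
      using coset_of_eqD[OF GL_carrier_mat[OF k(1)]] by metis
    have "minor m \<sigma> k \<noteq> 0"
      using minor_mult_borel[OF GL_carrier_mat[OF h(1)] b(1) m \<sigma>] h(2) b(2)
        borel_diag_nonzero[OF b(1)] m by auto
    then show "\<exists>p\<in>poly_fun n. p k \<noteq> 0 \<and> (\<forall>h\<in>carrier (GL n). p h \<noteq> 0 \<longrightarrow> coset_of n h \<in> ?U)"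
      using minor_poly_fun[OF m \<sigma>] by (intro bexI[of _ "minor m \<sigma>"]) auto
  qed (auto simp: flags_eq)
  moreover have "coset_of n g \<in> ?U" using g by auto
  moreover have "\<forall>T. coset_of n g \<in> T \<and> openin (flag_top n) T \<longrightarrow> (\<exists>y. y \<in> S \<and> y \<in> T)"
    using cl unfolding in_closure_of by (rule conjunct2)
  ultimately have "\<exists>y. y \<in> S \<and> y \<in> ?U" by (metis (lifting))
  then show ?thesis using that by auto
qed

section \<open>Left translation is continuous and preserves closures of stable sets\<close>

lemma poly_fun_translate:
  assumes t: "t \<in> carrier_mat n n" and "p \<in> poly_fun n"
  shows "\<exists>q\<in>poly_fun n. \<forall>g\<in>carrier_mat n n. q g = p (t * g)"
  using assms(2)
proof induction
  case (const c)
  then show ?case by (intro bexI[of _ "\<lambda>_. c"]) (auto intro: poly_fun.const)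
next
  case (entry i j)
  have "(\<lambda>g. \<Sum>k<n. t $$ (i, k) * g $$ (k, j)) \<in> poly_fun n"
    using entry by (intro poly_fun_sum poly_fun.mult poly_fun.const poly_fun.entry) auto
  then show ?case using index_mult_mat_sum[OF t _ entry] by (auto intro!: bexI)
next
  case (add p q)
  then obtain p' q' where "p' \<in> poly_fun n" "\<forall>g\<in>carrier_mat n n. p' g = p (t * g)"
    "q' \<in> poly_fun n" "\<forall>g\<in>carrier_mat n n. q' g = q (t * g)" by blast
  then show ?case by (intro bexI[of _ "\<lambda>g. p' g + q' g"] poly_fun.add) auto
next
  case (mult p q)
  then obtain p' q' where "p' \<in> poly_fun n" "\<forall>g\<in>carrier_mat n n. p' g = p (t * g)"
    "q' \<in> poly_fun n" "\<forall>g\<in>carrier_mat n n. q' g = q (t * g)" by blast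
  then show ?case by (intro bexI[of _ "\<lambda>g. p' g * q' g"] poly_fun.mult) auto
qed

lemma closedin_translate:
  assumes C: "closedin (flag_top n) C" and t: "t \<in> carrier (GL n)"
  shows "closedin (flag_top n) {y \<in> flags n. t <#\<^bsub>GL n\<^esub> y \<in> C}"
proof -
  have "openin (flag_top n) (flags n - {y \<in> flags n. t <#\<^bsub>GL n\<^esub> y \<in> C})"
  proof (rule openin_flagI)
    fix g assume g: "g \<in> carrier (GL n)" "coset_of n g \<in> flags n - {y \<in> flags n. t <#\<^bsub>GL n\<^esub> y \<in> C}"
    have tr: "t <#\<^bsub>GL n\<^esub> coset_of n h = coset_of n (t * h)" if "h \<in> carrier (GL n)" for h
      using translate_coset_of t that by (simp add: GL_carrier_mat)
    obtain p where p: "p \<in> poly_fun n" "p (t * g) \<noteq> 0"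
      "\<And>h. h \<in> carrier (GL n) \<Longrightarrow> p h \<noteq> 0 \<Longrightarrow> coset_of n h \<notin> C"
      using closedin_flag_nbhd[OF C GL_mult_closed[OF t g(1)]] g tr by auto
    obtain q where q: "q \<in> poly_fun n" "\<forall>g\<in>carrier_mat n n. q g = p (t * g)"
      using poly_fun_translate[OF GL_carrier_mat[OF t] p(1)] by auto
    show "\<exists>p\<in>poly_fun n. p g \<noteq> 0 \<and> (\<forall>h\<in>carrier (GL n). p h \<noteq> 0 \<longrightarrow>
        coset_of n h \<in> flags n - {y \<in> flags n. t <#\<^bsub>GL n\<^esub> y \<in> C})"
      using q p(2) p(3)[OF GL_mult_closed[OF t]] g(1) tr
      by (intro bexI[of _ q]) (auto simp: GL_carrier_mat flags_eq)
  qed auto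
  then show ?thesis by (auto simp: closedin_def)
qed

lemma translate_closure_of:
  assumes "S \<subseteq> flags n" "t \<in> carrier (GL n)" "\<And>y. y \<in> S \<Longrightarrow> t <#\<^bsub>GL n\<^esub> y \<in> S"
    "y \<in> flag_top n closure_of S"
  shows "t <#\<^bsub>GL n\<^esub> y \<in> flag_top n closure_of S"
proof -
  have "flag_top n closure_of S \<subseteq> {y \<in> flags n. t <#\<^bsub>GL n\<^esub> y \<in> flag_top n closure_of S}"
  proof (rule closure_of_minimal)
    have "S \<subseteq> flag_top n closure_of S" using assms(1) by (simp add: closure_of_subset)
    then show "S \<subseteq> {y \<in> flags n. t <#\<^bsub>GL n\<^esub> y \<in> flag_top n closure_of S}" using assms by auto
  qed (intro closedin_translate assms closedin_closure_of)
  then show ?thesis using assms(4) by auto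
qed

subsection \<open>Polynomial curves\<close>

definition poly_curve :: "nat \<Rightarrow> (complex \<Rightarrow> complex mat) \<Rightarrow> bool" where
  "poly_curve n \<gamma> \<longleftrightarrow> (\<forall>i<n. \<forall>j<n. \<exists>P. \<forall>s. \<gamma> s $$ (i, j) = poly P s)"

lemma poly_curve_poly_fun:
  assumes "poly_curve n \<gamma>" "p \<in> poly_fun n"
  obtains P where "\<And>s. p (\<gamma> s) = poly P s"
proof -
  from assms(2) have "\<exists>P. \<forall>s. p (\<gamma> s) = poly P s"
  proof induction
    case (const c)
    then show ?case by (auto intro: exI[of _ "[:c:]"])
  next
    case (entry i j)
    then show ?case using assms(1) by (simp add: poly_curve_def)
  next
    case (add p q)
    then obtain P Q where "\<forall>s. p (\<gamma> s) = poly P s" "\<forall>s. q (\<gamma> s) = poly Q s" by blast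
  then show ?case by (intro exI[of _ "P + Q"]) simp
  next
    case (mult p q)
    then obtain P Q where "\<forall>s. p (\<gamma> s) = poly P s" "\<forall>s. q (\<gamma> s) = poly Q s" by blast
  then show ?case by (intro exI[of _ "P * Q"]) simp
  qed
  then show ?thesis using that by auto
qed

text \<open>This replaces passage to a limit. A polynomial separating the point at \<open>s0\<close>
  from \<open>C\<close> would restrict to a nonzero polynomial in one variable, hence be nonzero at
  some parameter outside the finite set \<open>S\<close>.\<close>

lemma poly_curve_closed:
  assumes C: "closedin (flag_top n) C" and \<gamma>: "poly_curve n \<gamma>" and "finite S"
    and in_C: "\<And>s. s \<notin> S \<Longrightarrow> \<gamma> s \<in> carrier (GL n) \<and> coset_of n (\<gamma> s) \<in> C"
    and s0: "\<gamma> s0 \<in> carrier (GL n)"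
  shows "coset_of n (\<gamma> s0) \<in> C"
proof (rule ccontr)
  assume "coset_of n (\<gamma> s0) \<notin> C"
  then obtain p where p: "p \<in> poly_fun n" "p (\<gamma> s0) \<noteq> 0"
    "\<And>h. h \<in> carrier (GL n) \<Longrightarrow> p h \<noteq> 0 \<Longrightarrow> coset_of n h \<notin> C"
    using closedin_flag_nbhd[OF C s0] by metis
  obtain P where P: "\<And>s. p (\<gamma> s) = poly P s" using poly_curve_poly_fun[OF \<gamma> p(1)] by blast
  have "P \<noteq> 0" using P[of s0] p(2) by auto
  then have "finite (S \<union> {s. poly P s = 0})" using assms(3) poly_roots_finite by auto
  then obtain s where "s \<notin> S" "poly P s \<noteq> 0"
    using ex_new_if_finite[OF infinite_UNIV_char_0] by blast
  then show False using in_C p(3) P by metis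
qed

subsection \<open>Regular functions and germs\<close>

definition chart_rep :: "nat \<Rightarrow> (nat \<Rightarrow> nat) \<Rightarrow> complex mat set \<Rightarrow> complex mat" where
  "chart_rep n u y = (THE A. A \<in> slice n u \<and> coset_of n A = y)"

lemma chart_rep_coset:
  assumes "u permutes {0..<n}" "A \<in> slice n u" shows "chart_rep n u (coset_of n A) = A"
  unfolding chart_rep_def using coset_of_slice_inj[OF assms(1) _ assms(2)] assms(2)
  by (intro the_equality) auto

lemma flag_sheaf_fraction:
  assumes u: "u permutes {0..<n}" and p: "p \<in> poly_fun n" and q: "q \<in> poly_fun n"
  shows "flag_sheaf n (chart_basic n u q) (\<lambda>y. p (chart_rep n u y) / q (chart_rep n u y))"
proof -
  let ?V = "{g \<in> carrier (GL n). coset_of n g \<in> chart_basic n u q}"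
  have op: "openin (flag_top n) (chart_basic n u q)" using u q by (rule openin_chart_basic)
  then have op': "openin (GL_top n) ?V" unfolding openin_flag_top flag_open_def by simp
  obtain P Q where PQ: "P \<in> poly_fun n" "Q \<in> poly_fun n"
    "\<And>g. \<forall>j<n. minor (Suc j) u g \<noteq> 0 \<Longrightarrow> Q g \<noteq> 0 \<and> p (chart_coord n u g) = P g / Q g"
    using poly_fun_chart_coord[OF u p] by metis
  obtain P' Q' where PQ': "P' \<in> poly_fun n" "Q' \<in> poly_fun n"
    "\<And>g. \<forall>j<n. minor (Suc j) u g \<noteq> 0 \<Longrightarrow> Q' g \<noteq> 0 \<and> q (chart_coord n u g) = P' g / Q' g"
    using poly_fun_chart_coord[OF u q] by metis
  have frac: "Q h * P' h \<noteq> 0 \<and> p (chart_rep n u (coset_of n h)) / q (chart_rep n u (coset_of n h)) =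
      P h * Q' h / (Q h * P' h)" if "h \<in> ?V" for h
  proof -
    from that obtain A where A: "A \<in> slice n u" "coset_of n A = coset_of n h" "q A \<noteq> 0"
      and h: "h \<in> carrier (GL n)" by (auto simp: chart_basic_def)
    have "coset_of n h \<in> chart n u" using A(1,2) unfolding chart_def by (metis imageI)
    then have nz: "\<forall>j<n. minor (Suc j) u h \<noteq> 0" using coset_of_in_chart_iff[OF u h] by simp
    have "chart_rep n u (coset_of n h) = A" using chart_rep_coset[OF u A(1)] A(2) by simp
    then show ?thesis using PQ(3)[OF nz] PQ'(3)[OF nz] chart_coord_coset[OF u h A(1,2)] A(3)
      by auto
  qed
  have "(\<lambda>h. P h * Q' h) \<in> poly_fun n" "(\<lambda>h. Q h * P' h) \<in> poly_fun n"
    using PQ PQ' by (auto intro: poly_fun.mult)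
  then have "GL_sheaf n ?V (\<lambda>g. p (chart_rep n u (coset_of n g)) / q (chart_rep n u (coset_of n g)))"
    unfolding GL_sheaf_def
    using op' frac by (intro conjI ballI exI[of _ ?V] exI[of _ "\<lambda>h. P h * Q' h"] exI[of _ "\<lambda>h. Q h * P' h"]) auto
  then show ?thesis using op by (simp add: flag_sheaf_def)
qed

text \<open>The slice is a section of the quotient map over the chart, so local fractions on the
  group can be restricted to it. Conversely, a fraction of polynomials on the slice is regular on a
  basic open set of the chart.\<close>

lemma regular_near_iff:
  assumes u: "u permutes {0..<n}" and A0: "A0 \<in> slice n u" "coset_of n A0 \<in> Y"
  shows "f \<in> regular_near (subtopology (flag_top n) Y) (subspace_sheaf (flag_top n) (flag_sheaf n) Y)
      (coset_of n A0) \<longleftrightarrow>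
    (\<exists>p\<in>poly_fun n. \<exists>q\<in>poly_fun n. q A0 \<noteq> 0 \<and>
      (\<forall>A\<in>slice n u. coset_of n A \<in> Y \<longrightarrow> q A \<noteq> 0 \<longrightarrow> f (coset_of n A) = p A / q A))"
    (is "?L \<longleftrightarrow> ?R")
proof
  assume ?L
  then obtain U where U: "coset_of n A0 \<in> U" "subspace_sheaf (flag_top n) (flag_sheaf n) Y U f"
    by (auto simp: regular_near_def)
  then obtain V g where V: "openin (flag_top n) V" "coset_of n A0 \<in> V" "flag_sheaf n V g"
    "\<forall>z\<in>V \<inter> U. f z = g z" unfolding subspace_sheaf_def by blast
  obtain U' where U': "openin (flag_top n) U'" "U = U' \<inter> Y"
    using U(2) unfolding subspace_sheaf_def openin_subtopology by blast
  have A0G: "A0 \<in> carrier (GL n)" using slice_GL[OF u A0(1)] .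
  have "GL_sheaf n {g \<in> carrier (GL n). coset_of n g \<in> V} (\<lambda>h. g (coset_of n h))"
    using V(3) by (simp add: flag_sheaf_def)
  moreover have "A0 \<in> {g \<in> carrier (GL n). coset_of n g \<in> V}" using A0G V(2) by simp
  ultimately obtain W p q where W: "openin (GL_top n) W" "A0 \<in> W"
    "W \<subseteq> {g \<in> carrier (GL n). coset_of n g \<in> V}" "p \<in> poly_fun n" "q \<in> poly_fun n"
    "\<forall>h\<in>W. q h \<noteq> 0 \<and> g (coset_of n h) = p h / q h"
    unfolding GL_sheaf_def by meson
  obtain r1 where r1: "r1 \<in> poly_fun n" "r1 A0 \<noteq> 0" "\<And>h. h \<in> carrier (GL n) \<Longrightarrow> r1 h \<noteq> 0 \<Longrightarrow> h \<in> W"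
    using GL_nbhd[OF W(1,2)] by metis
  obtain r2 where r2: "r2 \<in> poly_fun n" "r2 A0 \<noteq> 0"
    "\<And>h. h \<in> carrier (GL n) \<Longrightarrow> r2 h \<noteq> 0 \<Longrightarrow> coset_of n h \<in> U'"
    using flag_nbhd[OF U'(1) A0G] U U' by blast
  \<comment> \<open>Expanding the fraction by \<open>r1 * r2\<close> makes a nonzero denominator
    force \<open>A\<close> into \<open>W\<close> and its coset into \<open>U'\<close>.\<close>
  show ?R
  proof (rule bexI[of _ "\<lambda>A. p A * (r1 A * r2 A)"], rule bexI[of _ "\<lambda>A. q A * (r1 A * r2 A)"],
      intro conjI ballI impI)
    show "(\<lambda>A. p A * (r1 A * r2 A)) \<in> poly_fun n" "(\<lambda>A. q A * (r1 A * r2 A)) \<in> poly_fun n"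
      by (intro poly_fun.mult W(4,5) r1(1) r2(1))+
    show "q A0 * (r1 A0 * r2 A0) \<noteq> 0" using W(2,6) r1(2) r2(2) by simp
    fix A assume A: "A \<in> slice n u" "coset_of n A \<in> Y" "q A * (r1 A * r2 A) \<noteq> 0"
    have AG: "A \<in> carrier (GL n)" using slice_GL[OF u A(1)] .
    have AW: "A \<in> W" "coset_of n A \<in> U'" using r1(3)[OF AG] r2(3)[OF AG] A(3) by simp_all
    then have "f (coset_of n A) = g (coset_of n A)" using V(4) U'(2) A(2) W(3) by blast
    also have "\<dots> = p A / q A" using W(6) AW by simp
    finally show "f (coset_of n A) = p A * (r1 A * r2 A) / (q A * (r1 A * r2 A))"
      using A(3) by simp
  qed
next
  assume ?R
  then obtain p q where pq: "p \<in> poly_fun n" "q \<in> poly_fun n" "q A0 \<noteq> 0"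
    "\<And>A. A \<in> slice n u \<Longrightarrow> coset_of n A \<in> Y \<Longrightarrow> q A \<noteq> 0 \<Longrightarrow> f (coset_of n A) = p A / q A"
    by blast
  let ?V = "chart_basic n u q"
  have op: "openin (flag_top n) ?V" using openin_chart_basic[OF u pq(2)] .
  have "openin (subtopology (flag_top n) Y) (?V \<inter> Y)" using op by (auto simp: openin_subtopology)
  moreover have in_V: "coset_of n A0 \<in> ?V" using pq(3) A0 by (auto simp: chart_basic_def)
  moreover have "subspace_sheaf (flag_top n) (flag_sheaf n) Y (?V \<inter> Y) f"
    unfolding subspace_sheaf_def
  proof (intro conjI ballI)
    show "openin (subtopology (flag_top n) Y) (?V \<inter> Y)" by fact
    fix y assume "y \<in> ?V \<inter> Y"
    have "f z = p (chart_rep n u z) / q (chart_rep n u z)" if z: "z \<in> ?V \<inter> (?V \<inter> Y)" for z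
      using z pq(4) by (auto simp: chart_basic_def chart_rep_coset[OF u])
    then show "\<exists>V g. openin (flag_top n) V \<and> y \<in> V \<and> flag_sheaf n V g \<and> (\<forall>z\<in>V \<inter> (?V \<inter> Y). f z = g z)"
      using op \<open>y \<in> ?V \<inter> Y\<close> flag_sheaf_fraction[OF u pq(1,2)] by blast
  qed
  ultimately show ?L using A0(2) by (auto simp: regular_near_def)
qed

lemma same_germ_iff:
  assumes u: "u permutes {0..<n}" and A0: "A0 \<in> slice n u" "coset_of n A0 \<in> Y"
  shows "same_germ (subtopology (flag_top n) Y) (coset_of n A0) f g \<longleftrightarrow>
    (\<exists>r\<in>poly_fun n. r A0 \<noteq> 0 \<and>
      (\<forall>A\<in>slice n u. coset_of n A \<in> Y \<longrightarrow> r A \<noteq> 0 \<longrightarrow> f (coset_of n A) = g (coset_of n A)))"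
    (is "?L \<longleftrightarrow> ?R")
proof
  assume ?L
  then obtain U where U: "openin (flag_top n) U" "coset_of n A0 \<in> U" "\<forall>z\<in>U \<inter> Y. f z = g z"
    by (auto simp: same_germ_def openin_subtopology)
  obtain r where "r \<in> poly_fun n" "r A0 \<noteq> 0"
    "\<And>h. h \<in> carrier (GL n) \<Longrightarrow> r h \<noteq> 0 \<Longrightarrow> coset_of n h \<in> U"
    using flag_nbhd[OF U(1) slice_GL[OF u A0(1)] U(2)] by metis
  then show ?R using U(3) slice_GL[OF u] by (intro bexI[of _ r]) auto
next
  assume ?R
  then obtain r where r: "r \<in> poly_fun n" "r A0 \<noteq> 0"
    "\<And>A. A \<in> slice n u \<Longrightarrow> coset_of n A \<in> Y \<Longrightarrow> r A \<noteq> 0 \<Longrightarrow> f (coset_of n A) = g (coset_of n A)"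
    by blast
  have "openin (subtopology (flag_top n) Y) (chart_basic n u r \<inter> Y)"
    using openin_chart_basic[OF u r(1)] by (auto simp: openin_subtopology)
  then show ?L unfolding same_germ_def
    using r A0 by (intro exI[of _ "chart_basic n u r \<inter> Y"]) (auto simp: chart_basic_def)
qed

section \<open>Tangent spaces in a chart\<close>

lemma sum_fun_apply: "(\<Sum>x\<in>A. f x) z = (\<Sum>x\<in>A. f x z)"
  for f :: "'a \<Rightarrow> 'b \<Rightarrow> complex"
  by (induction A rule: infinite_finite_induct) auto

lemma tangent_spaceI:
  assumes "\<And>f g. f \<in> regular_near X F x \<Longrightarrow> g \<in> regular_near X F x \<Longrightarrow> D (\<lambda>z. f z + g z) = D f + D g"
    and "\<And>f g. f \<in> regular_near X F x \<Longrightarrow> g \<in> regular_near X F x \<Longrightarrow>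
      D (\<lambda>z. f z * g z) = f x * D g + g x * D f"
    and "\<And>f g. f \<in> regular_near X F x \<Longrightarrow> g \<in> regular_near X F x \<Longrightarrow> same_germ X x f g \<Longrightarrow> D f = D g"
    and "\<And>c f. f \<in> regular_near X F x \<Longrightarrow> D (\<lambda>z. c * f z) = c * D f"
    and "\<And>f. f \<notin> regular_near X F x \<Longrightarrow> D f = 0"
  shows "D \<in> tangent_space X F x"
  unfolding tangent_space_def mem_Collect_eq
  by (intro conjI ballI allI impI) (fact assms)+

lemma tangent_spaceD:
  assumes "D \<in> tangent_space X F x"
  shows "\<And>f g. f \<in> regular_near X F x \<Longrightarrow> g \<in> regular_near X F x \<Longrightarrow> D (\<lambda>z. f z + g z) = D f + D g"
    and "\<And>f g. f \<in> regular_near X F x \<Longrightarrow> g \<in> regular_near X F x \<Longrightarrow>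
      D (\<lambda>z. f z * g z) = f x * D g + g x * D f"
    and "\<And>f g. f \<in> regular_near X F x \<Longrightarrow> g \<in> regular_near X F x \<Longrightarrow> same_germ X x f g \<Longrightarrow> D f = D g"
    and "\<And>c f. f \<in> regular_near X F x \<Longrightarrow> D (\<lambda>z. c * f z) = c * D f"
    and "\<And>f. f \<notin> regular_near X F x \<Longrightarrow> D f = 0"
proof -
  note 0 = assms[unfolded tangent_space_def mem_Collect_eq]
  note 1 = conjunct1[OF 0, rule_format]
  show "D (\<lambda>z. f z + g z) = D f + D g"
    if "f \<in> regular_near X F x" "g \<in> regular_near X F x" for f g
    by (rule conjunct1[OF 1[OF that]])
  show "D (\<lambda>z. f z * g z) = f x * D g + g x * D f"
    if "f \<in> regular_near X F x" "g \<in> regular_near X F x" for f g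
    by (rule conjunct1[OF conjunct2[OF 1[OF that]]])
  show "D f = D g" if "f \<in> regular_near X F x" "g \<in> regular_near X F x" "same_germ X x f g" for f g
    by (rule conjunct2[OF conjunct2[OF 1[OF that(1,2)]], THEN mp, OF that(3)])
  show "D (\<lambda>z. c * f z) = c * D f" if "f \<in> regular_near X F x" for c f
    using conjunct1[OF conjunct2[OF 0]] that by blast
  show "D f = 0" if "f \<notin> regular_near X F x" for f
    using conjunct2[OF conjunct2[OF 0]] that by blast
qed

lemma subspace_tangent_space: "cfun.subspace (tangent_space X F x)"
  unfolding cfun.subspace_def
proof (intro conjI ballI allI)
  show "0 \<in> tangent_space X F x" by (rule tangent_spaceI) simp_all
next
  fix D E assume D: "D \<in> tangent_space X F x" and E: "E \<in> tangent_space X F x"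
  note D = tangent_spaceD[OF D] and E = tangent_spaceD[OF E]
  show "D + E \<in> tangent_space X F x"
  proof (rule tangent_spaceI)
    fix f g assume "f \<in> regular_near X F x" "g \<in> regular_near X F x" "same_germ X x f g"
    then show "(D + E) f = (D + E) g" using D(3)[of f g] E(3)[of f g] by simp
  qed (simp_all add: D(1,2,4,5) E(1,2,4,5) algebra_simps)
next
  fix c D assume D: "D \<in> tangent_space X F x"
  note D = tangent_spaceD[OF D]
  show "(\<lambda>z. c * D z) \<in> tangent_space X F x"
  proof (rule tangent_spaceI)
    fix f g assume "f \<in> regular_near X F x" "g \<in> regular_near X F x" "same_germ X x f g"
    then show "c * D f = c * D g" using D(3)[of f g] by simp
  qed (simp_all add: D(1,2,4,5) algebra_simps)
qed

locale chart_variety =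
  fixes n :: nat and u :: "nat \<Rightarrow> nat" and Y :: "complex mat set set"
  assumes u: "u permutes {0..<n}" and closed: "closedin (flag_top n) Y"
begin

abbreviation X :: "complex mat set topology" where "X \<equiv> subtopology (flag_top n) Y"

abbreviation F :: "complex mat set function_sheaf" where
  "F \<equiv> subspace_sheaf (flag_top n) (flag_sheaf n) Y"

definition K :: "complex mat set" where "K = {A \<in> slice n u. coset_of n A \<in> Y}"

abbreviation regular_at :: "complex mat \<Rightarrow> (complex mat set \<Rightarrow> complex) set" where
  "regular_at A \<equiv> regular_near X F (coset_of n A)"

lemma K_slice: "A \<in> K \<Longrightarrow> A \<in> slice n u"
  and K_Y: "A \<in> K \<Longrightarrow> coset_of n A \<in> Y"
  and K_GL: "A \<in> K \<Longrightarrow> A \<in> carrier (GL n)"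
  using slice_GL[OF u] by (auto simp: K_def)

lemma regular_at_iff:
  assumes "A0 \<in> K"
  shows "f \<in> regular_at A0 \<longleftrightarrow> (\<exists>p\<in>poly_fun n. \<exists>q\<in>poly_fun n. q A0 \<noteq> 0 \<and>
      (\<forall>A\<in>K. q A \<noteq> 0 \<longrightarrow> f (coset_of n A) = p A / q A))"
  using regular_near_iff[OF u K_slice[OF assms] K_Y[OF assms], of f]
  by (simp add: K_def Ball_def imp_conjL)

lemma same_germ_at_iff:
  assumes "A0 \<in> K"
  shows "same_germ X (coset_of n A0) f g \<longleftrightarrow>
    (\<exists>r\<in>poly_fun n. r A0 \<noteq> 0 \<and> (\<forall>A\<in>K. r A \<noteq> 0 \<longrightarrow> f (coset_of n A) = g (coset_of n A)))"
  using same_germ_iff[OF u K_slice[OF assms] K_Y[OF assms], of f g]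
  by (simp add: K_def Ball_def imp_conjL)

lemma regular_atE:
  assumes "A0 \<in> K" "f \<in> regular_at A0"
  obtains p q where "p \<in> poly_fun n" "q \<in> poly_fun n" "q A0 \<noteq> 0"
    "\<And>A. A \<in> K \<Longrightarrow> q A \<noteq> 0 \<Longrightarrow> f (coset_of n A) = p A / q A"
proof -
  have "\<exists>p\<in>poly_fun n. \<exists>q\<in>poly_fun n. q A0 \<noteq> 0 \<and>
      (\<forall>A\<in>K. q A \<noteq> 0 \<longrightarrow> f (coset_of n A) = p A / q A)"
    using assms regular_at_iff[OF assms(1)] by simp
  then show ?thesis using that by auto
qed

lemma regular_atI:
  assumes "A0 \<in> K" "p \<in> poly_fun n" "q \<in> poly_fun n" "q A0 \<noteq> 0"
    "\<And>A. A \<in> K \<Longrightarrow> q A \<noteq> 0 \<Longrightarrow> f (coset_of n A) = p A / q A"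
  shows "f \<in> regular_at A0"
  unfolding regular_at_iff[OF assms(1)] using assms by (intro bexI[of _ p] bexI[of _ q]) auto

lemma regular_add:
  assumes A0: "A0 \<in> K" and f: "f \<in> regular_at A0" and g: "g \<in> regular_at A0"
  shows "(\<lambda>z. f z + g z) \<in> regular_at A0"
proof -
  obtain p q where 1: "p \<in> poly_fun n" "q \<in> poly_fun n" "q A0 \<noteq> 0"
    "\<And>A. A \<in> K \<Longrightarrow> q A \<noteq> 0 \<Longrightarrow> f (coset_of n A) = p A / q A" using regular_atE[OF A0 f] by blast
  obtain p' q' where 2: "p' \<in> poly_fun n" "q' \<in> poly_fun n" "q' A0 \<noteq> 0"
    "\<And>A. A \<in> K \<Longrightarrow> q' A \<noteq> 0 \<Longrightarrow> g (coset_of n A) = p' A / q' A" using regular_atE[OF A0 g] by blast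
  show ?thesis
    by (rule regular_atI[OF A0, of "\<lambda>A. p A * q' A + p' A * q A" "\<lambda>A. q A * q' A"])
      (use 1 2 in \<open>auto intro!: poly_fun.add poly_fun.mult simp: add_frac_eq\<close>)
qed

lemma regular_mult:
  assumes A0: "A0 \<in> K" and f: "f \<in> regular_at A0" and g: "g \<in> regular_at A0"
  shows "(\<lambda>z. f z * g z) \<in> regular_at A0"
proof -
  obtain p q where 1: "p \<in> poly_fun n" "q \<in> poly_fun n" "q A0 \<noteq> 0"
    "\<And>A. A \<in> K \<Longrightarrow> q A \<noteq> 0 \<Longrightarrow> f (coset_of n A) = p A / q A" using regular_atE[OF A0 f] by blast
  obtain p' q' where 2: "p' \<in> poly_fun n" "q' \<in> poly_fun n" "q' A0 \<noteq> 0"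
    "\<And>A. A \<in> K \<Longrightarrow> q' A \<noteq> 0 \<Longrightarrow> g (coset_of n A) = p' A / q' A" using regular_atE[OF A0 g] by blast
  show ?thesis
    by (rule regular_atI[OF A0, of "\<lambda>A. p A * p' A" "\<lambda>A. q A * q' A"])
      (use 1 2 in \<open>auto intro!: poly_fun.mult\<close>)
qed

lemma regular_poly:
  assumes A0: "A0 \<in> K" and p: "p \<in> poly_fun n"
  shows "(\<lambda>y. p (chart_rep n u y)) \<in> regular_at A0"
  by (rule regular_atI[OF A0 p poly_fun.const[of 1]])
    (auto simp: chart_rep_coset[OF u K_slice])

lemma regular_const: "A0 \<in> K \<Longrightarrow> (\<lambda>_. c) \<in> regular_at A0"
  using regular_poly[OF _ poly_fun.const] by simp

subsection \<open>Derivations along curves\<close>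

text \<open>The value 0 off the regular functions is the normalisation that
  \<open>tangent_space\<close> prescribes.\<close>

definition curve_derivation :: "(complex \<Rightarrow> complex mat) \<Rightarrow> (complex mat set \<Rightarrow> complex) \<Rightarrow> complex" where
  "curve_derivation \<gamma> f = (if f \<in> regular_at (\<gamma> 0)
     then THE d. ((\<lambda>s. f (coset_of n (\<gamma> s))) has_field_derivative d) (at 0) else 0)"

lemma curve_derivation_eqI:
  assumes "f \<in> regular_at (\<gamma> 0)" "((\<lambda>s. f (coset_of n (\<gamma> s))) has_field_derivative d) (at 0)"
  shows "curve_derivation \<gamma> f = d"
proof -
  have "(THE d. ((\<lambda>s. f (coset_of n (\<gamma> s))) has_field_derivative d) (at 0)) = d"
    using assms(2) by (rule the_equality) (rule DERIV_unique[OF _ assms(2)])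
  then show ?thesis unfolding curve_derivation_def using assms(1) by simp
qed

lemma poly_nonzero_nhds: "poly Q (a::complex) \<noteq> 0 \<Longrightarrow> \<forall>\<^sub>F s in nhds a. poly Q s \<noteq> 0"
proof -
  assume "poly Q a \<noteq> 0"
  moreover have "isCont (poly Q) a" by (rule poly_isCont)
  then have "(poly Q \<longlongrightarrow> poly Q a) (nhds a)"
    by (simp add: isCont_def tendsto_at_iff_tendsto_nhds)
  ultimately show ?thesis by (rule tendsto_imp_eventually_ne[rotated])
qed

lemma curve_has_derivative:
  assumes \<gamma>: "poly_curve n \<gamma>" "\<And>s. \<gamma> s \<in> K" and f: "f \<in> regular_at (\<gamma> 0)"
  shows "((\<lambda>s. f (coset_of n (\<gamma> s))) has_field_derivative curve_derivation \<gamma> f) (at 0)"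
proof -
  obtain p q where pq: "p \<in> poly_fun n" "q \<in> poly_fun n" "q (\<gamma> 0) \<noteq> 0"
    "\<And>A. A \<in> K \<Longrightarrow> q A \<noteq> 0 \<Longrightarrow> f (coset_of n A) = p A / q A"
    using regular_atE[OF \<gamma>(2) f] by blast
  obtain P where P: "\<And>s. p (\<gamma> s) = poly P s" using poly_curve_poly_fun[OF \<gamma>(1) pq(1)] by blast
  obtain Q where Q: "\<And>s. q (\<gamma> s) = poly Q s" using poly_curve_poly_fun[OF \<gamma>(1) pq(2)] by blast
  have Q0: "poly Q 0 \<noteq> 0" using pq(3) Q by simp
  have "((\<lambda>s. poly P s / poly Q s) has_field_derivative
      (poly (pderiv P) 0 * poly Q 0 - poly P 0 * poly (pderiv Q) 0) / (poly Q 0 * poly Q 0)) (at 0)"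
    by (rule DERIV_divide[OF poly_DERIV poly_DERIV Q0])
  moreover have "\<forall>\<^sub>F s in nhds 0. f (coset_of n (\<gamma> s)) = poly P s / poly Q s"
    using poly_nonzero_nhds[OF Q0]
  proof eventually_elim
    case (elim s)
    then show ?case using pq(4)[OF \<gamma>(2), of s] P Q by simp
  qed
  ultimately have *: "((\<lambda>s. f (coset_of n (\<gamma> s))) has_field_derivative
      (poly (pderiv P) 0 * poly Q 0 - poly P 0 * poly (pderiv Q) 0) / (poly Q 0 * poly Q 0)) (at 0)"
    using DERIV_cong_ev[of 0 0 "\<lambda>s. f (coset_of n (\<gamma> s))" "\<lambda>s. poly P s / poly Q s"] by simp
  then show ?thesis using curve_derivation_eqI[of f \<gamma>, OF f *] by simp
qed

lemma curve_derivation_tangent: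
  assumes \<gamma>: "poly_curve n \<gamma>" "\<And>s. \<gamma> s \<in> K"
  shows "curve_derivation \<gamma> \<in> tangent_space X F (coset_of n (\<gamma> 0))"
proof -
  note D = curve_has_derivative[OF \<gamma>]
  note g0 = \<gamma>(2)[of 0]
  have "curve_derivation \<gamma> (\<lambda>z. f z + g z) = curve_derivation \<gamma> f + curve_derivation \<gamma> g"
    if "f \<in> regular_at (\<gamma> 0)" "g \<in> regular_at (\<gamma> 0)" for f g
    by (rule curve_derivation_eqI[of "\<lambda>z. f z + g z" \<gamma>, OF regular_add[OF g0 that]
      DERIV_add[OF D[OF that(1)] D[OF that(2)]]])
  moreover have "curve_derivation \<gamma> (\<lambda>z. f z * g z) = f (coset_of n (\<gamma> 0)) * curve_derivation \<gamma> g +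
      g (coset_of n (\<gamma> 0)) * curve_derivation \<gamma> f"
    if "f \<in> regular_at (\<gamma> 0)" "g \<in> regular_at (\<gamma> 0)" for f g
    using curve_derivation_eqI[of "\<lambda>z. f z * g z" \<gamma>, OF regular_mult[OF g0 that]
      DERIV_mult[OF D[OF that(1)] D[OF that(2)]]]
    by (simp add: algebra_simps)
  moreover have "curve_derivation \<gamma> f = curve_derivation \<gamma> g"
    if fg: "f \<in> regular_at (\<gamma> 0)" "g \<in> regular_at (\<gamma> 0)" "same_germ X (coset_of n (\<gamma> 0)) f g" for f g
  proof -
    obtain r where r: "r \<in> poly_fun n" "r (\<gamma> 0) \<noteq> 0"
      "\<And>A. A \<in> K \<Longrightarrow> r A \<noteq> 0 \<Longrightarrow> f (coset_of n A) = g (coset_of n A)"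
      using fg(3) unfolding same_germ_at_iff[OF g0] by auto
    obtain R where R: "\<And>s. r (\<gamma> s) = poly R s" using poly_curve_poly_fun[OF \<gamma>(1) r(1)] by blast
    have "\<forall>\<^sub>F s in nhds 0. f (coset_of n (\<gamma> s)) = g (coset_of n (\<gamma> s))"
      using poly_nonzero_nhds[of R 0] r(2,3) R \<gamma>(2) by (auto elim: eventually_mono)
    then have "((\<lambda>s. f (coset_of n (\<gamma> s))) has_field_derivative curve_derivation \<gamma> g) (at 0)"
      using D[OF fg(2)] DERIV_cong_ev[of 0 0 "\<lambda>s. f (coset_of n (\<gamma> s))" "\<lambda>s. g (coset_of n (\<gamma> s))"]
      by simp
    then show ?thesis by (rule curve_derivation_eqI[of f \<gamma>, OF fg(1)])
  qed
  moreover have "curve_derivation \<gamma> (\<lambda>z. c * f z) = c * curve_derivation \<gamma> f"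
    if "f \<in> regular_at (\<gamma> 0)" for c f
    by (rule curve_derivation_eqI[of "\<lambda>z. c * f z" \<gamma>,
      OF regular_mult[OF g0 regular_const[OF g0] that] DERIV_cmult[OF D[OF that]]])
  moreover have "curve_derivation \<gamma> f = 0" if "f \<notin> regular_at (\<gamma> 0)" for f
    using that by (simp add: curve_derivation_def)
  ultimately show ?thesis by (rule tangent_spaceI)
qed

lemma curve_derivation_poly:
  assumes "p \<in> poly_fun n" "\<And>s. \<gamma> s \<in> K" "((\<lambda>s. p (\<gamma> s)) has_field_derivative d) (at 0)"
  shows "curve_derivation \<gamma> (\<lambda>y. p (chart_rep n u y)) = d"
  by (rule curve_derivation_eqI)
    (use assms in \<open>auto simp: regular_poly chart_rep_coset[OF u K_slice]\<close>)

subsection \<open>The dimension of the tangent space\<close>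

definition coord_fun :: "nat \<times> nat \<Rightarrow> complex mat set \<Rightarrow> complex" where
  "coord_fun e y = chart_rep n u y $$ e"

lemmas tangentD = tangent_spaceD[where X = X and F = F]

lemma tangent_const:
  assumes A0: "A0 \<in> K" and D: "D \<in> tangent_space X F (coset_of n A0)"
  shows "D (\<lambda>_. c) = 0"
  using tangentD(2)[OF D regular_const[OF A0, of 1] regular_const[OF A0, of 1]]
    tangentD(4)[OF D regular_const[OF A0, of 1], of c] by simp

text \<open>The sum and product rules reduce polynomials to coordinates. For a fraction, apply the
  derivation to \<open>f * q = p\<close> and use that \<open>q\<close> is nonzero at
  \<open>A0\<close>.\<close>

lemma tangent_zero:
  assumes A0: "A0 \<in> K" and D: "D \<in> tangent_space X F (coset_of n A0)"
    and kill: "\<And>a j. a < n \<Longrightarrow> j < n \<Longrightarrow> D (coord_fun (a, j)) = 0"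
  shows "D = (\<lambda>_. 0)"
proof
  fix f
  have poly: "D (\<lambda>y. p (chart_rep n u y)) = 0" if "p \<in> poly_fun n" for p
    using that
  proof induction
    case (const c)
    then show ?case using tangent_const[OF A0 D] .
  next
    case (entry i j)
    then show ?case using kill[of i j] by (simp add: coord_fun_def[abs_def])
  next
    case (add p q)
    then show ?case using tangentD(1)[OF D regular_poly[OF A0] regular_poly[OF A0]] by simp
  next
    case (mult p q)
    then show ?case using tangentD(2)[OF D regular_poly[OF A0] regular_poly[OF A0]] by simp
  qed
  show "D f = 0"
  proof (cases "f \<in> regular_at A0")
    case True
    obtain p q where pq: "p \<in> poly_fun n" "q \<in> poly_fun n" "q A0 \<noteq> 0"
      "\<And>A. A \<in> K \<Longrightarrow> q A \<noteq> 0 \<Longrightarrow> f (coset_of n A) = p A / q A"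
      using regular_atE[OF A0 True] by blast
    let ?q = "\<lambda>y. q (chart_rep n u y)" and ?p = "\<lambda>y. p (chart_rep n u y)"
    have "same_germ X (coset_of n A0) (\<lambda>y. f y * ?q y) ?p"
      unfolding same_germ_at_iff[OF A0] using pq
      by (intro bexI[of _ q]) (auto simp: chart_rep_coset[OF u K_slice])
    then have "D (\<lambda>y. f y * ?q y) = D ?p"
      by (intro tangentD(3)[OF D] regular_mult[OF A0] True regular_poly[OF A0] pq)
    moreover have "D (\<lambda>y. f y * ?q y) = f (coset_of n A0) * D ?q + ?q (coset_of n A0) * D f"
      by (intro tangentD(2)[OF D] True regular_poly[OF A0] pq)
    ultimately show ?thesis
      using poly[OF pq(1)] poly[OF pq(2)] pq(3) chart_rep_coset[OF u K_slice[OF A0]] by simp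
  next
    case False
    then show ?thesis by (rule tangentD(5)[OF D])
  qed
qed

text \<open>The derivations along the curves form a dual family to the coordinates
  \<open>e k\<close>, hence they are independent. If these coordinates determine a tangent vector,
  the family also spans: subtracting from \<open>E\<close> the combination with the same values on
  them leaves a derivation that kills every coordinate.\<close>

lemma
  fixes e :: "'i \<Rightarrow> nat \<times> nat" and \<gamma> :: "'i \<Rightarrow> complex \<Rightarrow> complex mat"
  assumes I: "finite I" and e: "\<And>i. i \<in> I \<Longrightarrow> fst (e i) < n \<and> snd (e i) < n"
    and \<gamma>: "\<And>i. i \<in> I \<Longrightarrow> poly_curve n (\<gamma> i)" "\<And>i s. i \<in> I \<Longrightarrow> \<gamma> i s \<in> K"
    and \<gamma>0: "\<And>i. i \<in> I \<Longrightarrow> \<gamma> i 0 = A0" and A0: "A0 \<in> K"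
    and coord: "\<And>i k s. i \<in> I \<Longrightarrow> k \<in> I \<Longrightarrow> \<gamma> i s $$ e k = A0 $$ e k + (if i = k then s else 0)"
  shows tangent_dim_ge: "\<And>d. has_complex_dim (tangent_space X F (coset_of n A0)) d \<Longrightarrow> card I \<le> d"
    and tangent_dim_eq: "(\<And>D a j. D \<in> tangent_space X F (coset_of n A0) \<Longrightarrow>
       (\<And>i. i \<in> I \<Longrightarrow> D (coord_fun (e i)) = 0) \<Longrightarrow> a < n \<Longrightarrow> j < n \<Longrightarrow> D (coord_fun (a, j)) = 0) \<Longrightarrow>
     has_complex_dim (tangent_space X F (coset_of n A0)) (card I)"
proof -
  let ?T = "tangent_space X F (coset_of n A0)"
  define D where "D i = curve_derivation (\<gamma> i)" for i
  have D_T: "D i \<in> ?T" if "i \<in> I" for i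
    using curve_derivation_tangent[OF \<gamma>(1)[OF that] \<gamma>(2)[OF that]] \<gamma>0[OF that] by (simp add: D_def)
  have D_coord: "D i (coord_fun (e k)) = (if i = k then 1 else 0)" if ik: "i \<in> I" "k \<in> I" for i k
  proof -
    have "(\<lambda>A. A $$ (fst (e k), snd (e k))) \<in> poly_fun n" using e[OF ik(2)] by (intro poly_fun.entry) auto
    then have p: "(\<lambda>A. A $$ e k) \<in> poly_fun n" by simp
    have "((\<lambda>s. A0 $$ e k + (if i = k then s else 0)) has_field_derivative (if i = k then 1 else 0)) (at 0)"
      by (auto intro!: derivative_eq_intros)
    then have "((\<lambda>s. \<gamma> i s $$ e k) has_field_derivative (if i = k then 1 else 0)) (at 0)"
      using coord[OF ik] by simp
    from curve_derivation_poly[OF p \<gamma>(2)[OF ik(1)] this]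
    show ?thesis by (simp add: D_def coord_fun_def[abs_def])
  qed
  have inj: "inj_on D I"
  proof (rule inj_onI)
    fix i k assume ik: "i \<in> I" "k \<in> I" "D i = D k"
    have "D i (coord_fun (e i)) = D k (coord_fun (e i))" using ik(3) by (rule fun_cong)
    then show "i = k" unfolding D_coord[OF ik(1) ik(1)] D_coord[OF ik(2) ik(1)] by (simp split: if_splits)
  qed
  have fin: "finite (D ` I)" using I by simp
  have zero: "c x = 0" if sum: "(\<Sum>x\<in>D ` I. (\<lambda>z. c x * x z)) = 0" and x: "x \<in> D ` I" for c x
  proof -
    obtain k where k: "k \<in> I" "x = D k" using x by auto
    have "(\<Sum>i\<in>I. c (D i) * D i (coord_fun (e k))) = (\<Sum>x\<in>D ` I. (\<lambda>z. c x * x z)) (coord_fun (e k))"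
      unfolding sum_fun_apply by (simp add: sum.reindex[OF inj])
    then have "(\<Sum>i\<in>I. c (D i) * D i (coord_fun (e k))) = 0" using sum by simp
    moreover have "(\<Sum>i\<in>I. c (D i) * D i (coord_fun (e k))) = (\<Sum>i\<in>I. if i = k then c (D i) else 0)"
      by (intro sum.cong) (auto simp: D_coord k)
    ultimately show "c x = 0" using k I by simp
  qed
  have indep: "cfun.independent (D ` I)"
    unfolding cfun.dependent_finite[OF fin] using zero by blast
  {
    fix d assume "has_complex_dim ?T d"
    then obtain S where S: "finite S" "card S = d" "cfun.span S = ?T" by (auto simp: has_complex_dim_def)
    then have "card (D ` I) \<le> card S"
      using cfun.independent_span_bound[OF S(1) indep] D_T by auto
    then show "card I \<le> d" using S(2) card_image[OF inj] by simp
  }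
  assume kill: "\<And>D a j. D \<in> ?T \<Longrightarrow> (\<And>i. i \<in> I \<Longrightarrow> D (coord_fun (e i)) = 0) \<Longrightarrow> a < n \<Longrightarrow> j < n \<Longrightarrow>
      D (coord_fun (a, j)) = 0"
  have "?T \<subseteq> cfun.span (D ` I)"
  proof
    fix E assume E: "E \<in> ?T"
    let ?S = "\<Sum>i\<in>I. (\<lambda>z. E (coord_fun (e i)) * D i z)"
    have S_T: "?S \<in> ?T"
      by (intro cfun.subspace_sum cfun.subspace_scale subspace_tangent_space D_T)
    let ?R = "E - ?S"
    have R_T: "?R \<in> ?T" by (intro cfun.subspace_diff subspace_tangent_space E S_T)
    have R0: "?R (coord_fun (e k)) = 0" if "k \<in> I" for k
    proof -
      have "?S (coord_fun (e k)) = (\<Sum>i\<in>I. if i = k then E (coord_fun (e i)) else 0)"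
        unfolding sum_fun_apply by (intro sum.cong) (auto simp: D_coord that)
      then show ?thesis using that I by simp
    qed
    have "?R = (\<lambda>_. 0)"
    proof (rule tangent_zero[OF A0 R_T])
      fix a j assume "a < n" "j < n"
      then show "?R (coord_fun (a, j)) = 0" by (intro kill[OF R_T R0])
    qed
    then have "?R = 0" by (simp add: zero_fun_def)
    then have "E = ?S" by simp
    moreover have "?S \<in> cfun.span (D ` I)"
      by (intro cfun.span_sum cfun.span_scale cfun.span_base) auto
    ultimately show "E \<in> cfun.span (D ` I)" by simp
  qed
  moreover have "cfun.span (D ` I) \<subseteq> ?T"
    using D_T by (intro cfun.span_minimal subspace_tangent_space) auto
  ultimately show "has_complex_dim ?T (card I)"
    unfolding has_complex_dim_def using fin indep card_image[OF inj] by (intro exI[of _ "D ` I"]) auto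
qed

end

section \<open>Local dimension in a chart\<close>

text \<open>The library bound concerns sets of vectors, here the vectors are indexed. The relation
  between two equal members shows that the indexing is injective.\<close>

lemma family_card_bound:
  fixes \<phi> :: "'i \<Rightarrow> 't \<Rightarrow> complex"
  assumes L: "finite L" and S: "finite S" and sp: "\<And>\<alpha>. \<alpha> \<in> L \<Longrightarrow> \<phi> \<alpha> \<in> cfun.span S"
    and indep: "\<And>c \<alpha>. (\<And>t. (\<Sum>\<alpha>\<in>L. c \<alpha> * \<phi> \<alpha> t) = 0) \<Longrightarrow> \<alpha> \<in> L \<Longrightarrow> c \<alpha> = 0"
  shows "card L \<le> card S"
proof -
  have inj: "inj_on \<phi> L"
  proof (rule inj_onI, rule ccontr)
    fix \<alpha> \<beta> assume ab: "\<alpha> \<in> L" "\<beta> \<in> L" "\<phi> \<alpha> = \<phi> \<beta>" "\<alpha> \<noteq> \<beta>"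
    define c :: "'i \<Rightarrow> complex" where "c \<gamma> = (if \<gamma> = \<alpha> then 1 else if \<gamma> = \<beta> then - 1 else 0)" for \<gamma>
    have "(\<Sum>\<gamma>\<in>L. c \<gamma> * \<phi> \<gamma> t) = 0" for t
    proof -
      have "(\<Sum>\<gamma>\<in>L. c \<gamma> * \<phi> \<gamma> t) = (\<Sum>\<gamma>\<in>{\<alpha>, \<beta>}. c \<gamma> * \<phi> \<gamma> t)"
        using L ab by (intro sum.mono_neutral_right) (auto simp: c_def)
      also have "\<dots> = 0" using ab by (simp add: c_def)
      finally show ?thesis .
    qed
    then have "c \<alpha> = 0" using indep[of c \<alpha>] ab(1) by simp
    then show False by (simp add: c_def)
  qed
  have fin: "finite (\<phi> ` L)" using L by simp
  have zero: "c x = 0" if sum: "(\<Sum>x\<in>\<phi> ` L. (\<lambda>z. c x * x z)) = 0" and x: "x \<in> \<phi> ` L" for c x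
  proof -
    obtain \<alpha> where \<alpha>: "\<alpha> \<in> L" "x = \<phi> \<alpha>" using x by auto
    have "(\<Sum>\<beta>\<in>L. c (\<phi> \<beta>) * \<phi> \<beta> t) = 0" for t
    proof -
      have "(\<Sum>\<beta>\<in>L. c (\<phi> \<beta>) * \<phi> \<beta> t) = (\<Sum>x\<in>\<phi> ` L. (\<lambda>z. c x * x z)) t"
        unfolding sum_fun_apply by (simp add: sum.reindex[OF inj])
      then show ?thesis using sum by simp
    qed
    then show ?thesis using indep[of "\<lambda>\<beta>. c (\<phi> \<beta>)" \<alpha>] \<alpha> by simp
  qed
  have "cfun.independent (\<phi> ` L)"
    unfolding cfun.dependent_finite[OF fin] using zero by blast
  then have "card (\<phi> ` L) \<le> card S"
    using cfun.independent_span_bound[OF S] sp by auto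
  then show ?thesis using card_image[OF inj] by simp
qed

lemma span_times:
  assumes f: "f \<in> cfun.span S" and g: "g \<in> cfun.span T"
    and ST: "\<And>s t. s \<in> S \<Longrightarrow> t \<in> T \<Longrightarrow> (\<lambda>z. s z * t z) \<in> cfun.span U"
  shows "(\<lambda>z. f z * g z) \<in> cfun.span U"
proof -
  have 1: "(\<lambda>z. s z * g z) \<in> cfun.span U" if s: "s \<in> S" for s
    using g
  proof (induction rule: cfun.span_induct_alt)
    case base
    then show ?case using cfun.span_zero by (simp add: zero_fun_def)
  next
    case (step c x y)
    have "(\<lambda>z. c * (s z * x z)) + (\<lambda>z. s z * y z) \<in> cfun.span U"
      by (intro cfun.span_add cfun.span_scale ST s step)
    moreover have "(\<lambda>z. c * (s z * x z)) + (\<lambda>z. s z * y z) = (\<lambda>z. s z * ((\<lambda>z. c * x z) + y) z)"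
      by (auto simp: algebra_simps)
    ultimately show ?case by simp
  qed
  show ?thesis using f
  proof (induction rule: cfun.span_induct_alt)
    case base
    then show ?case using cfun.span_zero by (simp add: zero_fun_def)
  next
    case (step c x y)
    have "(\<lambda>z. c * (x z * g z)) + (\<lambda>z. y z * g z) \<in> cfun.span U"
      by (intro cfun.span_add cfun.span_scale 1 step)
    moreover have "(\<lambda>z. c * (x z * g z)) + (\<lambda>z. y z * g z) = (\<lambda>z. ((\<lambda>z. c * x z) + y) z * g z)"
      by (auto simp: algebra_simps)
    ultimately show ?case by simp
  qed
qed

lemma power_growth_le:
  fixes d r M :: nat
  assumes "\<And>k. (k + 1) ^ d \<le> (M * k + 1) ^ r"
  shows "d \<le> r"
proof (rule ccontr)
  assume "\<not> d \<le> r"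
  \<comment> \<open>Chosen so that the constant \<open>(M + 1) ^ r\<close> on the right equals
    \<open>k\<close>, just below the extra factor \<open>k + 1\<close> on the left.\<close>
  define k where "k = (M + 1) ^ r"
  have "(k + 1) ^ Suc r \<le> (k + 1) ^ d" using \<open>\<not> d \<le> r\<close> by (intro power_increasing) auto
  also have "\<dots> \<le> (M * k + 1) ^ r" by (rule assms)
  also have "\<dots> \<le> ((M + 1) * (k + 1)) ^ r" by (intro power_mono) auto
  also have "\<dots> = k * (k + 1) ^ r" by (simp only: power_mult_distrib k_def)
  finally show False by simp
qed

text \<open>The functions \<open>f i\<close> of \<open>chain_monomial\<close> are chosen along a chain of irreducible sets such
  that \<open>f i\<close> vanishes on the \<open>i\<close>-th set but not on the next one; this makes them algebraically
  independent.\<close>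

fun chain_monomial :: "(nat \<Rightarrow> 'm \<Rightarrow> complex) \<Rightarrow> nat list \<Rightarrow> 'm \<Rightarrow> complex" where
  "chain_monomial f [] A = 1"
| "chain_monomial f (k # \<alpha>) A = f (length \<alpha>) A ^ k * chain_monomial f \<alpha> A"

text \<open>Each exponent is bounded separately, rather than the total degree, which makes the count
  the exact power \<open>(k + 1) ^ i\<close>.\<close>

definition exponents :: "nat \<Rightarrow> nat \<Rightarrow> nat list set" where
  "exponents k i = {\<alpha>. set \<alpha> \<subseteq> {..k} \<and> length \<alpha> = i}"

lemma finite_exponents: "finite (exponents k i)"
  unfolding exponents_def by (rule finite_lists_length_eq) simp

lemma card_exponents: "card (exponents k i) = (k + 1) ^ i"
  unfolding exponents_def by (simp add: card_lists_length_eq)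

lemma exponents_Suc: "exponents k (Suc i) = (\<lambda>(j, \<alpha>). j # \<alpha>) ` ({..k} \<times> exponents k i)"
  by (auto simp: exponents_def length_Suc_conv)

lemma poly_fun_power: "p \<in> poly_fun n \<Longrightarrow> (\<lambda>A. p A ^ k) \<in> poly_fun n"
  by (induction k) (auto intro: poly_fun.intros)

lemma chain_monomial_poly_fun:
  "(\<And>i. i < length \<alpha> \<Longrightarrow> f i \<in> poly_fun n) \<Longrightarrow> chain_monomial f \<alpha> \<in> poly_fun n"
proof (induction \<alpha>)
  case Nil
  then show ?case using poly_fun.const[of 1 n] by simp
next
  case (Cons k \<alpha>)
  have "(\<lambda>A. f (length \<alpha>) A ^ k * chain_monomial f \<alpha> A) \<in> poly_fun n"
    using Cons by (intro poly_fun.mult poly_fun_power) auto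
  then show ?case by simp
qed

text \<open>Induction along the chain. A relation on \<open>W (Suc i)\<close> is sorted by powers of
  \<open>f i\<close>. The lowest power can be cancelled, since vanishing of products is prime there
  and \<open>f i\<close> is not identically zero. Restricting the rest to \<open>W i\<close>, where
  \<open>f i\<close> vanishes, leaves a relation among the shorter monomials.\<close>

lemma chain_monomial_independent:
  assumes f: "\<And>i. i < d \<Longrightarrow> f i \<in> poly_fun n"
    and vanish: "\<And>i A. i < d \<Longrightarrow> A \<in> W i \<Longrightarrow> f i A = 0"
    and nonzero: "\<And>i. i < d \<Longrightarrow> \<exists>A\<in>W (Suc i). f i A \<noteq> 0"
    and sub: "\<And>i. i < d \<Longrightarrow> W i \<subseteq> W (Suc i)" and ne: "W 0 \<noteq> {}"
    and prime: "\<And>i p q. i \<le> d \<Longrightarrow> p \<in> poly_fun n \<Longrightarrow> q \<in> poly_fun n \<Longrightarrow>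
      (\<And>A. A \<in> W i \<Longrightarrow> p A * q A = 0) \<Longrightarrow> (\<forall>A\<in>W i. p A = 0) \<or> (\<forall>A\<in>W i. q A = 0)"
    and "i \<le> d" "\<And>A. A \<in> W i \<Longrightarrow> (\<Sum>\<alpha>\<in>exponents k i. c \<alpha> * chain_monomial f \<alpha> A) = 0"
    "\<alpha> \<in> exponents k i"
  shows "c \<alpha> = 0"
  using assms(7-)
proof (induction i arbitrary: c \<alpha>)
  case 0
  obtain A where "A \<in> W 0" using ne by auto
  have "exponents k 0 = {[]}" by (auto simp: exponents_def)
  then show ?case using 0(2)[OF \<open>A \<in> W 0\<close>] 0(3) by simp
next
  case (Suc i)
  have i: "i < d" using Suc.prems by simp
  define g where "g j A = (\<Sum>\<alpha>\<in>exponents k i. c (j # \<alpha>) * chain_monomial f \<alpha> A)" for j A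
  have g_poly: "g j \<in> poly_fun n" for j
  proof -
    have "(\<lambda>A. \<Sum>\<alpha>\<in>exponents k i. c (j # \<alpha>) * chain_monomial f \<alpha> A) \<in> poly_fun n"
      using i by (intro poly_fun_sum finite_exponents poly_fun.mult poly_fun.const chain_monomial_poly_fun f)
        (auto simp: exponents_def)
    then show ?thesis by (simp add: g_def[abs_def])
  qed
  have sum_g: "(\<Sum>j\<le>k. f i A ^ j * g j A) = 0" if "A \<in> W (Suc i)" for A
  proof -
    have "(\<Sum>\<alpha>\<in>exponents k (Suc i). c \<alpha> * chain_monomial f \<alpha> A) =
        (\<Sum>(j, \<alpha>)\<in>{..k} \<times> exponents k i. c (j # \<alpha>) * chain_monomial f (j # \<alpha>) A)"
      unfolding exponents_Suc by (subst sum.reindex) (auto simp: inj_on_def case_prod_beta)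
    also have "\<dots> = (\<Sum>j\<le>k. \<Sum>\<alpha>\<in>exponents k i. c (j # \<alpha>) * chain_monomial f (j # \<alpha>) A)"
      by (simp add: sum.cartesian_product)
    also have "\<dots> = (\<Sum>j\<le>k. f i A ^ j * g j A)"
      unfolding g_def sum_distrib_left by (intro sum.cong) (auto simp: exponents_def)
    finally show ?thesis using Suc.prems(2)[OF that] by simp
  qed
  have zero: "\<forall>\<alpha>\<in>exponents k i. c (j # \<alpha>) = 0" if "j \<le> k" for j
    using that
  proof (induction j rule: less_induct)
    case (less j)
    \<comment> \<open>The relation divided by \<open>f i ^ j\<close>; the coefficients of lower
      powers vanish by the inner induction.\<close>
    define h where "h A = (\<Sum>l\<in>{j..k}. f i A ^ (l - j) * g l A)" for A
    have "(\<lambda>A. \<Sum>l\<in>{j..k}. f i A ^ (l - j) * g l A) \<in> poly_fun n"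
      by (intro poly_fun_sum poly_fun.mult poly_fun_power f i g_poly) auto
    then have h_poly: "h \<in> poly_fun n" by (simp add: h_def[abs_def])
    have "f i A ^ j * h A = 0" if A: "A \<in> W (Suc i)" for A
    proof -
      have "f i A ^ j * h A = (\<Sum>l\<in>{j..k}. f i A ^ l * g l A)"
        unfolding h_def sum_distrib_left
        by (intro sum.cong) (auto simp: mult.assoc[symmetric] power_add[symmetric])
      also have "\<dots> = (\<Sum>l\<le>k. f i A ^ l * g l A)"
      proof (rule sum.mono_neutral_left)
        show "\<forall>l\<in>{..k} - {j..k}. f i A ^ l * g l A = 0"
        proof
          fix l assume "l \<in> {..k} - {j..k}"
          then have "g l A = 0" using less.IH[of l] by (auto simp: g_def)
          then show "f i A ^ l * g l A = 0" by simp
        qed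
      qed auto
      finally show ?thesis using sum_g[OF A] by simp
    qed
    then have "(\<forall>A\<in>W (Suc i). f i A ^ j = 0) \<or> (\<forall>A\<in>W (Suc i). h A = 0)"
      using Suc.prems(1) by (intro prime poly_fun_power f i h_poly) auto
    then have h0: "\<forall>A\<in>W (Suc i). h A = 0" using nonzero[OF i] by auto
    have "g j A = 0" if A: "A \<in> W i" for A
    proof -
      have "h A = (\<Sum>l\<in>{j}. f i A ^ (l - j) * g l A)"
        unfolding h_def using less.prems vanish[OF i A]
        by (intro sum.mono_neutral_right) auto
      then show ?thesis using h0 sub[OF i] A by auto
    qed
    then have "c (j # \<alpha>) = 0" if "\<alpha> \<in> exponents k i" for \<alpha>
      using Suc.IH[of "\<lambda>\<alpha>. c (j # \<alpha>)" \<alpha>] that i by (auto simp: g_def)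
    then show ?case by blast
  qed
  from Suc.prems(3) obtain j \<beta> where "\<alpha> = j # \<beta>" "j \<le> k" "\<beta> \<in> exponents k i"
    by (auto simp: exponents_Suc)
  then show ?case using zero by auto
qed

lemma irreducible_closedinD:
  "irreducible_closedin X Z \<Longrightarrow> closedin X A \<Longrightarrow> closedin X B \<Longrightarrow> Z = A \<union> B \<Longrightarrow> Z = A \<or> Z = B"
  unfolding irreducible_closedin_def by blast

context chart_variety
begin

lemma closedin_X: "closedin X Z \<Longrightarrow> closedin (flag_top n) Z \<and> Z \<subseteq> Y"
  using closed closedin_subset by (auto simp: closedin_closed_subtopology)

text \<open>If \<open>p * q\<close> vanishes on the chart part of \<open>Z\<close>, the two closed
  sets obtained by removing the loci of \<open>p \<noteq> 0\<close> and of
  \<open>q \<noteq> 0\<close> cover \<open>Z\<close>, so one of them is all of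
  \<open>Z\<close>.\<close>

lemma irreducible_prime:
  assumes Z: "irreducible_closedin X Z" and p: "p \<in> poly_fun n" and q: "q \<in> poly_fun n"
    and pq: "\<And>A. A \<in> slice n u \<Longrightarrow> coset_of n A \<in> Z \<Longrightarrow> p A * q A = 0"
  shows "(\<forall>A\<in>slice n u. coset_of n A \<in> Z \<longrightarrow> p A = 0) \<or> (\<forall>A\<in>slice n u. coset_of n A \<in> Z \<longrightarrow> q A = 0)"
proof -
  have Zc: "closedin X Z" using Z by (simp add: irreducible_closedin_def)
  have cl: "closedin X (Z - chart_basic n u r)" if "r \<in> poly_fun n" for r
  proof -
    have "closedin (flag_top n) (Z - chart_basic n u r)"
      using closedin_X[OF Zc] openin_chart_basic[OF u that] by (simp add: closedin_diff)
    then show ?thesis using closedin_X[OF Zc] closed by (auto simp: closedin_closed_subtopology)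
  qed
  have "Z = (Z - chart_basic n u p) \<union> (Z - chart_basic n u q)"
  proof -
    have "y \<notin> chart_basic n u q" if y: "y \<in> Z" "y \<in> chart_basic n u p" for y
    proof -
      obtain A where "A \<in> slice n u" "y = coset_of n A" "p A \<noteq> 0" using y(2) by (auto simp: chart_basic_def)
      then show ?thesis using pq[of A] y(1) coset_of_in_chart_basic_iff[OF u] by auto
    qed
    then show ?thesis by auto
  qed
  from irreducible_closedinD[OF Z cl[OF p] cl[OF q] this]
  have "Z = Z - chart_basic n u p \<or> Z = Z - chart_basic n u q" .
  then show ?thesis using coset_of_in_chart_basic_iff[OF u] by blast
qed

text \<open>A proper inclusion is already visible inside a chart that meets the larger set.
  Otherwise the larger set would be the union of the smaller one and of its closed part outside the
  chart.\<close>

lemma irreducible_strict_witness: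
  assumes Z: "irreducible_closedin X Z" "irreducible_closedin X Z'" "Z' \<subset> Z"
    and A0: "A0 \<in> slice n u" "coset_of n A0 \<in> Z"
  obtains p where "p \<in> poly_fun n" "\<And>A. A \<in> slice n u \<Longrightarrow> coset_of n A \<in> Z' \<Longrightarrow> p A = 0"
    "\<exists>A\<in>slice n u. coset_of n A \<in> Z \<and> p A \<noteq> 0"
proof -
  have Zc: "closedin X Z" "closedin X Z'" using Z by (auto simp: irreducible_closedin_def)
  have "closedin (flag_top n) (Z - chart n u)"
    using closedin_X[OF Zc(1)] openin_chart[OF u] by (simp add: closedin_diff)
  then have cl: "closedin X (Z - chart n u)"
    using closedin_X[OF Zc(1)] closed by (auto simp: closedin_closed_subtopology)
  have "\<not> Z \<inter> chart n u \<subseteq> Z'"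
  proof
    assume "Z \<inter> chart n u \<subseteq> Z'"
    then have "Z = Z' \<union> (Z - chart n u)" using Z(3) by auto
    from irreducible_closedinD[OF Z(1) Zc(2) cl this] have "Z = Z' \<or> Z = Z - chart n u" .
    then show False using Z(3) A0 by (auto simp: chart_def)
  qed
  then obtain A where A: "A \<in> slice n u" "coset_of n A \<in> Z" "coset_of n A \<notin> Z'"
    by (auto simp: chart_def)
  have Z'c: "closedin (flag_top n) Z'" using closedin_X[OF Zc(2)] by simp
  obtain p where p: "p \<in> poly_fun n" "p A \<noteq> 0"
    "\<And>h. h \<in> carrier (GL n) \<Longrightarrow> p h \<noteq> 0 \<Longrightarrow> coset_of n h \<notin> Z'"
    using closedin_flag_nbhd[OF Z'c slice_GL[OF u A(1)] A(3)] by blast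
  show ?thesis by (rule that[OF p(1)]) (use A p slice_GL[OF u] in auto)
qed

text \<open>The map \<open>\<theta>\<close> has dense image, and \<open>B\<close> is a
  multiplicative filtration of polynomial growth of order \<open>r\<close>. The chain functions pull
  back into the span of a common level \<open>B m\<close>, so their monomials with exponents at most
  \<open>k\<close> land at level \<open>d * (k * m)\<close>. Density turns a relation between
  pullbacks into one on the chart, which \<open>chain_monomial_independent\<close> excludes.
  Comparing cardinalities for all \<open>k\<close> gives the bound.\<close>

lemma local_dim_le:
  fixes \<theta> :: "'t \<Rightarrow> complex mat" and B :: "nat \<Rightarrow> ('t \<Rightarrow> complex) set"
  assumes A0: "A0 \<in> K"
    and dense: "\<And>p. p \<in> poly_fun n \<Longrightarrow> (\<And>t. p (\<theta> t) = 0) \<Longrightarrow> \<forall>A\<in>K. p A = 0"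
    and B: "\<And>k. finite (B k)" "\<And>k. card (B k) \<le> (C * k + 1) ^ r"
      "\<And>k l. k \<le> l \<Longrightarrow> B k \<subseteq> B l" "(\<lambda>_. 1) \<in> B 0"
      "\<And>k l f g. f \<in> B k \<Longrightarrow> g \<in> B l \<Longrightarrow> (\<lambda>t. f t * g t) \<in> B (k + l)"
    and entries: "\<And>a j. a < n \<Longrightarrow> j < n \<Longrightarrow> (\<lambda>t. \<theta> t $$ (a, j)) \<in> cfun.span (B 1)"
  shows "local_dim X (coset_of n A0) \<le> enat r"
proof -
  have span_mult: "(\<lambda>t. f t * g t) \<in> cfun.span (B (k + l))"
    if "f \<in> cfun.span (B k)" "g \<in> cfun.span (B l)" for f g k l
    using that by (rule span_times) (auto intro: cfun.span_base B(5))
  have span_mono: "f \<in> cfun.span (B l)" if "f \<in> cfun.span (B k)" "k \<le> l" for f k l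
    using that cfun.span_mono[OF B(3)] by blast
  have span_poly: "\<exists>k. (\<lambda>t. p (\<theta> t)) \<in> cfun.span (B k)" if "p \<in> poly_fun n" for p
    using that
  proof induction
    case (const c)
    have "(\<lambda>t. c * 1) \<in> cfun.span (B 0)" by (intro cfun.span_scale cfun.span_base B(4))
    then show ?case by auto
  next
    case (entry i j)
    then show ?case using entries by blast
  next
    case (add p q)
    then obtain k l where "(\<lambda>t. p (\<theta> t)) \<in> cfun.span (B k)" "(\<lambda>t. q (\<theta> t)) \<in> cfun.span (B l)" by blast
    then have "(\<lambda>t. p (\<theta> t)) + (\<lambda>t. q (\<theta> t)) \<in> cfun.span (B (k + l))"
      by (intro cfun.span_add) (auto intro: span_mono)
    then show ?case by (auto simp: plus_fun_def)
  next
    case (mult p q)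
    then show ?case using span_mult by blast
  qed
  have span_power: "(\<lambda>t. f t ^ j) \<in> cfun.span (B (j * k))" if "f \<in> cfun.span (B k)" for f j k
  proof (induction j)
    case 0
    then show ?case using cfun.span_base[OF B(4)] by simp
  next
    case (Suc j)
    then show ?case using span_mult[OF that Suc] by simp
  qed
  have "d \<le> r" if Z: "\<And>i. i \<le> d \<Longrightarrow> irreducible_closedin X (Z i)"
      "\<And>i. i \<le> d \<Longrightarrow> coset_of n A0 \<in> Z i" "\<And>i. i < d \<Longrightarrow> Z i \<subset> Z (Suc i)" for d Z
  proof -
    define W where "W i = {A \<in> slice n u. coset_of n A \<in> Z i}" for i
    have "\<exists>f. f \<in> poly_fun n \<and> (\<forall>A\<in>W i. f A = 0) \<and> (\<exists>A\<in>W (Suc i). f A \<noteq> 0)" if i: "i < d" for i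
    proof -
      obtain p where "p \<in> poly_fun n" "\<And>A. A \<in> slice n u \<Longrightarrow> coset_of n A \<in> Z i \<Longrightarrow> p A = 0"
        "\<exists>A\<in>slice n u. coset_of n A \<in> Z (Suc i) \<and> p A \<noteq> 0"
        by (rule irreducible_strict_witness[OF Z(1) Z(1) Z(3)[OF i] K_slice[OF A0] Z(2)]) (use i in auto)
      then show ?thesis by (intro exI[of _ p]) (auto simp: W_def)
    qed
    then obtain f where f: "\<And>i. i < d \<Longrightarrow> f i \<in> poly_fun n"
      "\<And>i A. i < d \<Longrightarrow> A \<in> W i \<Longrightarrow> f i A = 0" "\<And>i. i < d \<Longrightarrow> \<exists>A\<in>W (Suc i). f i A \<noteq> 0"
      by metis
    have WK: "W d \<subseteq> K" using closedin_X Z(1)[of d] by (auto simp: W_def K_def irreducible_closedin_def)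
    have "\<exists>m. \<forall>i<d. (\<lambda>t. f i (\<theta> t)) \<in> cfun.span (B m)"
    proof -
      have "\<forall>i\<in>{..<d}. \<exists>k. (\<lambda>t. f i (\<theta> t)) \<in> cfun.span (B k)" using span_poly f(1) by simp
      from bchoice[OF this] obtain m where m: "\<And>i. i < d \<Longrightarrow> (\<lambda>t. f i (\<theta> t)) \<in> cfun.span (B (m i))"
        by auto
      have "(\<lambda>t. f i (\<theta> t)) \<in> cfun.span (B (\<Sum>i<d. m i))" if "i < d" for i
        by (rule span_mono[OF m[OF that]]) (use that in \<open>auto intro!: member_le_sum\<close>)
      then show ?thesis by blast
    qed
    then obtain m where m: "\<And>i. i < d \<Longrightarrow> (\<lambda>t. f i (\<theta> t)) \<in> cfun.span (B m)" by blast
    have mono_span: "(\<lambda>t. chain_monomial f \<alpha> (\<theta> t)) \<in> cfun.span (B (length \<alpha> * (k * m)))"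
      if "set \<alpha> \<subseteq> {..k}" "length \<alpha> \<le> d" for \<alpha> k
      using that
    proof (induction \<alpha>)
      case Nil
      then show ?case using cfun.span_base[OF B(4)] by simp
    next
      case (Cons j \<alpha>)
      have "(\<lambda>t. f (length \<alpha>) (\<theta> t) ^ j) \<in> cfun.span (B (j * m))"
        using Cons.prems by (intro span_power m) auto
      then have "(\<lambda>t. f (length \<alpha>) (\<theta> t) ^ j) \<in> cfun.span (B (k * m))"
        by (rule span_mono) (use Cons.prems in auto)
      from span_mult[OF this Cons.IH] show ?case using Cons.prems by simp
    qed
    have "(k + 1) ^ d \<le> (C * d * m * k + 1) ^ r" for k
    proof -
      have "card (exponents k d) \<le> card (B (d * (k * m)))"
      proof (rule family_card_bound[OF finite_exponents B(1), of _ _ "\<lambda>\<alpha> t. chain_monomial f \<alpha> (\<theta> t)"])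
        fix \<alpha> assume "\<alpha> \<in> exponents k d"
        then show "(\<lambda>t. chain_monomial f \<alpha> (\<theta> t)) \<in> cfun.span (B (d * (k * m)))"
          using mono_span[of \<alpha> k] by (auto simp: exponents_def)
      next
        fix c \<alpha> assume c: "\<And>t. (\<Sum>\<alpha>\<in>exponents k d. c \<alpha> * chain_monomial f \<alpha> (\<theta> t)) = 0"
          and \<alpha>: "\<alpha> \<in> exponents k d"
        have "(\<lambda>A. \<Sum>\<alpha>\<in>exponents k d. c \<alpha> * chain_monomial f \<alpha> A) \<in> poly_fun n"
          by (intro poly_fun_sum finite_exponents poly_fun.mult poly_fun.const chain_monomial_poly_fun f)
            (auto simp: exponents_def)
        from dense[OF this c] have *: "(\<Sum>\<alpha>\<in>exponents k d. c \<alpha> * chain_monomial f \<alpha> A) = 0" if "A \<in> W d" for A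
          using that WK by auto
        show "c \<alpha> = 0"
        proof (rule chain_monomial_independent[where d = d and f = f and n = n and W = W and i = d
              and k = k and c = c and \<alpha> = \<alpha>])
          show "d \<le> d" "\<alpha> \<in> exponents k d" by (simp_all add: \<alpha>)
          show "(\<Sum>\<alpha>\<in>exponents k d. c \<alpha> * chain_monomial f \<alpha> A) = 0" if "A \<in> W d" for A
            by (rule *[OF that])
          show "f i \<in> poly_fun n" "\<exists>A\<in>W (Suc i). f i A \<noteq> 0" if "i < d" for i
            using f(1,3)[OF that] by auto
          show "f i A = 0" if "i < d" "A \<in> W i" for i A by (rule f(2)[OF that])
          show "W i \<subseteq> W (Suc i)" if "i < d" for i using Z(3)[OF that] by (auto simp: W_def)
          show "W 0 \<noteq> {}" using Z(2)[of 0] K_slice[OF A0] by (auto simp: W_def)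
          fix i p q assume i: "i \<le> d" and pq: "p \<in> poly_fun n" "q \<in> poly_fun n"
            and "\<And>A. A \<in> W i \<Longrightarrow> p A * q A = 0"
          then have "p A * q A = 0" if "A \<in> slice n u" "coset_of n A \<in> Z i" for A
            using that by (simp add: W_def)
          from irreducible_prime[OF Z(1)[OF i] pq this]
          show "(\<forall>A\<in>W i. p A = 0) \<or> (\<forall>A\<in>W i. q A = 0)" by (auto simp: W_def)
        qed
      qed
      also have "\<dots> \<le> (C * (d * (k * m)) + 1) ^ r" by (rule B(2))
      also have "C * (d * (k * m)) = C * d * m * k" by simp
      finally show ?thesis by (simp add: card_exponents)
    qed
    then show ?thesis by (rule power_growth_le)
  qed
  note le = this
  show ?thesis unfolding local_dim_def
  proof (rule Sup_least)
    fix x assume "x \<in> {enat d | d. \<exists>Z :: nat \<Rightarrow> complex mat set set.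
      (\<forall>i\<le>d. irreducible_closedin X (Z i) \<and> coset_of n A0 \<in> Z i) \<and> (\<forall>i<d. Z i \<subset> Z (Suc i))}"
    then obtain d and Z :: "nat \<Rightarrow> complex mat set set" where d: "x = enat d"
      and Z: "\<forall>i\<le>d. irreducible_closedin X (Z i) \<and> coset_of n A0 \<in> Z i" "\<forall>i<d. Z i \<subset> Z (Suc i)"
      by blast
    have "d \<le> r" by (rule le[of d Z]) (use Z in simp_all)
    then show "x \<le> enat r" using d by simp
  qed
qed

end

section \<open>Charts parametrized by an affine space\<close>

inductive_set mpoly :: "'i set \<Rightarrow> (('i \<Rightarrow> complex) \<Rightarrow> complex) set" for I where
  const: "(\<lambda>_. c) \<in> mpoly I"
| var: "i \<in> I \<Longrightarrow> (\<lambda>z. z i) \<in> mpoly I"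
| add: "p \<in> mpoly I \<Longrightarrow> q \<in> mpoly I \<Longrightarrow> (\<lambda>z. p z + q z) \<in> mpoly I"
| mult: "p \<in> mpoly I \<Longrightarrow> q \<in> mpoly I \<Longrightarrow> (\<lambda>z. p z * q z) \<in> mpoly I"

lemma mpoly_cong:
  "p \<in> mpoly I \<Longrightarrow> (\<And>i. i \<in> I \<Longrightarrow> z i = z' i) \<Longrightarrow> p z = p z'"
  by (induction rule: mpoly.induct) auto

lemma mpoly_line:
  assumes "p \<in> mpoly I" shows "\<exists>P. \<forall>s. p (\<lambda>i. z i + s * w i) = poly P s"
  using assms
proof induction
  case (const c)
  then show ?case by (intro exI[of _ "[:c:]"]) simp
next
  case (var i)
  then show ?case by (intro exI[of _ "[:z i, w i:]"]) simp
next
  case (add p q)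
  then obtain P Q where "\<forall>s. p (\<lambda>i. z i + s * w i) = poly P s" "\<forall>s. q (\<lambda>i. z i + s * w i) = poly Q s"
    by blast
  then show ?case by (intro exI[of _ "P + Q"]) simp
next
  case (mult p q)
  then obtain P Q where "\<forall>s. p (\<lambda>i. z i + s * w i) = poly P s" "\<forall>s. q (\<lambda>i. z i + s * w i) = poly Q s"
    by blast
  then show ?case by (intro exI[of _ "P * Q"]) simp
qed

lemma mpoly_entries:
  assumes "p \<in> mpoly I" "\<And>i. i \<in> I \<Longrightarrow> fst (e i) < n \<and> snd (e i) < n"
  shows "(\<lambda>A. p (\<lambda>i. A $$ e i)) \<in> poly_fun n"
  using assms(1)
proof induction
  case (var i)
  then show ?case using poly_fun.entry[of "fst (e i)" n "snd (e i)"] assms(2) by simp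
qed (auto intro: poly_fun.intros)

text \<open>The map \<open>\<psi>\<close> and the reading of the entries \<open>e\<close> are
  mutually inverse polynomial maps, so the chart of \<open>Y\<close> is the graph of a polynomial
  map over the affine space with coordinates \<open>I\<close>.\<close>

locale parametrized_chart = chart_variety +
  fixes I :: "'i set" and e :: "'i \<Rightarrow> nat \<times> nat" and \<psi> :: "('i \<Rightarrow> complex) \<Rightarrow> complex mat"
  assumes finite_I: "finite I" and e: "\<And>i. i \<in> I \<Longrightarrow> fst (e i) < n \<and> snd (e i) < n"
    and \<psi>_K: "\<And>z. \<psi> z \<in> K"
    and \<psi>_entries: "\<And>a j. a < n \<Longrightarrow> j < n \<Longrightarrow> (\<lambda>z. \<psi> z $$ (a, j)) \<in> mpoly I"
    and \<psi>_coord: "\<And>i z. i \<in> I \<Longrightarrow> \<psi> z $$ e i = z i"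
    and \<psi>_surj: "\<And>A. A \<in> K \<Longrightarrow> \<psi> (\<lambda>i. A $$ e i) = A"
begin

lemma poly_curve_line: "poly_curve n (\<lambda>s. \<psi> (\<lambda>i. z i + s * w i))"
  unfolding poly_curve_def using mpoly_line[OF \<psi>_entries] by blast

text \<open>The coordinate lines through \<open>A0\<close> supply the dual curves. They span because
  every entry agrees on \<open>K\<close> with a polynomial in the entries \<open>e i\<close>, so a
  derivation killing the latter kills the former.\<close>

lemma tangent_dim:
  assumes A0: "A0 \<in> K"
  shows "has_complex_dim (tangent_space X F (coset_of n A0)) (card I)"
proof -
  define z0 where "z0 i = A0 $$ e i" for i
  have z0: "\<psi> z0 = A0" using \<psi>_surj[OF A0] by (simp add: z0_def[abs_def])
  define \<gamma> where "\<gamma> k s = \<psi> (\<lambda>i. z0 i + s * (if i = k then 1 else 0))" for k s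
  show ?thesis
  proof (rule tangent_dim_eq[where e = e and \<gamma> = \<gamma>, OF finite_I e _ _ _ A0])
    show "poly_curve n (\<gamma> k)" for k unfolding \<gamma>_def[abs_def] by (rule poly_curve_line)
    show "\<gamma> k s \<in> K" for k s by (simp add: \<gamma>_def \<psi>_K)
    show "\<gamma> k 0 = A0" for k using z0 by (simp add: \<gamma>_def)
    show "\<gamma> i s $$ e k = A0 $$ e k + (if i = k then s else 0)" if "k \<in> I" for i k s
      using \<psi>_coord[OF that] by (auto simp: \<gamma>_def z0_def)
    fix D a j assume D: "D \<in> tangent_space X F (coset_of n A0)"
      and kill: "\<And>i. i \<in> I \<Longrightarrow> D (coord_fun (e i)) = 0" and aj: "a < n" "j < n"
    have mp: "D (\<lambda>y. p (\<lambda>i. chart_rep n u y $$ e i)) = 0" if "p \<in> mpoly I" for p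
      using that
    proof induction
      case (const c)
      then show ?case by (rule tangent_const[OF A0 D])
    next
      case (var i)
      then show ?case using kill[OF var] by (simp add: coord_fun_def[abs_def])
    next
      case (add p q)
      have "D (\<lambda>y. p (\<lambda>i. chart_rep n u y $$ e i) + q (\<lambda>i. chart_rep n u y $$ e i)) =
          D (\<lambda>y. p (\<lambda>i. chart_rep n u y $$ e i)) + D (\<lambda>y. q (\<lambda>i. chart_rep n u y $$ e i))"
        by (rule tangentD(1)[OF D regular_poly[OF A0 mpoly_entries[OF add(1) e]]
          regular_poly[OF A0 mpoly_entries[OF add(2) e]]])
      then show ?case using add.IH by simp
    next
      case (mult p q)
      have "D (\<lambda>y. p (\<lambda>i. chart_rep n u y $$ e i) * q (\<lambda>i. chart_rep n u y $$ e i)) =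
          p (\<lambda>i. chart_rep n u (coset_of n A0) $$ e i) * D (\<lambda>y. q (\<lambda>i. chart_rep n u y $$ e i)) +
          q (\<lambda>i. chart_rep n u (coset_of n A0) $$ e i) * D (\<lambda>y. p (\<lambda>i. chart_rep n u y $$ e i))"
        by (rule tangentD(2)[OF D regular_poly[OF A0 mpoly_entries[OF mult(1) e]]
          regular_poly[OF A0 mpoly_entries[OF mult(2) e]]])
      then show ?case using mult.IH by simp
    qed
    define p where "p z = \<psi> z $$ (a, j)" for z
    have p: "p \<in> mpoly I" using \<psi>_entries[OF aj] by (simp add: p_def[abs_def])
    have "(\<lambda>A. A $$ (a, j)) \<in> poly_fun n" using aj by (rule poly_fun.entry)
    from regular_poly[OF A0 this] have r1: "coord_fun (a, j) \<in> regular_at A0"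
      by (simp add: coord_fun_def[abs_def])
    have r2: "(\<lambda>y. p (\<lambda>i. chart_rep n u y $$ e i)) \<in> regular_at A0"
      by (rule regular_poly[OF A0 mpoly_entries[OF p e]])
    have "same_germ X (coset_of n A0) (coord_fun (a, j)) (\<lambda>y. p (\<lambda>i. chart_rep n u y $$ e i))"
      unfolding same_germ_at_iff[OF A0]
    proof (rule bexI[OF _ poly_fun.const[of 1]], intro conjI ballI impI)
      fix A assume A: "A \<in> K"
      then show "coord_fun (a, j) (coset_of n A) = p (\<lambda>i. chart_rep n u (coset_of n A) $$ e i)"
        using \<psi>_surj[OF A] by (simp add: coord_fun_def p_def chart_rep_coset[OF u K_slice[OF A]])
    qed simp
    then have "D (coord_fun (a, j)) = D (\<lambda>y. p (\<lambda>i. chart_rep n u y $$ e i))"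
      by (rule tangentD(3)[OF D r1 r2])
    then show "D (coord_fun (a, j)) = 0" using mp[OF p] by simp
  qed
qed

text \<open>The chain consists of closures of coordinate subspaces through \<open>A0\<close>, with
  one more coordinate set free at each step. They are irreducible because two points of such a
  subspace lie on a line inside it, and two nonzero polynomials on a line have a common nonzero
  argument.\<close>

lemma local_dim_ge:
  assumes A0: "A0 \<in> K"
  shows "enat (card I) \<le> local_dim X (coset_of n A0)"
proof -
  define z0 where "z0 i = A0 $$ e i" for i
  have z0: "\<psi> z0 = A0" using \<psi>_surj[OF A0] by (simp add: z0_def[abs_def])
  define Q where "Q J = {coset_of n (\<psi> z) | z. \<forall>i\<in>I - J. z i = z0 i}" for J
  define Z where "Z J = flag_top n closure_of Q J" for J
  have Q_Y: "Q J \<subseteq> Y" for J using K_Y[OF \<psi>_K] by (auto simp: Q_def)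
  have Y_flags: "Y \<subseteq> flags n" using closed closedin_subset by fastforce
  have Q_Z: "Q J \<subseteq> Z J" for J
    unfolding Z_def using Q_Y Y_flags by (intro closure_of_subset) auto
  have Z_Y: "Z J \<subseteq> Y" for J unfolding Z_def using Q_Y closed by (rule closure_of_minimal)
  have Z_closed: "closedin X (Z J)" for J
    using Z_Y closed by (auto simp: closedin_closed_subtopology Z_def)
  have A0_Q: "coset_of n A0 \<in> Q J" for J using z0 by (auto simp: Q_def intro!: exI[of _ z0])
  have irr: "irreducible_closedin X (Z J)" for J
    unfolding irreducible_closedin_def
  proof (intro conjI allI impI)
    show "Z J \<noteq> {}" using A0_Q[of J] Q_Z[of J] by auto
    fix A B assume AB: "closedin X A \<and> closedin X B \<and> Z J = A \<union> B"
    have cl: "closedin (flag_top n) A" "closedin (flag_top n) B" using AB closedin_X by auto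
    have "Q J \<subseteq> A \<or> Q J \<subseteq> B"
    proof (rule ccontr)
      assume "\<not> (Q J \<subseteq> A \<or> Q J \<subseteq> B)"
      then obtain z z' where z: "\<forall>i\<in>I - J. z i = z0 i" "coset_of n (\<psi> z) \<notin> A"
        and z': "\<forall>i\<in>I - J. z' i = z0 i" "coset_of n (\<psi> z') \<notin> B"
        by (auto simp: Q_def)
      obtain p where p: "p \<in> poly_fun n" "p (\<psi> z) \<noteq> 0"
        "\<And>h. h \<in> carrier (GL n) \<Longrightarrow> p h \<noteq> 0 \<Longrightarrow> coset_of n h \<notin> A"
        using closedin_flag_nbhd[OF cl(1) K_GL[OF \<psi>_K] z(2)] by blast
      obtain q where q: "q \<in> poly_fun n" "q (\<psi> z') \<noteq> 0"
        "\<And>h. h \<in> carrier (GL n) \<Longrightarrow> q h \<noteq> 0 \<Longrightarrow> coset_of n h \<notin> B"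
        using closedin_flag_nbhd[OF cl(2) K_GL[OF \<psi>_K] z'(2)] by blast
      define l where "l s i = z i + s * (z' i - z i)" for s i
      have curve: "poly_curve n (\<lambda>s. \<psi> (l s))"
        using poly_curve_line[of z "\<lambda>i. z' i - z i"] by (simp add: l_def[abs_def])
      obtain P where P: "\<And>s. p (\<psi> (l s)) = poly P s" using poly_curve_poly_fun[OF curve p(1)] by blast
      obtain R where R: "\<And>s. q (\<psi> (l s)) = poly R s" using poly_curve_poly_fun[OF curve q(1)] by blast
      have "l 0 = z" "l 1 = z'" by (auto simp: l_def)
      then have "poly P 0 \<noteq> 0" "poly R 1 \<noteq> 0" using p(2) q(2) P[of 0] R[of 1] by auto
      then have "P * R \<noteq> 0" by auto
      then have "finite {s. poly (P * R) s = 0}" by (rule poly_roots_finite)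
      then obtain s where "s \<notin> {s. poly (P * R) s = 0}"
        using ex_new_if_finite[OF infinite_UNIV_char_0] by blast
      then have "p (\<psi> (l s)) \<noteq> 0" "q (\<psi> (l s)) \<noteq> 0" using P R by auto
      then have "coset_of n (\<psi> (l s)) \<notin> A \<union> B" using p(3) q(3) K_GL[OF \<psi>_K] by blast
      moreover have "\<forall>i\<in>I - J. l s i = z0 i" using z(1) z'(1) by (simp add: l_def)
      then have "coset_of n (\<psi> (l s)) \<in> Q J" unfolding Q_def by blast
      ultimately show False using Q_Z AB by blast
    qed
    then have "Z J \<subseteq> A \<or> Z J \<subseteq> B"
      unfolding Z_def using closure_of_minimal cl by blast
    then show "Z J = A \<or> Z J = B" using AB by blast
  qed (rule Z_closed)
  have strict: "Z J \<subset> Z J'" if J: "J \<subseteq> J'" "k \<in> J'" "k \<notin> J" "k \<in> I" for J J' k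
  proof
    have "Q J \<subseteq> Q J'" using J(1) by (auto simp: Q_def)
    then show "Z J \<subseteq> Z J'" unfolding Z_def by (rule closure_of_mono)
    define z where "z = z0(k := z0 k + 1)"
    have "coset_of n (\<psi> z) \<in> Q J'" using J by (auto simp: Q_def z_def)
    then have in': "coset_of n (\<psi> z) \<in> Z J'" using Q_Z by blast
    define p where "p A = A $$ e k - z0 k" for A
    have ek: "(\<lambda>A. A $$ e k) \<in> poly_fun n"
      using poly_fun.entry[of "fst (e k)" n "snd (e k)"] e[OF J(4)] by simp
    have "p \<in> poly_fun n"
      using poly_fun_diff[OF ek poly_fun.const[of "z0 k"]] by (simp add: p_def[abs_def])
    moreover have "p (\<psi> z) \<noteq> 0" using \<psi>_coord[OF J(4)] by (simp add: p_def z_def)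
    moreover have "p B = 0" if B: "B \<in> slice n u" "coset_of n B \<in> Q J" for B
    proof -
      obtain z' where z': "\<forall>i\<in>I - J. z' i = z0 i" "coset_of n B = coset_of n (\<psi> z')"
        using B(2) by (auto simp: Q_def)
      have "B = \<psi> z'" using coset_of_slice_inj[OF u B(1) K_slice[OF \<psi>_K] z'(2)] .
      then show ?thesis using z'(1) J \<psi>_coord[OF J(4)] by (simp add: p_def)
    qed
    ultimately have "coset_of n (\<psi> z) \<notin> Z J"
      using closure_of_chart_nonzero[OF u _ K_slice[OF \<psi>_K], of p z "Q J"] unfolding Z_def by blast
    then show "Z J \<noteq> Z J'" using in' by blast
  qed
  obtain xs where xs: "set xs = I" "distinct xs" using finite_distinct_list[OF finite_I] by blast
  have len: "length xs = card I" using xs distinct_card by force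
  define V where "V i = Z (set (take i xs))" for i
  have "V i \<subset> V (Suc i)" if "i < card I" for i
  proof -
    have i: "i < length xs" using that len by simp
    have "xs ! i \<notin> set (take i xs)"
      using xs(2) i by (auto simp: in_set_conv_nth nth_eq_iff_index_eq)
    moreover have "set (take (Suc i) xs) = insert (xs ! i) (set (take i xs))"
      using i by (simp add: take_Suc_conv_app_nth)
    ultimately show ?thesis unfolding V_def
      by (intro strict[of _ _ "xs ! i"]) (use i xs(1) nth_mem in auto)
  qed
  moreover have "irreducible_closedin X (V i) \<and> coset_of n A0 \<in> V i" for i
    using irr A0_Q Q_Z unfolding V_def by blast
  ultimately show ?thesis unfolding local_dim_def by (intro Sup_upper) blast
qed

lemma smooth:
  assumes "A0 \<in> K" "local_dim X (coset_of n A0) \<le> enat (card I)"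
  shows "smooth_at X F (coset_of n A0)"
  unfolding smooth_at_def using tangent_dim local_dim_ge assms antisym by blast

end

section \<open>Bruhat order\<close>

lemma transpose_values:
  assumes "inj x"
  shows "Transposition.transpose (x i) (x j) \<circ> x = x \<circ> Transposition.transpose i j"
  using assms by (auto simp: fun_eq_iff Transposition.transpose_def inj_eq)

lemma permutes_swap_values:
  fixes n a b :: nat
  assumes "x permutes {0..<n}" "a < n" "b < n"
  shows "Transposition.transpose a b \<circ> x permutes {0..<n}"
  using permutes_compose[OF assms(1) permutes_swap_id[of a "{0..<n}" b]] assms by simp

definition inversions :: "nat \<Rightarrow> (nat \<Rightarrow> nat) \<Rightarrow> (nat \<times> nat) set" where
  "inversions n x = {(i, j). i < j \<and> j < n \<and> x j < x i}"

lemma perm_length_inversions: "perm_length n x = card (inversions n x)"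
  by (simp add: perm_length_def inversions_def)

lemma finite_inversions: "finite (inversions n x)"
  by (rule finite_subset[of _ "{..<n} \<times> {..<n}"]) (auto simp: inversions_def)

lemma perm_length_le: "perm_length n x \<le> n * n"
proof -
  have "card (inversions n x) \<le> card ({..<n} \<times> {..<n})"
    by (rule card_mono) (auto simp: inversions_def)
  then show ?thesis by (simp add: perm_length_inversions)
qed

text \<open>Inversions of \<open>x\<close> are compared with those of \<open>y\<close> by
  \<open>\<phi>\<close>, which moves a pair of positions by the transposition unless this would
  reverse the order of the pair. The inversion \<open>(i, j)\<close> of \<open>y\<close> is never
  hit, so the length grows.\<close>

context
  fixes n i j :: nat and x y s :: "nat \<Rightarrow> nat" and \<phi> :: "nat \<times> nat \<Rightarrow> nat \<times> nat"
  assumes ij: "i < j" "j < n" "x i < x j" and inj: "inj x"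
  defines "s \<equiv> Transposition.transpose i j" and "y \<equiv> x \<circ> Transposition.transpose i j"
    and "\<phi> \<equiv> (\<lambda>(p, q). if Transposition.transpose i j p < Transposition.transpose i j q
      then (Transposition.transpose i j p, Transposition.transpose i j q) else (p, q))"
begin

lemma inversions_swap_inj: "inj_on \<phi> (inversions n x)"
proof (rule inj_onI)
  fix a b assume ab: "a \<in> inversions n x" "b \<in> inversions n x" "\<phi> a = \<phi> b"
  obtain p q p' q' where pq: "a = (p, q)" "b = (p', q')" by (cases a, cases b)
  have ss: "s (s k) = k" for k by (simp add: s_def)
  have lt: "p < q" "p' < q'" using ab pq by (auto simp: inversions_def)
  have "(if s p < s q then (s p, s q) else (p, q)) = (if s p' < s q' then (s p', s q') else (p', q'))"
    using ab(3) by (simp only: pq \<phi>_def s_def prod.case)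
  then show "a = b" unfolding pq using lt ss by (metis prod.inject)
qed

lemma inversions_swap_subset: "\<phi> ` inversions n x \<subseteq> inversions n y - {(i, j)}"
proof
  fix b assume "b \<in> \<phi> ` inversions n x"
  then obtain p q where pq: "p < q" "q < n" "x q < x p" and b: "b = \<phi> (p, q)"
    by (auto simp: inversions_def)
  show "b \<in> inversions n y - {(i, j)}"
  proof (cases "s p < s q")
    case True
    then have "b = (s p, s q)" by (simp add: b \<phi>_def s_def)
    moreover have "s q < n" using pq ij by (auto simp: s_def Transposition.transpose_def)
    moreover have "(s p, s q) \<noteq> (i, j)"
      using pq ij by (auto simp: s_def Transposition.transpose_def split: if_splits)
    ultimately show ?thesis using True pq by (auto simp: inversions_def y_def s_def)
  next
    case False
    then have "b = (p, q)" by (simp add: b \<phi>_def s_def)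
    then show ?thesis using False pq ij
      by (auto simp: inversions_def y_def s_def Transposition.transpose_def split: if_splits)
  qed
qed

text \<open>Surjectivity is in doubt only for pairs that \<open>\<phi>\<close> leaves in place.
  Apart from \<open>(i, j)\<close> these join \<open>i\<close> or \<open>j\<close> to a position
  between them, and a value that is not between \<open>x i\<close> and \<open>x j\<close> makes them
  inversions of \<open>x\<close> as well.\<close>

lemma inversions_swap_cover:
  assumes "\<And>k. i < k \<Longrightarrow> k < j \<Longrightarrow> \<not> (x i < x k \<and> x k < x j)"
  shows "inversions n y - {(i, j)} \<subseteq> \<phi> ` inversions n x"
proof
  fix b assume b: "b \<in> inversions n y - {(i, j)}"
  then obtain p q where pq: "p < q" "q < n" "y q < y p" and bpq: "b = (p, q)"
    by (auto simp: inversions_def)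
  have ne: "k \<noteq> l \<Longrightarrow> x k \<noteq> x l" for k l using inj by (auto dest: injD)
  show "b \<in> \<phi> ` inversions n x"
  proof (cases "s p < s q")
    case True
    have "s q < n" using pq ij by (auto simp: s_def Transposition.transpose_def)
    then have "(s p, s q) \<in> inversions n x" using True pq by (auto simp: inversions_def y_def s_def)
    moreover have "\<phi> (s p, s q) = b" using pq by (simp add: bpq \<phi>_def s_def)
    ultimately show ?thesis by (metis imageI)
  next
    case False
    have "x q < x p"
    proof (cases "p = i")
      case True
      then have "q \<noteq> j" "q < j" using b bpq False pq ij(1)
        by (auto simp: s_def Transposition.transpose_def split: if_splits)
      then have "x q < x j" using pq True by (simp add: y_def Transposition.transpose_def)
      then show ?thesis using assms[of q] ne[of q i] pq True \<open>q < j\<close> by auto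
    next
      case pi: False
      then have "q = j" "i < p" using False pq ij(1)
        by (auto simp: s_def Transposition.transpose_def split: if_splits)
      then have "x i < x p" using pq pi by (simp add: y_def Transposition.transpose_def)
      then show ?thesis using assms[of p] ne[of p j] pq \<open>q = j\<close> \<open>i < p\<close> by auto
    qed
    then have "(p, q) \<in> inversions n x" using pq by (simp add: inversions_def)
    moreover have "\<phi> (p, q) = b" using False by (simp add: bpq \<phi>_def s_def)
    ultimately show ?thesis by (metis imageI)
  qed
qed

lemma inversions_swap_mem: "(i, j) \<in> inversions n y"
  using ij by (simp add: inversions_def y_def)

lemma perm_length_swap_less: "perm_length n x < perm_length n y"
proof -
  have "card (\<phi> ` inversions n x) \<le> card (inversions n y - {(i, j)})"
    using inversions_swap_subset finite_inversions by (intro card_mono) auto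
  also have "\<dots> < card (inversions n y)"
    using inversions_swap_mem finite_inversions by (intro card_Diff1_less)
  finally show ?thesis using card_image[OF inversions_swap_inj] by (simp add: perm_length_inversions)
qed

lemma perm_length_swap_cover:
  assumes "\<And>k. i < k \<Longrightarrow> k < j \<Longrightarrow> \<not> (x i < x k \<and> x k < x j)"
  shows "perm_length n y = Suc (perm_length n x)"
proof -
  have "\<phi> ` inversions n x = inversions n y - {(i, j)}"
    using inversions_swap_subset inversions_swap_cover[OF assms] by blast
  then have "card (inversions n x) = card (inversions n y - {(i, j)})"
    using card_image[OF inversions_swap_inj] by simp
  also have "Suc \<dots> = card (inversions n y)"
    using inversions_swap_mem finite_inversions by (rule card_Suc_Diff1[rotated])
  finally show ?thesis by (simp add: perm_length_inversions)
qed

end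

lemma bruhat_step_up:
  assumes "x permutes {0..<n}" "i < j" "j < n" "x i < x j"
  shows "bruhat_step n x (Transposition.transpose (x i) (x j) \<circ> x)"
proof -
  have "x i < n" "x j < n" using assms permutes_lessD by auto
  moreover have "perm_length n x < perm_length n (Transposition.transpose (x i) (x j) \<circ> x)"
    unfolding transpose_values[OF permutes_inj[OF assms(1)]]
    by (rule perm_length_swap_less[OF assms(2-4) permutes_inj[OF assms(1)]])
  ultimately show ?thesis unfolding bruhat_step_def by blast
qed

lemma transpose_comp_self: "Transposition.transpose a b \<circ> (Transposition.transpose a b \<circ> x) = x"
  by (simp add: fun_eq_iff)

lemma bruhat_step_down:
  assumes x: "x permutes {0..<n}" "i < j" "j < n" "x j < x i"
  shows "bruhat_step n (Transposition.transpose (x i) (x j) \<circ> x) x"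
proof -
  let ?y = "Transposition.transpose (x i) (x j) \<circ> x"
  have y: "?y i = x j" "?y j = x i" by simp_all
  have "?y permutes {0..<n}" using x permutes_lessD by (intro permutes_swap_values) auto
  from bruhat_step_up[OF this x(2,3)] show ?thesis
    unfolding y using x(4) by (simp add: transpose_commute[of "x j"] transpose_comp_self)
qed

text \<open>The definition provides two values in no particular order; the growth of the length
  decides which of their positions comes first.\<close>

lemma bruhat_stepE:
  assumes u: "u permutes {0..<n}" and "bruhat_step n u v"
  obtains i j where "i < j" "j < n" "u i < u j" "v = Transposition.transpose (u i) (u j) \<circ> u"
proof -
  obtain a b where ab: "a < n" "b < n" "v = Transposition.transpose a b \<circ> u"
    and less: "perm_length n u < perm_length n v"
    using assms(2) by (auto simp: bruhat_step_def)
  obtain i where i: "u i = a" using permutes_surj[OF u] by (metis surjD)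
  obtain j where j: "u j = b" using permutes_surj[OF u] by (metis surjD)
  note ij = i j
  have ltn: "i < n" "j < n" using ij ab permutes_in_image[OF u] by fastforce+
  have *: "\<exists>i j. i < j \<and> j < n \<and> u i < u j \<and> v = Transposition.transpose (u i) (u j) \<circ> u"
    if p: "p < q" "q < n" "v = Transposition.transpose (u p) (u q) \<circ> u" for p q
  proof -
    have "u p \<noteq> u q" using p(1) permutes_inj[OF u] by (auto dest: injD)
    moreover have "\<not> u q < u p"
    proof
      assume "u q < u p"
      from bruhat_step_down[OF u p(1,2) this] have "perm_length n v < perm_length n u"
        unfolding p(3) by (auto simp: bruhat_step_def)
      then show False using less by simp
    qed
    ultimately show ?thesis using p by (metis linorder_neqE_nat)
  qed
  have "i \<noteq> j" using less ab ij by auto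
  then consider "i < j" | "j < i" by linarith
  then have "\<exists>i j. i < j \<and> j < n \<and> u i < u j \<and> v = Transposition.transpose (u i) (u j) \<circ> u"
  proof cases
    case 1
    then show ?thesis using *[of i j] ltn ab ij by simp
  next
    case 2
    then show ?thesis using *[of j i] ltn ab ij by (simp add: transpose_commute)
  qed
  then show ?thesis using that by blast
qed

lemma bruhat_step_permutes:
  assumes "u permutes {0..<n}" "bruhat_step n u v" shows "v permutes {0..<n}"
  using assms(2) permutes_swap_values[OF assms(1)] by (auto simp: bruhat_step_def)

lemma bruhat_le_step: "bruhat_step n x y \<Longrightarrow> bruhat_le n x y"
  by (simp add: bruhat_le_def)

lemma bruhat_le_trans: "bruhat_le n x y \<Longrightarrow> bruhat_le n y z \<Longrightarrow> bruhat_le n x z"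
  by (simp add: bruhat_le_def)

text \<open>On the positions \<open>i, k, j\<close> the pattern of \<open>x\<close> is 123 and that
  of \<open>z\<close> is 321. Both 213 and 132 rise to 231, and 231 rises to 321.\<close>

lemma bruhat_le_intermediate:
  assumes x: "x permutes {0..<n}" and k: "i < k" "k < j" "j < n" "x i < x k" "x k < x j"
  defines "z \<equiv> Transposition.transpose (x i) (x j) \<circ> x"
  shows "bruhat_le n (Transposition.transpose (x i) (x k) \<circ> x) z"
    and "bruhat_le n (Transposition.transpose (x k) (x j) \<circ> x) z"
proof -
  have lt: "x i < n" "x k < n" "x j < n" using k permutes_lessD[OF x] by auto
  let ?y = "Transposition.transpose (x i) (x k) \<circ> x"
  let ?y' = "Transposition.transpose (x i) (x j) \<circ> ?y"
  have y: "?y permutes {0..<n}" by (rule permutes_swap_values[OF x]) (fact lt)+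
  have y': "?y' permutes {0..<n}" by (rule permutes_swap_values[OF y]) (fact lt)+
  have v: "?y i = x k" "?y k = x i" "?y j = x j" using k by (auto simp: Transposition.transpose_def)
  have v': "?y' i = x k" "?y' k = x j" using k by (auto simp: Transposition.transpose_def)
  have 1: "bruhat_step n ?y ?y'" using bruhat_step_up[OF y k(2,3)] k unfolding v by simp
  have 2: "bruhat_step n ?y' (Transposition.transpose (x k) (x j) \<circ> ?y')"
    using bruhat_step_up[OF y' k(1)] k unfolding v' by simp
  have "Transposition.transpose (x k) (x j) \<circ> ?y' = z"
    using k by (auto simp: fun_eq_iff z_def Transposition.transpose_def)
  then show "bruhat_le n ?y z" using 1 2 bruhat_le_trans bruhat_le_step by metis
next
  have lt: "x i < n" "x k < n" "x j < n" using k permutes_lessD[OF x] by auto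
  let ?y = "Transposition.transpose (x k) (x j) \<circ> x"
  let ?y' = "Transposition.transpose (x i) (x k) \<circ> ?y"
  have y: "?y permutes {0..<n}" by (rule permutes_swap_values[OF x]) (fact lt)+
  have y': "?y' permutes {0..<n}" by (rule permutes_swap_values[OF y]) (fact lt)+
  have v: "?y i = x i" "?y j = x k" using k by (auto simp: Transposition.transpose_def)
  have v': "?y' i = x k" "?y' k = x j" using k by (auto simp: Transposition.transpose_def)
  have "i < j" using k by simp
  then have 1: "bruhat_step n ?y ?y'" using bruhat_step_up[OF y _ k(3), of i] k unfolding v by simp
  have 2: "bruhat_step n ?y' (Transposition.transpose (x k) (x j) \<circ> ?y')"
    using bruhat_step_up[OF y' k(1)] k unfolding v' by simp
  have "Transposition.transpose (x k) (x j) \<circ> ?y' = z"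
    using k by (auto simp: fun_eq_iff z_def Transposition.transpose_def)
  then show "bruhat_le n ?y z" using 1 2 bruhat_le_trans bruhat_le_step by metis
qed

subsection \<open>The rank criterion\<close>

definition rank_ge :: "(nat \<Rightarrow> nat) \<Rightarrow> nat \<Rightarrow> nat \<Rightarrow> nat" where
  "rank_ge x p q = card {i. i < p \<and> q \<le> x i}"

lemma rank_ge_split:
  assumes "q \<le> q'"
  shows "rank_ge x p q = rank_ge x p q' + card {i. i < p \<and> q \<le> x i \<and> x i < q'}"
proof -
  have "{i. i < p \<and> q \<le> x i} = {i. i < p \<and> q' \<le> x i} \<union> {i. i < p \<and> q \<le> x i \<and> x i < q'}"
    using assms by auto
  then show ?thesis unfolding rank_ge_def by (simp add: card_Un_disjoint disjoint_iff)
qed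

text \<open>Bjoerner and Brenti, Combinatorics of Coxeter Groups, Theorem 2.1.5: swap the first position
  where \<open>x\<close> and \<open>y\<close> differ with the first later one whose value lies in the interval
  between \<open>x\<close> and \<open>y\<close> there.\<close>

lemma rank_criterion:
  assumes "x permutes {0..<n}" "y permutes {0..<n}"
    and "\<And>p q. p \<le> n \<Longrightarrow> rank_ge x p q \<le> rank_ge y p q"
  shows "bruhat_le n x y"
  using assms(1,3)
proof (induction "n * n - perm_length n x" arbitrary: x rule: less_induct)
  case less
  note x = less.prems(1) and rank = less.prems(2) and y = assms(2)
  have injx: "inj x" and injy: "inj y" using x y by (auto intro: permutes_inj)
  show ?case
  proof (cases "x = y")
    case True
    then show ?thesis by (simp add: bruhat_le_def)
  next
    case False
    define i where "i = (LEAST i. x i \<noteq> y i)"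
    have "\<exists>i. x i \<noteq> y i" using False by (auto simp: fun_eq_iff)
    then have xy: "x i \<noteq> y i" unfolding i_def by (rule LeastI_ex)
    have eq: "x a = y a" if "a < i" for a using that not_less_Least unfolding i_def by blast
    have i: "i < n"
    proof (rule ccontr)
      assume "\<not> i < n"
      then have "x i = i" "y i = i" using x y by (auto intro: permutes_not_in)
      then show False using xy by simp
    qed
    have less_i: "x i < y i"
    proof (rule ccontr)
      assume "\<not> x i < y i"
      then have gt: "y i < x i" using xy by simp
      have "{a. a < Suc i \<and> x i \<le> x a} = insert i {a. a < i \<and> x i \<le> y a}"
        using eq by (auto simp: less_Suc_eq)
      then have "rank_ge x (Suc i) (x i) = Suc (card {a. a < i \<and> x i \<le> y a})"
        by (simp add: rank_ge_def)
      moreover have "{a. a < Suc i \<and> x i \<le> y a} = {a. a < i \<and> x i \<le> y a}"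
        using gt by (auto simp: less_Suc_eq)
      then have "rank_ge y (Suc i) (x i) = card {a. a < i \<and> x i \<le> y a}" by (simp add: rank_ge_def)
      ultimately show False using rank[of "Suc i" "x i"] i by simp
    qed
    define Q where "Q j \<longleftrightarrow> i < j \<and> x i < x j \<and> x j \<le> y i" for j
    obtain j' where j': "x j' = y i" using permutes_surj[OF x] by (metis surjD)
    have "j' \<noteq> i" using j' xy by auto
    moreover have "\<not> j' < i"
    proof
      assume "j' < i"
      then have "y j' = y i" using eq j' by simp
      then show False using injy \<open>j' < i\<close> by (auto dest: injD)
    qed
    ultimately have Qj': "Q j'" using j' less_i by (simp add: Q_def)
    define j where "j = (LEAST j. Q j)"
    have Qj: "Q j" unfolding j_def using Qj' by (rule LeastI)
    have min: "\<not> Q k" if "k < j" for k using that not_less_Least unfolding j_def by blast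
    have "j' < n"
    proof (rule ccontr)
      assume "\<not> j' < n"
      then have "x j' = j'" using x by (intro permutes_not_in) auto
      then show False using j' \<open>\<not> j' < n\<close> permutes_lessD[OF y i] by simp
    qed
    moreover have "j \<le> j'" unfolding j_def using Qj' by (rule Least_le)
    ultimately have j: "i < j" "j < n" "x i < x j" "x j \<le> y i" using Qj by (auto simp: Q_def)
    define x' where "x' = Transposition.transpose (x i) (x j) \<circ> x"
    have x'_eq: "x' = x \<circ> Transposition.transpose i j"
      unfolding x'_def by (rule transpose_values[OF injx])
    have step: "bruhat_step n x x'" unfolding x'_def by (rule bruhat_step_up[OF x j(1-3)])
    then have len: "perm_length n x < perm_length n x'" by (auto simp: bruhat_step_def)
    have "rank_ge x' p q \<le> rank_ge y p q" if p: "p \<le> n" for p q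
    proof -
      consider "p \<le> i" | "j < p" | "i < p" "p \<le> j" by linarith
      then show ?thesis
      proof cases
        case 1
        then have "{a. a < p \<and> q \<le> x' a} = {a. a < p \<and> q \<le> x a}"
          using j(1) by (auto simp: x'_eq Transposition.transpose_def)
        then show ?thesis using rank[OF p, of q] by (simp add: rank_ge_def)
      next
        case 2
        have "{a. a < p \<and> q \<le> x' a} = Transposition.transpose i j ` {a. a < p \<and> q \<le> x a}"
        proof (intro equalityI subsetI)
          fix a assume a: "a \<in> {a. a < p \<and> q \<le> x' a}"
          have "Transposition.transpose i j a \<in> {a. a < p \<and> q \<le> x a}"
            using a 2 j(1) by (auto simp: x'_eq Transposition.transpose_def split: if_splits)
          then show "a \<in> Transposition.transpose i j ` {a. a < p \<and> q \<le> x a}"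
            by (intro image_eqI[of _ _ "Transposition.transpose i j a"]) simp_all
        next
          fix a assume "a \<in> Transposition.transpose i j ` {a. a < p \<and> q \<le> x a}"
          then show "a \<in> {a. a < p \<and> q \<le> x' a}"
            using 2 j(1) by (auto simp: x'_eq Transposition.transpose_def split: if_splits)
        qed
        then have "rank_ge x' p q = rank_ge x p q" by (simp add: rank_ge_def card_image)
        then show ?thesis using rank[OF p] by simp
      next
        case 3
        show ?thesis
        proof (cases "x i < q \<and> q \<le> x j")
          case False
          then have "{a. a < p \<and> q \<le> x' a} = {a. a < p \<and> q \<le> x a}"
            using 3 j(1,3) by (auto simp: x'_eq Transposition.transpose_def)
          then show ?thesis using rank[OF p, of q] by (simp add: rank_ge_def)
        next
          case True
          have "{a. a < p \<and> q \<le> x' a} = insert i {a. a < p \<and> q \<le> x a}"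
            using 3 j(1,3) True by (auto simp: x'_eq Transposition.transpose_def)
          then have 1: "rank_ge x' p q \<le> Suc (rank_ge x p q)"
            unfolding rank_ge_def by (simp add: card_insert_if)
          \<comment> \<open>Passing from threshold \<open>q\<close> to \<open>Suc (y i)\<close>
            gains the missing unit. By minimality of \<open>j\<close>, values of \<open>x\<close>
            from \<open>q\<close> to \<open>y i\<close> at positions below \<open>p\<close> occur
            only before \<open>i\<close>, where \<open>x\<close> and \<open>y\<close> agree, while
            \<open>y\<close> has the additional value \<open>y i\<close> at position
            \<open>i\<close>.\<close>
          have le: "q \<le> Suc (y i)" using True j by simp
          let ?c = "{a. a < i \<and> q \<le> y a \<and> y a < Suc (y i)}"
          have "{a. a < p \<and> q \<le> x a \<and> x a < Suc (y i)} \<subseteq> ?c"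
          proof
            fix a assume a: "a \<in> {a. a < p \<and> q \<le> x a \<and> x a < Suc (y i)}"
            have "a \<noteq> i" using a True by auto
            moreover have "\<not> i < a" using a min[of a] 3 True by (auto simp: Q_def)
            ultimately have "a < i" by simp
            then show "a \<in> ?c" using a eq by auto
          qed
          then have "card {a. a < p \<and> q \<le> x a \<and> x a < Suc (y i)} \<le> card ?c" by (intro card_mono) auto
          then have 2: "rank_ge x p q \<le> rank_ge x p (Suc (y i)) + card ?c"
            using rank_ge_split[OF le, of x p] by simp
          have "insert i ?c \<subseteq> {a. a < p \<and> q \<le> y a \<and> y a < Suc (y i)}" using 3 True j by auto
          then have "card (insert i ?c) \<le> card {a. a < p \<and> q \<le> y a \<and> y a < Suc (y i)}"
            by (intro card_mono) auto
          then have "rank_ge y p (Suc (y i)) + Suc (card ?c) \<le> rank_ge y p q"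
            using rank_ge_split[OF le, of y p] by simp
          then show ?thesis using 1 2 rank[OF p, of "Suc (y i)"] by simp
        qed
      qed
    qed
    moreover have "x' permutes {0..<n}" using bruhat_step_permutes[OF x step] .
    moreover have "n * n - perm_length n x' < n * n - perm_length n x"
      using len perm_length_le[of n x'] by simp
    ultimately have "bruhat_le n x' y" using less.hyps by blast
    then show ?thesis using bruhat_le_trans[OF bruhat_le_step[OF step]] by blast
  qed
qed

section \<open>Torus fixed points of Schubert varieties\<close>

lemma perm_mat_slice:
  assumes "u permutes {0..<n}" shows "perm_mat n u \<in> slice n u"
proof -
  have "u i = u j \<longleftrightarrow> i = j" for i j using permutes_inj[OF assms] by (auto dest: injD)
  then show ?thesis using permutes_lessD[OF assms] by (auto simp: slice_def perm_mat_def)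
qed

lemma perm_mat_GL: "u permutes {0..<n} \<Longrightarrow> perm_mat n u \<in> carrier (GL n)"
  using slice_GL perm_mat_slice by blast

definition bruhat_cell :: "nat \<Rightarrow> (nat \<Rightarrow> nat) \<Rightarrow> complex mat set set" where
  "bruhat_cell n w = {b <#\<^bsub>GL n\<^esub> perm_point n w | b. b \<in> borel_group n}"

lemma schubert_variety_cell: "schubert_variety n w = flag_top n closure_of bruhat_cell n w"
  by (simp add: schubert_variety_def bruhat_cell_def)

context
  fixes n :: nat and w :: "nat \<Rightarrow> nat"
  assumes w: "w permutes {0..<n}"
begin

lemma bruhat_cell_eq: "bruhat_cell n w = {coset_of n (b * perm_mat n w) | b. b \<in> borel_group n}"
  unfolding bruhat_cell_def perm_point_def
  using translate_coset_of[OF borel_carrier_mat GL_carrier_mat[OF perm_mat_GL[OF w]]] by auto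

lemma bruhat_cell_flags: "bruhat_cell n w \<subseteq> flags n"
  using GL_mult_closed[OF borel_GL perm_mat_GL[OF w]] by (auto simp: bruhat_cell_eq flags_eq)

lemma schubert_variety_translate:
  assumes b: "b \<in> borel_group n" and y: "y \<in> schubert_variety n w"
  shows "b <#\<^bsub>GL n\<^esub> y \<in> schubert_variety n w"
proof -
  have "b <#\<^bsub>GL n\<^esub> z \<in> bruhat_cell n w" if z: "z \<in> bruhat_cell n w" for z
  proof -
    obtain c where c: "c \<in> borel_group n" "z = coset_of n (c * perm_mat n w)"
      using z by (auto simp: bruhat_cell_eq)
    note m = borel_carrier_mat[OF b] borel_carrier_mat[OF c(1)] GL_carrier_mat[OF perm_mat_GL[OF w]]
    have "b <#\<^bsub>GL n\<^esub> z = coset_of n (b * (c * perm_mat n w))"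
      unfolding c(2) by (rule translate_coset_of[OF m(1) mult_carrier_mat[OF m(2,3)]])
    also have "b * (c * perm_mat n w) = (b * c) * perm_mat n w"
      by (rule assoc_mult_mat[OF m, symmetric])
    finally show ?thesis using borel_mult[OF b c(1)] by (auto simp: bruhat_cell_eq)
  qed
  then show ?thesis using y unfolding schubert_variety_cell
    by (intro translate_closure_of[OF bruhat_cell_flags borel_GL[OF b]])
qed

lemma closedin_schubert_variety: "closedin (flag_top n) (schubert_variety n w)"
  by (simp add: schubert_variety_cell)

lemma perm_point_self: "perm_point n w \<in> schubert_variety n w"
proof -
  have "coset_of n (1\<^sub>m n * perm_mat n w) \<in> bruhat_cell n w"
    using one_mat_borel by (auto simp: bruhat_cell_eq)
  then have "perm_point n w \<in> bruhat_cell n w"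
    using GL_carrier_mat[OF perm_mat_GL[OF w]] by (simp add: perm_point_def)
  then show ?thesis
    using closure_of_subset[of "bruhat_cell n w" "flag_top n"] bruhat_cell_flags
    by (auto simp: schubert_variety_cell)
qed

text \<open>A nonvanishing minor of \<open>b w\<close> has, by the Leibniz formula, a permutation \<open>\<pi>\<close> along which all
  entries are nonzero; upper triangularity of \<open>b\<close> turns this into the rank inequality.\<close>

lemma perm_point_schubert_le:
  assumes z: "z permutes {0..<n}" and mem: "perm_point n z \<in> schubert_variety n w"
  shows "bruhat_le n z w"
proof (rule rank_criterion[OF z w])
  fix p q assume p: "p \<le> n"
  have zl: "z r < n" if "r < p" for r using that p permutes_lessD[OF z] by simp
  have "minor p z (perm_mat n z) \<noteq> 0" using minor_slice[OF perm_mat_slice[OF z] p] by simp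
  moreover have "coset_of n (perm_mat n z) \<in> flag_top n closure_of bruhat_cell n w"
    using mem by (simp add: schubert_variety_cell perm_point_def)
  ultimately obtain h where h: "h \<in> carrier (GL n)" "coset_of n h \<in> bruhat_cell n w" "minor p z h \<noteq> 0"
    using closure_of_minor_nonzero[of p n z, OF p zl perm_mat_GL[OF z]] by blast
  then obtain b where b: "b \<in> borel_group n" "coset_of n h = coset_of n (b * perm_mat n w)"
    by (auto simp: bruhat_cell_eq)
  let ?g = "b * perm_mat n w"
  have g: "?g \<in> carrier_mat n n"
    using GL_carrier_mat[OF GL_mult_closed[OF borel_GL[OF b(1)] perm_mat_GL[OF w]]] .
  obtain b' where b': "b' \<in> borel_group n" "h = ?g * b'"
    using coset_of_eqD[OF GL_carrier_mat[OF h(1)] b(2)[symmetric]] by blast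
  have "minor p z ?g \<noteq> 0"
    using h(3) minor_mult_borel[OF g b'(1) p zl] unfolding b'(2) by auto
  then obtain \<pi> where \<pi>: "\<pi> permutes {0..<p}" "(\<Prod>i=0..<p. ?g $$ (z i, \<pi> i)) \<noteq> 0"
    unfolding minor_leibniz using sum.not_neutral_contains_not_neutral
    by (metis (no_types, lifting) mem_Collect_eq mult_zero_right)
  have le: "z i \<le> w (\<pi> i)" if i: "i < p" for i
  proof (rule ccontr)
    assume gt: "\<not> z i \<le> w (\<pi> i)"
    have \<pi>i: "\<pi> i < n" using permutes_in_image[OF \<pi>(1), of i] i p by simp
    have "?g $$ (z i, \<pi> i) = (\<Sum>k<n. b $$ (z i, k) * perm_mat n w $$ (k, \<pi> i))"
      by (rule index_mult_mat_sum[OF borel_carrier_mat[OF b(1)]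
        GL_carrier_mat[OF perm_mat_GL[OF w]] zl[OF i] \<pi>i])
    also have "\<dots> = 0"
    proof (intro sum.neutral ballI)
      fix k assume k: "k \<in> {..<n}"
      show "b $$ (z i, k) * perm_mat n w $$ (k, \<pi> i) = 0"
      proof (cases "k = w (\<pi> i)")
        case True
        then show ?thesis using gt b(1) zl[OF i] by (auto simp: borel_group_eq)
      next
        case False
        then show ?thesis using k \<pi>i by (simp add: perm_mat_def)
      qed
    qed
    finally show False using \<pi>(2) i by auto
  qed
  show "rank_ge z p q \<le> rank_ge w p q"
    unfolding rank_ge_def
  proof (rule card_inj_on_le)
    show "inj_on \<pi> {i. i < p \<and> q \<le> z i}" using permutes_inj[OF \<pi>(1)] by (rule inj_on_subset) simp
    show "\<pi> ` {i. i < p \<and> q \<le> z i} \<subseteq> {i. i < p \<and> q \<le> w i}"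
      using le permutes_in_image[OF \<pi>(1)] by (force intro: order_trans)
  qed simp
qed

end

subsection \<open>Torus-stable curves joining two fixed points\<close>

text \<open>The chart part of the torus-stable curve that joins the fixed point of \<open>u\<close>
  to that of \<open>u\<close> with the values at \<open>j\<close> and \<open>i\<close> exchanged.
  The second point is approached as \<open>s\<close> tends to infinity.\<close>

definition edge_mat :: "nat \<Rightarrow> (nat \<Rightarrow> nat) \<Rightarrow> nat \<Rightarrow> nat \<Rightarrow> complex \<Rightarrow> complex mat" where
  "edge_mat n u j i s = mat n n (\<lambda>(a, c). if a = u c then 1 else if c = j \<and> a = u i then s else 0)"

lemma edge_mat_slice:
  assumes u: "u permutes {0..<n}" and "j < i" "i < n"
  shows "edge_mat n u j i s \<in> slice n u"
proof -
  have "u c = u d \<longleftrightarrow> c = d" for c d using permutes_inj[OF u] by (auto dest: injD)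
  then show ?thesis using permutes_lessD[OF u] assms(2,3) by (auto simp: slice_def edge_mat_def)
qed

lemma edge_mat_0: "edge_mat n u j i 0 = perm_mat n u"
  by (rule eq_matI) (auto simp: edge_mat_def perm_mat_def)

lemma poly_curve_edge_mat: "poly_curve n (edge_mat n u j i)"
  unfolding poly_curve_def
proof (intro allI impI)
  fix a c assume "a < n" "c < n"
  then show "\<exists>P. \<forall>s. edge_mat n u j i s $$ (a, c) = poly P s"
    by (intro exI[of _ "if a = u c then 1 else if c = j \<and> a = u i then [:0, 1:] else 0"])
      (auto simp: edge_mat_def)
qed

text \<open>The change of coordinate on a projective line: seen from its other fixed point, the same
  curve has the parameter \<open>1 / s\<close>.\<close>

lemma edge_mat_swap:
  assumes u: "u permutes {0..<n}" and ji: "j < i" "i < n" and s: "s \<noteq> 0"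
  shows "coset_of n (edge_mat n (Transposition.transpose (u j) (u i) \<circ> u) j i (1 / s)) =
    coset_of n (edge_mat n u j i s)"
proof -
  let ?v = "Transposition.transpose (u j) (u i) \<circ> u"
  \<comment> \<open>Column \<open>j\<close> is divided by \<open>s\<close>, and column
    \<open>i\<close> becomes column \<open>j\<close> minus \<open>s\<close> times column
    \<open>i\<close>, which leaves the unit vector with index \<open>u j\<close>.\<close>
  define \<beta> where "\<beta> = mat n n (\<lambda>(k, c). if k = c then (if c = j then 1 / s else if c = i then - s else 1)
    else if k = j \<and> c = i then 1 else 0)"
  have \<beta>: "\<beta> \<in> borel_group n" by (rule borelI) (use ji s in \<open>auto simp: \<beta>_def\<close>)
  have E: "edge_mat n u j i s \<in> carrier_mat n n" by (simp add: edge_mat_def)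
  have inj: "u c = u d \<longleftrightarrow> c = d" for c d using permutes_inj[OF u] by (auto dest: injD)
  have "edge_mat n u j i s * \<beta> = edge_mat n ?v j i (1 / s)"
  proof (rule eq_matI)
    fix a c assume "a < dim_row (edge_mat n ?v j i (1 / s))" "c < dim_col (edge_mat n ?v j i (1 / s))"
    then have ac: "a < n" "c < n" by (auto simp: edge_mat_def)
    have "(edge_mat n u j i s * \<beta>) $$ (a, c) = (\<Sum>k<n. edge_mat n u j i s $$ (a, k) * \<beta> $$ (k, c))"
      by (rule index_mult_mat_sum[OF E borel_carrier_mat[OF \<beta>] ac])
    also have "\<dots> = (\<Sum>k\<in>(if c = i then {j, i} else {c}). edge_mat n u j i s $$ (a, k) * \<beta> $$ (k, c))"
      using ac ji by (intro sum.mono_neutral_right) (auto simp: \<beta>_def)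
    also have "\<dots> = edge_mat n ?v j i (1 / s) $$ (a, c)"
      using ac ji s by (auto simp: edge_mat_def \<beta>_def inj Transposition.transpose_def)
    finally show "(edge_mat n u j i s * \<beta>) $$ (a, c) = edge_mat n ?v j i (1 / s) $$ (a, c)" .
  qed (auto simp: edge_mat_def \<beta>_def)
  then show ?thesis using coset_of_mult_borel[OF E \<beta>] by simp
qed

lemma edge_curve_limit:
  assumes u: "u permutes {0..<n}" and ji: "j < i" "i < n" and C: "closedin (flag_top n) C"
    and mem: "\<And>s. s \<noteq> 0 \<Longrightarrow> coset_of n (edge_mat n u j i s) \<in> C"
  shows "perm_point n u \<in> C"
proof -
  have "coset_of n (edge_mat n u j i 0) \<in> C"
    by (rule poly_curve_closed[OF C poly_curve_edge_mat, of "{0}"])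
      (use slice_GL[OF u edge_mat_slice[OF u ji]] mem in auto)
  then show ?thesis by (simp add: edge_mat_0 perm_point_def)
qed

lemma edge_curve_swap_limit:
  assumes u: "u permutes {0..<n}" and ji: "j < i" "i < n" and C: "closedin (flag_top n) C"
    and mem: "\<And>s. s \<noteq> 0 \<Longrightarrow> coset_of n (edge_mat n u j i s) \<in> C"
  shows "perm_point n (Transposition.transpose (u j) (u i) \<circ> u) \<in> C"
proof (rule edge_curve_limit[OF _ ji C])
  show "Transposition.transpose (u j) (u i) \<circ> u permutes {0..<n}"
    by (rule permutes_swap_values[OF u]) (use ji permutes_lessD[OF u] in auto)
  fix s :: complex assume "s \<noteq> 0"
  then show "coset_of n (edge_mat n (Transposition.transpose (u j) (u i) \<circ> u) j i s) \<in> C"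
    using edge_mat_swap[OF u ji, of "1 / s"] mem[of "1 / s"] by simp
qed

text \<open>Since \<open>u j < u i\<close>, a root subgroup inside the Borel group moves the upper
  fixed point along the curve joining it to the lower one. The curve thus lies in the Schubert
  variety, and closedness adds its limit, the fixed point of \<open>u\<close>.\<close>

lemma perm_point_step_schubert:
  assumes w: "w permutes {0..<n}" and u: "u permutes {0..<n}" and ji: "j < i" "i < n" "u j < u i"
    and mem: "perm_point n (Transposition.transpose (u j) (u i) \<circ> u) \<in> schubert_variety n w"
  shows "perm_point n u \<in> schubert_variety n w"
proof (rule edge_curve_limit[OF u ji(1,2) closedin_schubert_variety[OF w]])
  fix s :: complex assume s: "s \<noteq> 0"
  let ?v = "Transposition.transpose (u j) (u i) \<circ> u"
  have ul: "u j < n" "u i < n" using ji permutes_lessD[OF u] by auto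
  have v: "?v permutes {0..<n}" using permutes_swap_values[OF u ul] .
  define b where "b = mat n n (\<lambda>(a, c). if a = c then 1 else if a = u j \<and> c = u i then 1 / s else 0)"
  have b: "b \<in> borel_group n" by (rule borelI) (use ji in \<open>auto simp: b_def\<close>)
  note P = GL_carrier_mat[OF perm_mat_GL[OF v]]
  have inj: "u c = u d \<longleftrightarrow> c = d" for c d using permutes_inj[OF u] by (auto dest: injD)
  have "b * perm_mat n ?v = edge_mat n ?v j i (1 / s)"
  proof (rule eq_matI)
    fix a c assume "a < dim_row (edge_mat n ?v j i (1 / s))" "c < dim_col (edge_mat n ?v j i (1 / s))"
    then have ac: "a < n" "c < n" by (auto simp: edge_mat_def)
    have vc: "?v c < n" using permutes_lessD[OF v ac(2)] .
    have "(b * perm_mat n ?v) $$ (a, c) = (\<Sum>k<n. b $$ (a, k) * perm_mat n ?v $$ (k, c))"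
      by (rule index_mult_mat_sum[OF borel_carrier_mat[OF b] P ac])
    also have "\<dots> = (\<Sum>k\<in>{?v c}. b $$ (a, k) * perm_mat n ?v $$ (k, c))"
      using vc ac by (intro sum.mono_neutral_right) (auto simp: perm_mat_def)
    also have "\<dots> = edge_mat n ?v j i (1 / s) $$ (a, c)"
      using ac vc by (auto simp: edge_mat_def b_def perm_mat_def inj Transposition.transpose_def)
    finally show "(b * perm_mat n ?v) $$ (a, c) = edge_mat n ?v j i (1 / s) $$ (a, c)" .
  qed (auto simp: edge_mat_def b_def perm_mat_def)
  then have "b <#\<^bsub>GL n\<^esub> perm_point n ?v = coset_of n (edge_mat n ?v j i (1 / s))"
    unfolding perm_point_def by (simp add: translate_coset_of[OF borel_carrier_mat[OF b] P])
  also have "\<dots> = coset_of n (edge_mat n u j i s)" by (rule edge_mat_swap[OF u ji(1,2) s])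
  finally show "coset_of n (edge_mat n u j i s) \<in> schubert_variety n w"
    using schubert_variety_translate[OF w b mem] by simp
qed

lemma perm_point_schubert:
  assumes w: "w permutes {0..<n}" and "bruhat_le n u w" and u: "u permutes {0..<n}"
  shows "perm_point n u \<in> schubert_variety n w"
  using assms(2) u unfolding bruhat_le_def
proof (induction rule: converse_rtranclp_induct)
  case base
  show ?case by (rule perm_point_self[OF w])
next
  case (step u v)
  obtain j i where ji: "j < i" "i < n" "u j < u i" "v = Transposition.transpose (u j) (u i) \<circ> u"
    using bruhat_stepE[OF step.prems step.hyps(1)] by blast
  have "perm_point n v \<in> schubert_variety n w"
    using step.IH bruhat_step_permutes[OF step.prems step.hyps(1)] by blast
  then show ?case unfolding ji(4) by (rule perm_point_step_schubert[OF w step.prems ji(1-3)])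
qed

section \<open>The torus action on slices\<close>

definition torus_mat :: "nat \<Rightarrow> (nat \<Rightarrow> complex) \<Rightarrow> complex mat" where
  "torus_mat n t = mat n n (\<lambda>(i, j). if i = j then t i else 0)"

text \<open>Left multiplication by the torus spoils the ones at \<open>(u j, j)\<close>. Dividing
  column \<open>j\<close> by \<open>t (u j)\<close> restores them, and being a diagonal right factor
  it does not change the coset.\<close>

definition torus_scale :: "nat \<Rightarrow> (nat \<Rightarrow> nat) \<Rightarrow> (nat \<Rightarrow> complex) \<Rightarrow> complex mat \<Rightarrow> complex mat" where
  "torus_scale n u t A = mat n n (\<lambda>(a, j). t a / t (u j) * A $$ (a, j))"

lemma diag_torus_borel: "T \<in> diag_torus n \<Longrightarrow> T \<in> borel_group n"
  by (auto simp: diag_torus_def borel_group_def diagonal_mat_def carrier_GL)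

lemma torus_mat_borel: "(\<And>a. t a \<noteq> 0) \<Longrightarrow> torus_mat n t \<in> borel_group n"
  by (rule borelI) (auto simp: torus_mat_def)

lemma torus_mat_diag_torus: "(\<And>a. t a \<noteq> 0) \<Longrightarrow> torus_mat n t \<in> diag_torus n"
  using borel_GL[OF torus_mat_borel, of t n]
  by (auto simp: diag_torus_def diagonal_mat_def torus_mat_def)

lemma diag_torusE:
  assumes "T \<in> diag_torus n"
  obtains t where "\<And>a. t a \<noteq> 0" "T = torus_mat n t"
proof
  \<comment> \<open>The value 1 beyond \<open>n\<close> makes \<open>?t\<close> nonzero everywhere,
    as the statement demands.\<close>
  let ?t = "\<lambda>a. if a < n then T $$ (a, a) else 1"
  show "?t a \<noteq> 0" for a using borel_diag_nonzero[OF diag_torus_borel[OF assms]] by auto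
  show "T = torus_mat n ?t"
    using assms by (intro eq_matI) (auto simp: torus_mat_def diag_torus_def diagonal_mat_def carrier_GL)
qed

lemma torus_scale_slice:
  assumes "u permutes {0..<n}" "\<And>a. t a \<noteq> 0" "A \<in> slice n u"
  shows "torus_scale n u t A \<in> slice n u"
  using assms permutes_lessD[OF assms(1)] by (auto simp: slice_def torus_scale_def)

lemma torus_mat_mult:
  assumes "A \<in> carrier_mat n n" "a < n" "j < n"
  shows "(torus_mat n t * A) $$ (a, j) = t a * A $$ (a, j)"
    and "(A * torus_mat n t) $$ (a, j) = A $$ (a, j) * t j"
proof -
  have T: "torus_mat n t \<in> carrier_mat n n" by (simp add: torus_mat_def)
  have "(torus_mat n t * A) $$ (a, j) = (\<Sum>k<n. torus_mat n t $$ (a, k) * A $$ (k, j))"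
    by (rule index_mult_mat_sum[OF T assms])
  also have "\<dots> = (\<Sum>k\<in>{a}. torus_mat n t $$ (a, k) * A $$ (k, j))"
    using assms by (intro sum.mono_neutral_right) (auto simp: torus_mat_def)
  finally show "(torus_mat n t * A) $$ (a, j) = t a * A $$ (a, j)" using assms by (simp add: torus_mat_def)
  have "(A * torus_mat n t) $$ (a, j) = (\<Sum>k<n. A $$ (a, k) * torus_mat n t $$ (k, j))"
    by (rule index_mult_mat_sum[OF assms(1) T assms(2,3)])
  also have "\<dots> = (\<Sum>k\<in>{j}. A $$ (a, k) * torus_mat n t $$ (k, j))"
    using assms by (intro sum.mono_neutral_right) (auto simp: torus_mat_def)
  finally show "(A * torus_mat n t) $$ (a, j) = A $$ (a, j) * t j" using assms by (simp add: torus_mat_def)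
qed

lemma translate_torus_mat:
  assumes A: "A \<in> carrier_mat n n" and t: "\<And>a. t a \<noteq> 0"
  shows "torus_mat n t <#\<^bsub>GL n\<^esub> coset_of n A = coset_of n (torus_scale n u t A)"
proof -
  have T: "torus_mat n t \<in> carrier_mat n n" for t by (simp add: torus_mat_def)
  have b: "torus_mat n (\<lambda>j. 1 / t (u j)) \<in> borel_group n" using t by (intro torus_mat_borel) simp
  have TA: "torus_mat n t * A \<in> carrier_mat n n" using T A by (rule mult_carrier_mat)
  have "torus_mat n t * A * torus_mat n (\<lambda>j. 1 / t (u j)) = torus_scale n u t A"
  proof (rule eq_matI)
    fix a j assume "a < dim_row (torus_scale n u t A)" "j < dim_col (torus_scale n u t A)"
    then have aj: "a < n" "j < n" by (auto simp: torus_scale_def)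
    show "(torus_mat n t * A * torus_mat n (\<lambda>j. 1 / t (u j))) $$ (a, j) = torus_scale n u t A $$ (a, j)"
      unfolding torus_mat_mult(2)[OF TA aj] torus_mat_mult(1)[OF A aj] using aj
      by (simp add: torus_scale_def)
  qed (use A in \<open>auto simp: torus_mat_def torus_scale_def\<close>)
  then show ?thesis
    using translate_coset_of[OF T A, of t] coset_of_mult_borel[OF TA b] by simp
qed

lemma torus_orbit_slice:
  assumes "A \<in> carrier_mat n n"
  shows "torus_orbit n (coset_of n A) = {coset_of n (torus_scale n u t A) | t. \<forall>a. t a \<noteq> 0}"
proof (intro equalityI subsetI)
  fix y assume "y \<in> torus_orbit n (coset_of n A)"
  then obtain T where T: "T \<in> diag_torus n" "y = T <#\<^bsub>GL n\<^esub> coset_of n A"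
    by (auto simp: torus_orbit_def)
  then obtain t where "\<And>a. t a \<noteq> 0" "T = torus_mat n t" using diag_torusE[OF T(1)] by blast
  then show "y \<in> {coset_of n (torus_scale n u t A) | t. \<forall>a. t a \<noteq> 0}"
    using translate_torus_mat[OF assms] T(2) by blast
next
  fix y assume "y \<in> {coset_of n (torus_scale n u t A) | t. \<forall>a. t a \<noteq> 0}"
  then obtain t where t: "\<And>a. t a \<noteq> 0" "y = coset_of n (torus_scale n u t A)" by auto
  then have "y = torus_mat n t <#\<^bsub>GL n\<^esub> coset_of n A" using translate_torus_mat[OF assms] by simp
  then show "y \<in> torus_orbit n (coset_of n A)"
    using torus_mat_diag_torus[of t, OF t(1)] by (auto simp: torus_orbit_def)
qed

lemma torus_scale_perm_mat:
  assumes "u permutes {0..<n}" "\<And>a. t a \<noteq> 0"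
  shows "torus_scale n u t (perm_mat n u) = perm_mat n u"
  using assms(2) by (intro eq_matI) (auto simp: torus_scale_def perm_mat_def)

lemma torus_scale_scale:
  assumes "u permutes {0..<n}"
  shows "torus_scale n u t (torus_scale n u t' A) = torus_scale n u (\<lambda>a. t a * t' a) A"
  using permutes_lessD[OF assms] by (intro eq_matI) (auto simp: torus_scale_def ac_simps)

locale generic_orbit =
  fixes n :: nat and w :: "nat \<Rightarrow> nat" and Orb Y :: "complex mat set set"
  assumes w: "w permutes {0..<n}" and generic: "generic_torus_orbit n w Orb"
    and Y_def: "Y = flag_top n closure_of Orb"
begin

lemma closedin_Y: "closedin (flag_top n) Y"
  by (simp add: Y_def)

lemma Orb_schubert: "Orb \<subseteq> schubert_variety n w"
  using generic schubert_variety_translate[OF w diag_torus_borel]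
  by (auto simp: generic_torus_orbit_def torus_orbit_def)

lemma Y_schubert: "Y \<subseteq> schubert_variety n w"
  unfolding Y_def by (rule closure_of_minimal[OF Orb_schubert closedin_schubert_variety[OF w]])

lemma Orb_flags: "Orb \<subseteq> flags n"
  using Orb_schubert closedin_subset[OF closedin_schubert_variety[OF w]] by auto

lemma Y_flags: "Y \<subseteq> flags n"
  using closedin_subset[OF closedin_Y] by simp

text \<open>Forward, \<open>Y\<close> lies in the Schubert variety, whose fixed points are known
  from the rank criterion. Backward, the clause on fixed points in the definition of a generic orbit
  is used.\<close>

lemma perm_point_Y_iff:
  assumes u: "u permutes {0..<n}"
  shows "perm_point n u \<in> Y \<longleftrightarrow> bruhat_le n u w"
proof
  assume "perm_point n u \<in> Y"
  then show "bruhat_le n u w" using perm_point_schubert_le[OF w u] Y_schubert by blast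
next
  assume "bruhat_le n u w"
  then have mem: "perm_point n u \<in> schubert_variety n w" using perm_point_schubert[OF w _ u] by blast
  have "T <#\<^bsub>GL n\<^esub> perm_point n u = perm_point n u" if T: "T \<in> diag_torus n" for T
  proof -
    obtain t where t: "\<And>a. t a \<noteq> 0" "T = torus_mat n t" using diag_torusE[OF T] by blast
    show ?thesis unfolding t(2) perm_point_def
      translate_torus_mat[OF GL_carrier_mat[OF perm_mat_GL[OF u]] t(1), where u = u]
      torus_scale_perm_mat[OF u t(1)] by (rule refl)
  qed
  then have "perm_point n u \<in> torus_fixed_points n (schubert_variety n w)"
    using mem by (simp add: torus_fixed_points_def)
  then show "perm_point n u \<in> Y" using generic by (auto simp: generic_torus_orbit_def Y_def)
qed

lemma Orb_translate:
  assumes "y \<in> Orb" "T \<in> diag_torus n" shows "T <#\<^bsub>GL n\<^esub> y \<in> Orb"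
proof -
  obtain x where x: "x \<in> schubert_variety n w" "Orb = torus_orbit n x"
    using generic by (auto simp: generic_torus_orbit_def)
  have "x \<in> flags n" using x(1) closedin_subset[OF closedin_schubert_variety[OF w]] by auto
  then obtain g where g: "g \<in> carrier (GL n)" "x = coset_of n g" by (auto simp: flags_eq)
  note gm = GL_carrier_mat[OF g(1)]
  obtain t where t: "\<And>a. t a \<noteq> 0" "y = coset_of n (torus_scale n id t g)"
    using assms(1) torus_orbit_slice[OF gm, of id] x g by auto
  obtain t' where t': "\<And>a. t' a \<noteq> 0" "T = torus_mat n t'" using diag_torusE[OF assms(2)] by blast
  have "torus_scale n id t g \<in> carrier_mat n n" by (simp add: torus_scale_def)
  then have "T <#\<^bsub>GL n\<^esub> y = coset_of n (torus_scale n id t' (torus_scale n id t g))"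
    unfolding t(2) t'(2) by (rule translate_torus_mat[OF _ t'(1)])
  also have "\<dots> = coset_of n (torus_scale n id (\<lambda>a. t' a * t a) g)"
    by (simp add: torus_scale_scale permutes_id)
  also have "\<dots> \<in> Orb" using torus_orbit_slice[OF gm, of id] x g t(1) t'(1) by auto
  finally show ?thesis .
qed

lemma Y_torus_scale:
  assumes "A \<in> carrier_mat n n" "coset_of n A \<in> Y" "\<And>a. t a \<noteq> 0"
  shows "coset_of n (torus_scale n u t A) \<in> Y"
proof -
  have "torus_mat n t <#\<^bsub>GL n\<^esub> coset_of n A \<in> Y"
    using assms(2) unfolding Y_def
    by (intro translate_closure_of[OF Orb_flags borel_GL[OF torus_mat_borel[of t, OF assms(3)]]]
      Orb_translate torus_mat_diag_torus assms(3))
  then show ?thesis using translate_torus_mat[OF assms(1,3)] by simp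
qed

text \<open>The torus element with entries \<open>s ^ u\<^sup>-\<^sup>1 a\<close> contracts the slice at \<open>u\<close> to its fixed
  point as \<open>s\<close> tends to \<open>0\<close>.\<close>

lemma slice_contract:
  assumes u: "u permutes {0..<n}" and A: "A \<in> slice n u" "coset_of n A \<in> Y"
  shows "perm_point n u \<in> Y"
proof -
  define v where "v = Hilbert_Choice.inv u"
  have vu: "v (u c) = c" and uv: "u (v c) = c" for c
    using permutes_inverses[OF u] by (simp_all add: v_def)
  \<comment> \<open>In the slice an entry \<open>(a, j)\<close> vanishes unless
    \<open>j \<le> v a\<close>, so no negative power of \<open>s\<close> arises and the curve
    extends to \<open>s = 0\<close>. There only the entries with \<open>v a = j\<close> survive,
    which are the ones of \<open>perm_mat n u\<close>.\<close>
  define \<gamma> where "\<gamma> s = mat n n (\<lambda>(a, j). if j \<le> v a then s ^ (v a - j) * A $$ (a, j) else 0)"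
    for s :: complex
  have zero: "A $$ (a, j) = 0" if "a < n" "j < n" "\<not> j \<le> v a" for a j
  proof -
    have "v a < n" using permutes_lessD[OF permutes_inv[OF u] that(1)] by (simp add: v_def)
    then have "A $$ (u (v a), j) = 0" using A(1) that by (simp add: slice_def)
    then show ?thesis by (simp add: uv)
  qed
  have "poly_curve n \<gamma>"
    unfolding poly_curve_def
  proof (intro allI impI)
    fix a j assume "a < n" "j < n"
    then show "\<exists>P. \<forall>s. \<gamma> s $$ (a, j) = poly P s"
      by (intro exI[of _ "if j \<le> v a then monom (A $$ (a, j)) (v a - j) else 0"])
        (auto simp: \<gamma>_def poly_monom)
  qed
  moreover have scale: "\<gamma> s = torus_scale n u (\<lambda>a. s ^ v a) A" if "s \<noteq> 0" for s
    using that zero by (intro eq_matI) (auto simp: \<gamma>_def torus_scale_def vu power_diff)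
  have "\<gamma> s \<in> carrier (GL n) \<and> coset_of n (\<gamma> s) \<in> Y" if "s \<notin> {0}" for s
    using that slice_GL[OF u torus_scale_slice[OF u _ A(1)]] Y_torus_scale[OF slice_carrier_mat[OF A(1)] A(2)]
    by (simp add: scale)
  moreover have "\<gamma> 0 = perm_mat n u"
  proof (rule eq_matI)
    fix a j assume "a < dim_row (perm_mat n u)" "j < dim_col (perm_mat n u)"
    then have aj: "a < n" "j < n" by (auto simp: perm_mat_def)
    have "v a = j \<longleftrightarrow> a = u j" using vu uv by metis
    then show "\<gamma> 0 $$ (a, j) = perm_mat n u $$ (a, j)"
      using aj A(1) by (auto simp: \<gamma>_def perm_mat_def slice_def vu power_0_left)
  qed (auto simp: \<gamma>_def perm_mat_def)
  ultimately have "coset_of n (\<gamma> 0) \<in> Y"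
    using poly_curve_closed[OF closedin_Y, of \<gamma> "{0}" 0] perm_mat_GL[OF u] by simp
  then show ?thesis using \<open>\<gamma> 0 = perm_mat n u\<close> by (simp add: perm_point_def)
qed

lemma Y_charts:
  assumes "y \<in> Y"
  obtains u A where "u permutes {0..<n}" "bruhat_le n u w" "A \<in> slice n u" "y = coset_of n A"
proof -
  obtain g where g: "g \<in> carrier (GL n)" "y = coset_of n g" using assms Y_flags by (auto simp: flags_eq)
  obtain u b where u: "u permutes {0..<n}" "b \<in> borel_group n" "g * b \<in> slice n u"
    using PLU_decomposition[OF g(1)] by blast
  have "y = coset_of n (g * b)" using coset_of_mult_borel[OF GL_carrier_mat[OF g(1)] u(2)] g(2) by simp
  then show ?thesis
    using that u slice_contract[OF u(1,3)] assms perm_point_Y_iff[OF u(1)] by blast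
qed

end

section \<open>Indecomposable edges and forests\<close>

definition indecomposables :: "(nat \<times> nat) set \<Rightarrow> (nat \<times> nat) set" where
  "indecomposables P = {e \<in> P. \<not> decomposable P e}"

abbreviation symcl :: "('a \<times> 'a) set \<Rightarrow> ('a \<times> 'a) set" where
  "symcl R \<equiv> R \<union> R\<inverse>"

lemma heightD: "P \<subseteq> measure h \<Longrightarrow> (b, a) \<in> P \<Longrightarrow> h b < h a"
  by auto

lemma trancl_height:
  fixes h :: "'a \<Rightarrow> nat"
  assumes "P \<subseteq> measure h" and "(b, a) \<in> P\<^sup>+"
  shows "h b < h a"
  using assms(2)
proof (induction rule: trancl_induct)
  case (step c a)
  then show ?case using heightD[OF assms(1) step.hyps(2)] by simp
qed (rule heightD[OF assms(1)])

lemma rtrancl_height: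
  fixes h :: "'a \<Rightarrow> nat"
  assumes "P \<subseteq> measure h" and "(b, a) \<in> P\<^sup>*"
  shows "h b \<le> h a"
  using assms(2) trancl_height[OF assms(1)]
  by (auto simp: rtrancl_eq_or_trancl intro: less_imp_le)

text \<open>The height makes repeated decomposition terminate: the first step and the remainder of a
  decomposition both span a smaller height difference.\<close>

lemma trancl_indecomposables:
  fixes h :: "nat \<Rightarrow> nat"
  assumes h: "P \<subseteq> measure h" and "(b, a) \<in> P\<^sup>+"
  shows "(b, a) \<in> (indecomposables P)\<^sup>+"
  using assms(2)
proof (induction "h a - h b" arbitrary: a b rule: less_induct)
  case less
  have split: "(b, a) \<in> (indecomposables P)\<^sup>+" if c: "(b, c) \<in> P" "(c, a) \<in> P\<^sup>+" for c
  proof -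
    have "h b < h c" "h c < h a" using heightD[OF h c(1)] trancl_height[OF h c(2)] by auto
    then have "(b, c) \<in> (indecomposables P)\<^sup>+" "(c, a) \<in> (indecomposables P)\<^sup>+"
      using less.hyps[OF _ r_into_trancl[OF c(1)]] less.hyps[OF _ c(2)] by auto
    then show ?thesis by (rule trancl_trans)
  qed
  show ?case
  proof (cases "(b, a) \<in> indecomposables P")
    case False
    obtain c where c: "(b, c) \<in> P" "(c, a) \<in> P\<^sup>*" "(b, a) \<in> P \<Longrightarrow> c \<noteq> a"
    proof (cases "(b, a) \<in> P")
      case True
      then have "(b, a) \<in> (P - {(b, a)})\<^sup>+" using False by (simp add: indecomposables_def decomposable_def)
      then obtain c where c: "(b, c) \<in> P - {(b, a)}" "(c, a) \<in> (P - {(b, a)})\<^sup>*" by (auto dest: tranclD)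
      have "(c, a) \<in> P\<^sup>*" using c(2) rtrancl_mono[of "P - {(b, a)}" P] by blast
      then show ?thesis using that[of c] c(1) by blast
    next
      case False
      then show ?thesis using less.prems that by (meson tranclD)
    qed
    have "c \<noteq> a" using c by auto
    then have "(c, a) \<in> P\<^sup>+" using c(2) by (auto simp: rtrancl_eq_or_trancl)
    then show ?thesis using split c(1) by blast
  qed blast
qed

text \<open>Every decomposition in \<open>P\<close> refines to one into indecomposables of
  \<open>P\<close>, and these all belong to \<open>E\<close>. So for members of \<open>E\<close>,
  decomposability in \<open>P\<close> and in \<open>E\<close> agree.\<close>

lemma indecomposables_cong:
  fixes h :: "nat \<Rightarrow> nat"
  assumes h: "P \<subseteq> measure h" and E: "E \<subseteq> P" "indecomposables P \<subseteq> E"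
  shows "indecomposables E = indecomposables P"
proof (intro equalityI subsetI)
  fix e assume e: "e \<in> indecomposables E"
  then have eE: "e \<in> E" "e \<notin> (E - {e})\<^sup>+" by (auto simp: indecomposables_def decomposable_def)
  show "e \<in> indecomposables P"
  proof (rule ccontr)
    assume ne: "e \<notin> indecomposables P"
    obtain b a where ba: "e = (b, a)" by (cases e)
    have "(b, a) \<in> P\<^sup>+" using eE(1) E(1) ba by auto
    then have "e \<in> (indecomposables P)\<^sup>+" unfolding ba by (rule trancl_indecomposables[OF h])
    moreover have "indecomposables P \<subseteq> E - {e}" using ne E(2) by auto
    ultimately show False using eE(2) trancl_mono by blast
  qed
next
  fix e assume e: "e \<in> indecomposables P"
  then have "e \<notin> (P - {e})\<^sup>+" by (auto simp: indecomposables_def decomposable_def)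
  then have "e \<notin> (E - {e})\<^sup>+" using E(1) trancl_mono[of e "E - {e}" "P - {e}"] by blast
  then show "e \<in> indecomposables E" using e E(2) by (auto simp: indecomposables_def decomposable_def)
qed

lemma rtrancl_add_edge:
  assumes "(x, y) \<in> (insert (a, b) P)\<^sup>*"
  shows "(x, y) \<in> P\<^sup>* \<or> ((x, a) \<in> P\<^sup>* \<and> (b, y) \<in> P\<^sup>*)"
  using assms
proof (induction rule: rtrancl_induct)
  case (step y z)
  then show ?case by (auto intro: rtrancl_into_rtrancl)
qed simp

text \<open>The potential is the number of vertices reachable once the edge \<open>(b, a)\<close> is made two-way.\<close>

lemma indecomposable_potential:
  fixes h :: "nat \<Rightarrow> nat"
  assumes h: "P \<subseteq> measure h" and fin: "finite P"
    and e: "(b0, a0) \<in> indecomposables P"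
  obtains l :: "nat \<Rightarrow> nat" where "l b0 = l a0"
    "\<And>b a. (b, a) \<in> P \<Longrightarrow> (b, a) \<noteq> (b0, a0) \<Longrightarrow> l a < l b"
proof
  let ?e = "(b0, a0)"
  let ?R = "insert (a0, b0) P"
  have eP: "?e \<in> P" and ind: "?e \<notin> (P - {?e})\<^sup>+"
    using e by (auto simp: indecomposables_def decomposable_def)
  define reach where "reach c = {d. (c, d) \<in> ?R\<^sup>*}" for c
  have fin_reach: "finite (reach c)" for c
  proof (rule finite_subset)
    show "reach c \<subseteq> insert c (snd ` ?R)"
    proof
      fix d assume "d \<in> reach c"
      then have "(c, d) \<in> ?R\<^sup>*" by (simp add: reach_def)
      then show "d \<in> insert c (snd ` ?R)" by (cases rule: rtranclE) (auto intro: rev_image_eqI)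
    qed
  qed (use fin in simp)
  have mono: "reach a \<subseteq> reach b" if "(b, a) \<in> ?R" for a b
    using that by (auto simp: reach_def intro: converse_rtrancl_into_rtrancl)
  have "reach b0 = reach a0" using mono[of b0 a0] mono[of a0 b0] eP by auto
  then show "card (reach b0) = card (reach a0)" by simp
  fix b a assume ba: "(b, a) \<in> P" "(b, a) \<noteq> (b0, a0)"
  \<comment> \<open>By the height, such a path has to use the reversed edge. Together with
    \<open>(b, a)\<close> it yields a path from \<open>b0\<close> through \<open>b\<close> and
    \<open>a\<close> to \<open>a0\<close> that avoids the edge itself, which is a decomposition of
    it.\<close>
  have "(a, b) \<notin> ?R\<^sup>*"
  proof
    assume "(a, b) \<in> ?R\<^sup>*"
    then consider "(a, b) \<in> P\<^sup>*" | "(a, a0) \<in> P\<^sup>*" "(b0, b) \<in> P\<^sup>*" using rtrancl_add_edge[of a b a0 b0 P] by blast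
    then show False
    proof cases
      case 1
      then show False using rtrancl_height[OF h 1] heightD[OF h ba(1)] by simp
    next
      case 2
      let ?P = "P - {?e}"
      have P_eq: "insert ?e ?P = P" using eP by auto
      have sub: "?P\<^sup>* \<subseteq> P\<^sup>*" by (rule rtrancl_mono) auto
      have "(b0, b) \<in> ?P\<^sup>* \<or> (a0, b) \<in> ?P\<^sup>*" using rtrancl_add_edge[of b0 b b0 a0 ?P] 2(2) P_eq by auto
      moreover have "(a0, b) \<notin> ?P\<^sup>*"
      proof
        assume "(a0, b) \<in> ?P\<^sup>*"
        then have "(a0, b) \<in> P\<^sup>*" using sub by blast
        from rtrancl_height[OF h this] rtrancl_height[OF h 2(1)] heightD[OF h ba(1)]
        show False by simp
      qed
      moreover have "(a, a0) \<in> ?P\<^sup>* \<or> (a, b0) \<in> ?P\<^sup>*" using rtrancl_add_edge[of a a0 b0 a0 ?P] 2(1) P_eq by auto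
      moreover have "(a, b0) \<notin> ?P\<^sup>*"
      proof
        assume "(a, b0) \<in> ?P\<^sup>*"
        then have "(a, b0) \<in> P\<^sup>*" using sub by blast
        from rtrancl_height[OF h this] rtrancl_height[OF h 2(2)] heightD[OF h ba(1)]
        show False by simp
      qed
      ultimately have "(b0, b) \<in> ?P\<^sup>*" "(b, a) \<in> ?P" "(a, a0) \<in> ?P\<^sup>*" using ba by auto
      then have "?e \<in> ?P\<^sup>+" by (meson rtrancl_into_trancl1 trancl_rtrancl_trancl)
      then show False using ind by simp
    qed
  qed
  then have "b \<notin> reach a" "b \<in> reach b" by (auto simp: reach_def)
  then have "reach a \<subset> reach b" using mono[of b a] ba(1) by auto
  then show "card (reach a) < card (reach b)" by (rule psubset_card_mono[OF fin_reach])
qed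

section \<open>Cycles, forests and characters of the torus\<close>

lemma rtrancl_distinct_path:
  assumes "(a, b) \<in> R\<^sup>*"
  shows "\<exists>vs. vs \<noteq> [] \<and> distinct vs \<and> hd vs = a \<and> last vs = b \<and> successively (\<lambda>x y. (x, y) \<in> R) vs"
  using assms
proof (induction rule: rtrancl_induct)
  case base
  then show ?case by (intro exI[of _ "[a]"]) simp
next
  case (step b c)
  then obtain vs where vs: "vs \<noteq> []" "distinct vs" "hd vs = a" "last vs = b"
    "successively (\<lambda>x y. (x, y) \<in> R) vs" by blast
  show ?case
  proof (cases "c \<in> set vs")
    case True
    then obtain xs ys where xs: "vs = xs @ c # ys" by (auto dest: split_list)
    show ?thesis
      using vs unfolding xs
      by (intro exI[of _ "xs @ [c]"]) (auto simp: successively_append_iff hd_append)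
  next
    case False
    then show ?thesis using vs step.hyps(2)
      by (intro exI[of _ "vs @ [c]"]) (auto simp: successively_append_iff)
  qed
qed

lemma sym_rtrancl_symcl: "(a, b) \<in> (symcl R)\<^sup>* \<Longrightarrow> (b, a) \<in> (symcl R)\<^sup>*"
proof -
  have "sym (symcl R)" by (auto simp: sym_def)
  then show "(a, b) \<in> (symcl R)\<^sup>* \<Longrightarrow> (b, a) \<in> (symcl R)\<^sup>*" using sym_rtrancl by (metis symD)
qed

text \<open>An edge lies on a cycle exactly if its ends stay connected after its removal. A simple
  path between the ends has at least three vertices, because the height excludes loops and opposite
  edges; conversely, the closing edge of a cycle is the one to remove.\<close>

lemma is_forest_iff:
  fixes h :: "nat \<Rightarrow> nat"
  assumes h: "E \<subseteq> measure h"
  shows "is_forest (fst ` E \<union> snd ` E, E) \<longleftrightarrow> (\<forall>e\<in>E. e \<notin> (symcl (E - {e}))\<^sup>*)"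
proof
  assume forest: "is_forest (fst ` E \<union> snd ` E, E)"
  show "\<forall>e\<in>E. e \<notin> (symcl (E - {e}))\<^sup>*"
  proof (rule ballI, rule notI)
    fix e assume e: "e \<in> E" "e \<in> (symcl (E - {e}))\<^sup>*"
    obtain a b where ab: "e = (a, b)" by (cases e)
    obtain vs where vs: "vs \<noteq> []" "distinct vs" "hd vs = a" "last vs = b"
      "successively (\<lambda>x y. (x, y) \<in> symcl (E - {e})) vs"
      using rtrancl_distinct_path[of a b "symcl (E - {e})"] e(2) ab by auto
    have "a \<noteq> b" using heightD[OF h, of a b] e(1) ab by auto
    have "length vs \<noteq> 1" using vs \<open>a \<noteq> b\<close> by (auto simp: length_Suc_conv)
    moreover have "length vs \<noteq> 2"
    proof
      assume "length vs = 2"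
      then have "vs = [a, b]" using vs(3,4) by (auto simp: length_Suc_conv numeral_2_eq_2)
      then have "(b, a) \<in> E" using vs(5) ab by auto
      then show False using heightD[OF h, of a b] heightD[OF h, of b a] e(1) ab by simp
    qed
    ultimately have len: "3 \<le> length vs" using vs(1) by (cases vs; cases "tl vs"; cases "tl (tl vs)") auto
    have adj: "(vs ! i, vs ! (Suc i mod length vs)) \<in> E \<or> (vs ! (Suc i mod length vs), vs ! i) \<in> E"
      if i: "i < length vs" for i
    proof (cases "Suc i < length vs")
      case True
      then show ?thesis using vs(5) by (auto simp: successively_conv_nth)
    next
      case False
      then have il: "Suc i = length vs" using i by simp
      then have "vs ! i = b" using vs(1,4) by (metis diff_Suc_1 last_conv_nth)
      moreover have "vs ! (Suc i mod length vs) = a" using il vs(1,3) by (simp add: hd_conv_nth)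
      ultimately show ?thesis using e(1) ab by simp
    qed
    have "set vs \<subseteq> fst ` E \<union> snd ` E"
    proof
      fix x assume "x \<in> set vs"
      then obtain i where "i < length vs" "x = vs ! i" by (auto simp: in_set_conv_nth)
      then show "x \<in> fst ` E \<union> snd ` E" using adj[of i] by force
    qed
    then show False using forest len vs(2) adj unfolding is_forest_def Let_def by auto
  qed
next
  assume E: "\<forall>e\<in>E. e \<notin> (symcl (E - {e}))\<^sup>*"
  show "is_forest (fst ` E \<union> snd ` E, E)"
    unfolding is_forest_def
  proof
    assume "\<exists>vs. 3 \<le> length vs \<and> distinct vs \<and> set vs \<subseteq> fst (fst ` E \<union> snd ` E, E) \<and>
      (\<forall>i<length vs. let a = vs ! i; b = vs ! (Suc i mod length vs)
        in (a, b) \<in> snd (fst ` E \<union> snd ` E, E) \<or> (b, a) \<in> snd (fst ` E \<union> snd ` E, E))"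
    then obtain vs where len: "3 \<le> length vs" and dist: "distinct vs"
      and adj: "\<And>i. i < length vs \<Longrightarrow> (vs ! i, vs ! (Suc i mod length vs)) \<in> symcl E"
      by (auto simp: Let_def)
    define m where "m = length vs - 1"
    have m: "2 \<le> m" "m < length vs" "Suc m = length vs" using len by (auto simp: m_def)
    have "(vs ! m, vs ! 0) \<in> symcl E" using adj[OF m(2)] m(3) by simp
    then obtain e where e: "e \<in> E" "e = (vs ! m, vs ! 0) \<or> e = (vs ! 0, vs ! m)" by auto
    have "(vs ! 0, vs ! i) \<in> (symcl (E - {e}))\<^sup>*" if "i \<le> m" for i
      using that
    proof (induction i)
      case (Suc i)
      have i: "i < length vs" "Suc i < length vs" and l0: "0 < length vs" using Suc.prems m by auto
      have "(vs ! i, vs ! Suc i) \<in> symcl E" using adj[OF i(1)] i(2) by simp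
      moreover have n: "vs ! i = vs ! 0 \<longleftrightarrow> i = 0" "vs ! i = vs ! m \<longleftrightarrow> i = m"
        "vs ! Suc i = vs ! m \<longleftrightarrow> Suc i = m" "vs ! Suc i \<noteq> vs ! 0"
        using nth_eq_iff_index_eq[OF dist i(1) l0] nth_eq_iff_index_eq[OF dist i(1) m(2)]
          nth_eq_iff_index_eq[OF dist i(2) m(2)] nth_eq_iff_index_eq[OF dist i(2) l0] by simp_all
      moreover have "(vs ! i, vs ! Suc i) \<noteq> e" "(vs ! Suc i, vs ! i) \<noteq> e"
        using e(2) n m Suc.prems by auto
      ultimately have "(vs ! i, vs ! Suc i) \<in> symcl (E - {e})" by auto
      then show ?case using Suc by (auto intro: rtrancl_into_rtrancl)
    qed simp
    from this[OF order_refl] have p: "(vs ! 0, vs ! m) \<in> (symcl (E - {e}))\<^sup>*" .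
    then have "(vs ! m, vs ! 0) \<in> (symcl (E - {e}))\<^sup>*" by (rule sym_rtrancl_symcl)
    with p have "e \<in> (symcl (E - {e}))\<^sup>*" using e(2) by metis
    then show False using E e(1) by blast
  qed
qed

text \<open>Edges are added one at a time. A new edge joins two different components of the earlier
  ones, so rescaling \<open>t\<close> on the component of its head adjusts the quotient at this edge
  and leaves all earlier quotients unchanged.\<close>

lemma forest_solve:
  fixes z :: "nat \<times> nat \<Rightarrow> complex"
  assumes E: "\<And>e. e \<in> E \<Longrightarrow> e \<notin> (symcl (E - {e}))\<^sup>*" and z: "\<And>e. e \<in> E \<Longrightarrow> z e \<noteq> 0"
    and "finite F" "F \<subseteq> E"
  shows "\<exists>t. (\<forall>a. t a \<noteq> 0) \<and> (\<forall>e\<in>F. t (snd e) / t (fst e) = z e)"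
  using assms(3,4)
proof (induction F rule: finite_induct)
  case empty
  then show ?case by (intro exI[of _ "\<lambda>_. 1"]) simp
next
  case (insert e F)
  then obtain t where "(\<forall>a. t a \<noteq> 0) \<and> (\<forall>e\<in>F. t (snd e) / t (fst e) = z e)" by auto
  then have t: "\<And>a. t a \<noteq> 0" "\<And>e. e \<in> F \<Longrightarrow> t (snd e) / t (fst e) = z e" by auto
  obtain b a where e: "e = (b, a)" by (cases e)
  define C where "C = {c. (a, c) \<in> (symcl F)\<^sup>*}"
  have "b \<notin> C"
  proof
    assume "b \<in> C"
    then have "(b, a) \<in> (symcl F)\<^sup>*" unfolding C_def mem_Collect_eq by (rule sym_rtrancl_symcl)
    then have "e \<in> (symcl F)\<^sup>*" by (simp add: e)
    moreover have "(symcl F)\<^sup>* \<subseteq> (symcl (E - {e}))\<^sup>*" using insert by (intro rtrancl_mono) auto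
    ultimately show False using E[of e] insert.prems by blast
  qed
  have C_iff: "c \<in> C \<longleftrightarrow> d \<in> C" if "(c, d) \<in> F" for c d
  proof -
    have "(c, d) \<in> symcl F" "(d, c) \<in> symcl F" using that by auto
    then show ?thesis unfolding C_def mem_Collect_eq by (meson rtrancl.rtrancl_into_rtrancl)
  qed
  define t' where "t' c = (if c \<in> C then t c * (z e * t b / t a) else t c)" for c
  have "z e * t b / t a \<noteq> 0" using z[of e] t(1) insert.prems by simp
  then have "t' c \<noteq> 0" for c using t(1) by (simp add: t'_def)
  moreover have t': "t' d / t' c = z (c, d)" if "(c, d) \<in> insert e F" for c d
  proof (cases "(c, d) = e")
    case True
    have "a \<in> C" by (simp add: C_def)
    then show ?thesis using True \<open>b \<notin> C\<close> t(1) e by (simp add: t'_def)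
  next
    case False
    then have cd: "(c, d) \<in> F" using that by auto
    have "t' d / t' c = t d / t c"
      using C_iff[OF cd] \<open>z e * t b / t a \<noteq> 0\<close> by (simp add: t'_def)
    then show ?thesis using t(2)[OF cd] by simp
  qed
  ultimately show ?case by (intro exI[of _ t']) auto
qed

text \<open>The exponents are independent of \<open>t\<close>: walking along the path, each edge
  contributes 1 or -1 according to the direction in which it is used.\<close>

lemma character_generated:
  assumes J: "finite J" and "(b, a) \<in> (symcl J)\<^sup>*"
  shows "\<exists>k :: nat \<times> nat \<Rightarrow> int. \<forall>t :: nat \<Rightarrow> complex. (\<forall>a. t a \<noteq> 0) \<longrightarrow>
    t a / t b = (\<Prod>e\<in>J. (t (snd e) / t (fst e)) powi k e)"
  using assms(2)
proof (induction rule: rtrancl_induct)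
  case base
  then show ?case by (intro exI[of _ "\<lambda>_. 0"]) simp
next
  case (step c d)
  obtain k :: "nat \<times> nat \<Rightarrow> int" where k: "\<And>t :: nat \<Rightarrow> complex. (\<forall>a. t a \<noteq> 0) \<Longrightarrow>
    t c / t b = (\<Prod>e\<in>J. (t (snd e) / t (fst e)) powi k e)" using step.IH by blast
  have add: "\<exists>k' :: nat \<times> nat \<Rightarrow> int. \<forall>t :: nat \<Rightarrow> complex. (\<forall>a. t a \<noteq> 0) \<longrightarrow>
      t d / t b = (\<Prod>e\<in>J. (t (snd e) / t (fst e)) powi k' e)"
    if e0: "e0 \<in> J" and m: "\<And>t :: nat \<Rightarrow> complex. (\<forall>a. t a \<noteq> 0) \<Longrightarrow>
      t d / t c = (t (snd e0) / t (fst e0)) powi m" for e0 m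
  proof (intro exI[of _ "\<lambda>e. k e + (if e = e0 then m else 0)"] allI impI)
    fix t :: "nat \<Rightarrow> complex" assume t: "\<forall>a. t a \<noteq> 0"
    have "(\<Prod>e\<in>J. (t (snd e) / t (fst e)) powi (k e + (if e = e0 then m else 0))) =
        (\<Prod>e\<in>J. (t (snd e) / t (fst e)) powi k e) *
        (\<Prod>e\<in>J. if e = e0 then (t (snd e) / t (fst e)) powi m else 1)"
      unfolding prod.distrib[symmetric] using t by (intro prod.cong) (auto simp: power_int_add)
    also have "\<dots> = t c / t b * (t d / t c)" using k[OF t] m[OF t] e0 J by simp
    also have "\<dots> = t d / t b" using t by simp
    finally show "t d / t b = (\<Prod>e\<in>J. (t (snd e) / t (fst e)) powi (k e + (if e = e0 then m else 0)))"
      by simp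
  qed
  from step.hyps(2) consider "(c, d) \<in> J" | "(d, c) \<in> J" by auto
  then show ?case
  proof cases
    case 1
    show ?thesis by (rule add[OF 1, of 1]) simp
  next
    case 2
    show ?thesis by (rule add[OF 2, of "-1"]) (simp add: power_int_minus)
  qed
qed

section \<open>The closure of a generic torus orbit in a chart\<close>

lemma minor_cong: "(\<And>r. r < m \<Longrightarrow> \<sigma> r = \<tau> r) \<Longrightarrow> minor m \<sigma> g = minor m \<tau> g"
  unfolding minor_def by (intro arg_cong[of _ _ det] eq_matI) auto

locale generic_chart = generic_orbit +
  fixes u :: "nat \<Rightarrow> nat"
  assumes u: "u permutes {0..<n}" and u_le: "bruhat_le n u w"

sublocale generic_chart \<subseteq> chart_variety n u Y
  using u closedin_Y by unfold_locales

context generic_chart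
begin

section \<open>Coordinates of the orbit in the chart and their support\<close>

definition pos :: "nat \<Rightarrow> nat" where "pos = Hilbert_Choice.inv u"

lemma pos_u [simp]: "pos (u c) = c" and u_pos [simp]: "u (pos a) = a"
  using permutes_inverses[OF u] by (simp_all add: pos_def)

lemma u_eq_iff [simp]: "u c = u d \<longleftrightarrow> c = d"
  using permutes_inj[OF u] by (auto dest: injD)

lemma u_less [simp]: "u c < n \<longleftrightarrow> c < n"
  using permutes_in_image[OF u, of c] by simp

lemma pos_less [simp]: "pos a < n \<longleftrightarrow> a < n"
  using u_less[of "pos a"] by simp

definition base :: "complex mat" where
  "base = (SOME A. A \<in> slice n u \<and> coset_of n A \<in> Orb)"

text \<open>The chart is an open neighbourhood of the fixed point of \<open>u\<close>, which lies in
  the closure of the orbit; hence it meets the orbit.\<close>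

lemma base_slice: "base \<in> slice n u" and base_Orb: "coset_of n base \<in> Orb"
proof -
  have cl: "coset_of n (perm_mat n u) \<in> flag_top n closure_of Orb"
    using perm_point_Y_iff[OF u] u_le by (simp add: perm_point_def Y_def)
  have "\<exists>A. A \<in> slice n u \<and> coset_of n A \<in> Orb"
    by (rule closure_of_chart_nonzero[of u n "\<lambda>_. 1" "perm_mat n u" Orb,
      OF u poly_fun.const perm_mat_slice[OF u] one_neq_zero cl]) blast
  from someI_ex[OF this] show "base \<in> slice n u" "coset_of n base \<in> Orb" by (simp_all add: base_def)
qed

definition orbit_pt :: "(nat \<Rightarrow> complex) \<Rightarrow> complex mat" where
  "orbit_pt t = torus_scale n u t base"

lemma orbit_pt_index: "a < n \<Longrightarrow> j < n \<Longrightarrow> orbit_pt t $$ (a, j) = t a / t (u j) * base $$ (a, j)"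
  by (simp add: orbit_pt_def torus_scale_def)

lemma orbit_pt_slice: "(\<And>a. t a \<noteq> 0) \<Longrightarrow> orbit_pt t \<in> slice n u"
  unfolding orbit_pt_def by (rule torus_scale_slice[OF u _ base_slice])

lemma Orb_eq: "Orb = {coset_of n (orbit_pt t) | t. \<forall>a. t a \<noteq> 0}"
proof (intro equalityI subsetI)
  fix y assume y: "y \<in> Orb"
  obtain x where x: "x \<in> schubert_variety n w" "Orb = torus_orbit n x"
    using generic by (auto simp: generic_torus_orbit_def)
  have "x \<in> flags n" using x(1) closedin_subset[OF closedin_schubert_variety[OF w]] by auto
  then obtain g where g: "g \<in> carrier (GL n)" "x = coset_of n g" by (auto simp: flags_eq)
  note Orb = torus_orbit_slice[OF GL_carrier_mat[OF g(1)], of id, folded g(2) x(2)]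
  obtain t0 where t0: "\<And>a. t0 a \<noteq> 0" "coset_of n base = coset_of n (torus_scale n id t0 g)"
    using base_Orb unfolding Orb by auto
  obtain t where t: "\<And>a. t a \<noteq> 0" "y = coset_of n (torus_scale n id t g)"
    using y unfolding Orb by auto
  let ?t = "\<lambda>a. t a / t0 a"
  have nz: "?t a \<noteq> 0" for a using t(1) t0(1) by simp
  have "torus_scale n id t0 g \<in> carrier_mat n n" by (simp add: torus_scale_def)
  from translate_torus_mat[where u = id and t = ?t, OF this nz]
  have "torus_mat n ?t <#\<^bsub>GL n\<^esub> coset_of n base = coset_of n (torus_scale n id ?t (torus_scale n id t0 g))"
    unfolding t0(2) .
  also have "\<dots> = y" using t0(1) by (simp add: torus_scale_scale permutes_id t(2))
  finally have "y = coset_of n (orbit_pt ?t)"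
    using translate_torus_mat[where u = u and t = ?t, OF slice_carrier_mat[OF base_slice] nz]
    by (simp add: orbit_pt_def)
  then show "y \<in> {coset_of n (orbit_pt t) | t. \<forall>a. t a \<noteq> 0}" using nz by blast
next
  fix y assume "y \<in> {coset_of n (orbit_pt t) | t. \<forall>a. t a \<noteq> 0}"
  then obtain t where t: "\<And>a. t a \<noteq> 0" "y = coset_of n (orbit_pt t)" by auto
  have "y = torus_mat n t <#\<^bsub>GL n\<^esub> coset_of n base"
    unfolding t(2) orbit_pt_def
    by (rule translate_torus_mat[where t = t, OF slice_carrier_mat[OF base_slice] t(1), symmetric])
  then show "y \<in> Orb" using Orb_translate[OF base_Orb torus_mat_diag_torus[of t, OF t(1)]] by simp
qed

lemma OrbE:
  assumes "y \<in> Orb" obtains t where "\<forall>a. t a \<noteq> 0" "y = coset_of n (orbit_pt t)"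
proof -
  have "\<exists>t. y = coset_of n (orbit_pt t) \<and> (\<forall>a. t a \<noteq> 0)"
    using assms by (subst (asm) Orb_eq) blast
  then show ?thesis using that by blast
qed

lemma Orb_Y: "Orb \<subseteq> Y"
  unfolding Y_def using Orb_flags by (intro closure_of_subset) simp

lemma orbit_pt_K: "(\<And>a. t a \<noteq> 0) \<Longrightarrow> orbit_pt t \<in> K"
proof -
  assume t: "\<And>a. t a \<noteq> 0"
  then have "coset_of n (orbit_pt t) \<in> Orb" by (subst Orb_eq) blast
  then show ?thesis using orbit_pt_slice[of t, OF t] Orb_Y by (auto simp: K_def)
qed

lemma orbit_dense:
  assumes p: "p \<in> poly_fun n" and zero: "\<And>t. (\<And>a. t a \<noteq> 0) \<Longrightarrow> p (orbit_pt t) = 0" and A: "A \<in> K"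
  shows "p A = 0"
proof (rule ccontr)
  assume "p A \<noteq> 0"
  then obtain B where B: "B \<in> slice n u" "coset_of n B \<in> Orb" "p B \<noteq> 0"
    using closure_of_chart_nonzero[OF u p K_slice[OF A]] K_Y[OF A] unfolding Y_def by blast
  obtain t where t: "\<forall>a. t a \<noteq> 0" "coset_of n B = coset_of n (orbit_pt t)" by (rule OrbE[OF B(2)])
  have "B = orbit_pt t" by (rule coset_of_slice_inj[OF u B(1) orbit_pt_slice[of t, OF t(1)[rule_format]] t(2)])
  then show False using zero[of t, OF t(1)[rule_format]] B(3) by simp
qed

definition supp :: "(nat \<times> nat) set" where
  "supp = {(u j, u i) | j i. j < i \<and> i < n \<and> base $$ (u i, j) \<noteq> 0}"

lemma supp_iff: "(b, a) \<in> supp \<longleftrightarrow> pos b < pos a \<and> a < n \<and> base $$ (a, pos b) \<noteq> 0"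
proof
  assume "pos b < pos a \<and> a < n \<and> base $$ (a, pos b) \<noteq> 0"
  then have "(u (pos b), u (pos a)) \<in> supp" unfolding supp_def
    by (intro CollectI exI[of _ "pos b"] exI[of _ "pos a"]) simp
  then show "(b, a) \<in> supp" by simp
qed (auto simp: supp_def)

lemma supp_measure: "supp \<subseteq> measure pos"
  by (auto simp: supp_def)

lemma supp_less: "(b, a) \<in> supp \<Longrightarrow> b < n \<and> a < n"
  by (auto simp: supp_def)

lemma finite_supp: "finite supp"
  by (rule finite_subset[of _ "{..<n} \<times> {..<n}"]) (use supp_less in auto)

lemma base_outside_supp:
  assumes "a < n" "j < n" "a \<noteq> u j" "(u j, a) \<notin> supp"
  shows "base $$ (a, j) = 0"
proof (cases "j < pos a")
  case True
  then show ?thesis using assms by (simp add: supp_iff)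
next
  case False
  moreover have "pos a \<noteq> j" using assms(3) by auto
  ultimately have "base $$ (u (pos a), j) = 0"
    using base_slice assms(1,2) by (simp add: slice_def del: u_pos)
  then show ?thesis by simp
qed

text \<open>The fixed point of the swapped permutation lies in \<open>Y\<close>, so its minor of
  size \<open>Suc j\<close> is nonzero somewhere on the orbit. Up to position \<open>j\<close> the
  two permutations differ only at \<open>j\<close>, so on the slice this minor is the coordinate at
  \<open>(u i, j)\<close>.\<close>

lemma swap_le_supp:
  assumes ji: "j < i" "i < n" and le: "bruhat_le n (Transposition.transpose (u j) (u i) \<circ> u) w"
  shows "(u j, u i) \<in> supp"
proof -
  let ?v = "Transposition.transpose (u j) (u i) \<circ> u"
  have v: "?v permutes {0..<n}" by (rule permutes_swap_values[OF u]) (use ji in auto)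
  have jn: "Suc j \<le> n" using ji by simp
  have vl: "?v r < n" if "r < Suc j" for r using permutes_lessD[OF v] that ji by simp
  have "coset_of n (perm_mat n ?v) \<in> flag_top n closure_of Orb"
    using perm_point_Y_iff[OF v] le by (simp add: perm_point_def Y_def)
  moreover have "minor (Suc j) ?v (perm_mat n ?v) \<noteq> 0"
    using minor_slice[OF perm_mat_slice[OF v] jn] by simp
  ultimately obtain h where h: "h \<in> carrier (GL n)" "coset_of n h \<in> Orb" "minor (Suc j) ?v h \<noteq> 0"
    using closure_of_minor_nonzero[of "Suc j" n ?v, OF jn vl perm_mat_GL[OF v]] by blast
  obtain t where t: "\<forall>a. t a \<noteq> 0" "coset_of n h = coset_of n (orbit_pt t)" by (rule OrbE[OF h(2)])
  have slice: "orbit_pt t \<in> slice n u" using orbit_pt_slice t(1) by blast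
  obtain b where b: "b \<in> borel_group n" "h = orbit_pt t * b"
    using coset_of_eqD[OF GL_carrier_mat[OF h(1)] t(2)[symmetric]] by blast
  have "minor (Suc j) ?v (orbit_pt t) \<noteq> 0"
    using h(3) minor_mult_borel[of "orbit_pt t" n b "Suc j" ?v, OF slice_carrier_mat[OF slice] b(1) jn vl]
    unfolding b(2) by auto
  moreover have "minor (Suc j) ?v (orbit_pt t) = minor (Suc j) (u(j := u i)) (orbit_pt t)"
    by (rule minor_cong) (use ji in \<open>auto simp: Transposition.transpose_def\<close>)
  moreover have "\<dots> = orbit_pt t $$ (u i, j)" by (rule minor_slice_update[OF slice]) (use ji in simp)
  ultimately have "base $$ (u i, j) \<noteq> 0" using orbit_pt_index[of "u i" j t] ji by simp
  then show ?thesis using ji by (simp add: supp_iff)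
qed

text \<open>A potential for the indecomposable edge gives a one-parameter subgroup whose limit keeps
  only the coordinate of this edge.\<close>

lemma edge_curve_K:
  assumes ji: "j < i" "i < n" and e: "(u j, u i) \<in> indecomposables supp"
  shows "edge_mat n u j i s \<in> K"
proof -
  obtain l :: "nat \<Rightarrow> nat" where l: "l (u j) = l (u i)"
    "\<And>b a. (b, a) \<in> supp \<Longrightarrow> (b, a) \<noteq> (u j, u i) \<Longrightarrow> l a < l b"
    by (rule indecomposable_potential[OF supp_measure finite_supp e]) blast
  have eP: "(u j, u i) \<in> supp" using e by (simp add: indecomposables_def)
  then have nz: "base $$ (u i, j) \<noteq> 0" by (simp add: supp_iff)
  have le: "l a \<le> l b" if "(b, a) \<in> supp" for a b
    using l(2)[OF that] l(1) by (cases "(b, a) = (u j, u i)") auto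
  have "coset_of n (edge_mat n u j i s) \<in> Y"
  proof (cases "s = 0")
    case True
    then show ?thesis using perm_point_Y_iff[OF u] u_le by (simp add: edge_mat_0 perm_point_def)
  next
    case False
    \<comment> \<open>This factor brings the coordinate at \<open>(u i, j)\<close> to the prescribed
      value \<open>s\<close>.\<close>
    define c where "c a = (if a = u i then s / base $$ (u i, j) else 1)" for a
    have c_nz: "c a \<noteq> 0" for a using False nz by (simp add: c_def)
    \<comment> \<open>The orbit under the one-parameter subgroup with weights \<open>l\<close>, run
      towards \<open>\<tau> = 0\<close>. The exponent is 0 at the chosen edge and positive at every
      other pair of the support, so only this edge coordinate survives at 0.\<close>
    define \<gamma> where "\<gamma> \<tau> = mat n n (\<lambda>(a, k). if a = u k then 1 else if (u k, a) \<in> supp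
        then c a / c (u k) * base $$ (a, k) * \<tau> ^ (l (u k) - l a) else 0)" for \<tau> :: complex
    have \<gamma>_orbit: "\<gamma> \<tau> = orbit_pt (\<lambda>a. c a * (1 / \<tau>) ^ l a)" if "\<tau> \<noteq> 0" for \<tau>
    proof (rule eq_matI)
      fix a k assume "a < dim_row (orbit_pt (\<lambda>a. c a * (1 / \<tau>) ^ l a))"
        "k < dim_col (orbit_pt (\<lambda>a. c a * (1 / \<tau>) ^ l a))"
      then have ak: "a < n" "k < n" by (auto simp: orbit_pt_def torus_scale_def)
      consider "a = u k" | "a \<noteq> u k" "(u k, a) \<in> supp" | "a \<noteq> u k" "(u k, a) \<notin> supp" by blast
      then show "\<gamma> \<tau> $$ (a, k) = orbit_pt (\<lambda>a. c a * (1 / \<tau>) ^ l a) $$ (a, k)"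
      proof cases
        case 1
        have "base $$ (u k, k) = 1" using base_slice ak by (simp add: slice_def)
        then show ?thesis using 1 ak that c_nz by (simp add: orbit_pt_index \<gamma>_def)
      next
        case 2
        have "\<tau> ^ (l (u k) - l a) = \<tau> ^ l (u k) / \<tau> ^ l a" using le[OF 2(2)] that by (simp add: power_diff)
        then show ?thesis using 2 ak that c_nz by (simp add: orbit_pt_index \<gamma>_def power_one_over divide_simps)
      next
        case 3
        then show ?thesis using base_outside_supp[OF ak 3] ak by (simp add: orbit_pt_index \<gamma>_def)
      qed
    qed (auto simp: \<gamma>_def orbit_pt_def torus_scale_def)
    have \<gamma>_0: "\<gamma> 0 = edge_mat n u j i s"
    proof (rule eq_matI)
      fix a k assume "a < dim_row (edge_mat n u j i s)" "k < dim_col (edge_mat n u j i s)"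
      then have ak: "a < n" "k < n" by (auto simp: edge_mat_def)
      consider "a = u k" | "a \<noteq> u k" "k = j" "a = u i" | "a \<noteq> u k" "(u k, a) \<noteq> (u j, u i)" by auto
      then show "\<gamma> 0 $$ (a, k) = edge_mat n u j i s $$ (a, k)"
      proof cases
        case 1
        then show ?thesis using ak by (simp add: \<gamma>_def edge_mat_def)
      next
        case 2
        then show ?thesis using ak eP l(1) nz ji by (simp add: \<gamma>_def edge_mat_def c_def)
      next
        case 3
        then have "(u k, a) \<in> supp \<longrightarrow> (0::complex) ^ (l (u k) - l a) = 0" using l(2)[of "u k" a] by auto
        then show ?thesis using 3 ak by (auto simp: \<gamma>_def edge_mat_def)
      qed
    qed (auto simp: \<gamma>_def edge_mat_def)
    have "poly_curve n \<gamma>" unfolding poly_curve_def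
    proof (intro allI impI)
      fix a k assume "a < n" "k < n"
      then show "\<exists>P. \<forall>\<tau>. \<gamma> \<tau> $$ (a, k) = poly P \<tau>"
        by (intro exI[of _ "if a = u k then 1 else if (u k, a) \<in> supp
            then monom (c a / c (u k) * base $$ (a, k)) (l (u k) - l a) else 0"])
          (auto simp: \<gamma>_def poly_monom)
    qed
    moreover have "\<gamma> \<tau> \<in> carrier (GL n) \<and> coset_of n (\<gamma> \<tau>) \<in> Y" if "\<tau> \<notin> {0}" for \<tau>
    proof -
      have "\<gamma> \<tau> \<in> K" unfolding \<gamma>_orbit[OF that[simplified]]
        using that c_nz by (intro orbit_pt_K) simp
      then show ?thesis using K_GL K_Y by simp
    qed
    ultimately have "coset_of n (\<gamma> 0) \<in> Y"
      using poly_curve_closed[OF closedin_Y, of \<gamma> "{0}" 0] slice_GL[OF u edge_mat_slice[OF u ji]]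
      unfolding \<gamma>_0 by simp
    then show ?thesis by (simp add: \<gamma>_0)
  qed
  then show ?thesis using edge_mat_slice[OF u ji] by (simp add: K_def)
qed

text \<open>The far end of the edge curve shows that the swap stays below \<open>w\<close>. If the
  length changed by more than one, some position between \<open>j\<close> and \<open>i\<close> would
  carry a value between \<open>u j\<close> and \<open>u i\<close>. The two partial swaps are then
  below the full swap if it goes up, and below \<open>u\<close> if it goes down, so
  \<open>swap_le_supp\<close> puts both in the support and decomposes the pair.\<close>

lemma indecomposables_Etilde: "indecomposables supp \<subseteq> Etilde n w u"
proof
  fix e assume e: "e \<in> indecomposables supp"
  then have eP: "e \<in> supp" and ind: "e \<notin> (supp - {e})\<^sup>+"
    by (auto simp: indecomposables_def decomposable_def)
  obtain j i where ji: "j < i" "i < n" "e = (u j, u i)" using eP by (auto simp: supp_def)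
  let ?v = "Transposition.transpose (u j) (u i) \<circ> u"
  have v: "?v permutes {0..<n}" by (rule permutes_swap_values[OF u]) (use ji in auto)
  have "perm_point n ?v \<in> Y"
    by (rule edge_curve_swap_limit[OF u ji(1,2) closedin_Y])
      (use edge_curve_K[OF ji(1,2)] e ji(3) K_Y in auto)
  then have v_le: "bruhat_le n ?v w" using perm_point_Y_iff[OF v] by simp
  have no_split: "\<not> ((u j, u k) \<in> supp \<and> (u k, u i) \<in> supp)" for k
  proof
    assume k: "(u j, u k) \<in> supp \<and> (u k, u i) \<in> supp"
    then have "j < k" "k < i" using supp_iff by auto
    then have "(u j, u k) \<in> supp - {e}" "(u k, u i) \<in> supp - {e}" using k ji by auto
    then have "e \<in> (supp - {e})\<^sup>+" unfolding ji(3) by (meson r_into_trancl trancl_trans)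
    then show False using ind by simp
  qed
  have "\<bar>int (perm_length n u) - int (perm_length n ?v)\<bar> = 1"
  proof (cases "u j < u i")
    case True
    have "\<not> (u j < u k \<and> u k < u i)" if k: "j < k" "k < i" for k
    proof
      assume uk: "u j < u k \<and> u k < u i"
      note im = bruhat_le_intermediate[OF u k ji(2) uk[THEN conjunct1] uk[THEN conjunct2]]
      have "(u j, u k) \<in> supp"
        by (rule swap_le_supp) (use k ji bruhat_le_trans[OF im(1) v_le] in auto)
      moreover have "(u k, u i) \<in> supp"
        by (rule swap_le_supp) (use k ji bruhat_le_trans[OF im(2) v_le] in auto)
      ultimately show False using no_split by blast
    qed
    then have "perm_length n (u \<circ> Transposition.transpose j i) = Suc (perm_length n u)"
      by (intro perm_length_swap_cover[OF ji(1,2) True permutes_inj[OF u]])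
    then show ?thesis unfolding transpose_values[OF permutes_inj[OF u]] by simp
  next
    case False
    then have gt: "u i < u j" using ji by (metis linorder_neqE_nat nat_neq_iff u_eq_iff)
    have down: "(u p, u q) \<in> supp" if "p < q" "q < n" "u q < u p" for p q
      by (rule swap_le_supp[OF that(1,2)])
        (use bruhat_le_trans[OF bruhat_le_step[OF bruhat_step_down[OF u that]] u_le] in simp)
    have vv: "?v j = u i" "?v i = u j" by simp_all
    have "\<not> (?v j < ?v k \<and> ?v k < ?v i)" if k: "j < k" "k < i" for k
    proof
      assume vk: "?v j < ?v k \<and> ?v k < ?v i"
      have "?v k = u k" using k by (simp add: Transposition.transpose_def)
      then have "u i < u k" "u k < u j" using vk vv by auto
      then have "(u j, u k) \<in> supp" "(u k, u i) \<in> supp" using k ji by (auto intro: down)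
      then show False using no_split by blast
    qed
    moreover have "?v j < ?v i" using gt vv by simp
    ultimately have "perm_length n (?v \<circ> Transposition.transpose j i) = Suc (perm_length n ?v)"
      by (intro perm_length_swap_cover[OF ji(1,2) _ permutes_inj[OF v]])
    moreover have "?v \<circ> Transposition.transpose j i = u"
      unfolding transpose_values[OF permutes_inj[OF u]] by (simp add: fun_eq_iff)
    ultimately show ?thesis by simp
  qed
  then show "e \<in> Etilde n w u" unfolding Etilde_def using ji v_le by blast
qed

lemma Etilde_supp: "Etilde n w u \<subseteq> supp"
proof
  fix e assume "e \<in> Etilde n w u"
  then obtain i j where "e = (u i, u j)" "i < j" "j < n"
    "bruhat_le n (Transposition.transpose (u i) (u j) \<circ> u) w"
    unfolding Etilde_def by blast
  then show "e \<in> supp" using swap_le_supp by simp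
qed

lemma Eindec_eq: "Eindec n w u = indecomposables supp"
proof -
  have "Eindec n w u = indecomposables (Etilde n w u)" by (simp add: Eindec_def indecomposables_def)
  also have "\<dots> = indecomposables supp"
    by (rule indecomposables_cong[OF supp_measure Etilde_supp indecomposables_Etilde])
  finally show ?thesis .
qed

end

section \<open>Smoothness and forests\<close>

context generic_chart
begin

abbreviation edges :: "(nat \<times> nat) set" where "edges \<equiv> indecomposables supp"

abbreviation entry :: "nat \<times> nat \<Rightarrow> nat \<times> nat" where "entry e \<equiv> (snd e, pos (fst e))"

lemma edges_supp: "e \<in> edges \<Longrightarrow> e \<in> supp"
  by (simp add: indecomposables_def)

lemma finite_edges: "finite edges"
  by (rule finite_subset[OF _ finite_supp]) (auto dest: edges_supp)

lemma edges_measure: "edges \<subseteq> measure pos"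
  using supp_measure edges_supp by blast

lemma entry_less: "e \<in> supp \<Longrightarrow> fst (entry e) < n \<and> snd (entry e) < n"
  using supp_less[of "fst e" "snd e"] by simp

lemma supp_edges_trancl: "(b, a) \<in> supp \<Longrightarrow> (b, a) \<in> edges\<^sup>+"
  using trancl_indecomposables[OF supp_measure] by blast

lemma Gamma_forest_iff: "is_forest (Gamma n w u) \<longleftrightarrow> (\<forall>e\<in>edges. e \<notin> (symcl (edges - {e}))\<^sup>*)"
  unfolding Gamma_def Eindec_eq by (rule is_forest_iff[OF edges_measure])

definition nz :: "(nat \<Rightarrow> complex) \<Rightarrow> nat \<Rightarrow> complex" where
  "nz t a = (if t a = 0 then 1 else t a)"

lemma nz_nonzero [simp]: "nz t a \<noteq> 0"
  by (simp add: nz_def)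

text \<open>Regular functions restrict to Laurent polynomials in the characters of the edges in \<open>J\<close>.
  The functions \<open>nz t\<close> make every \<open>t\<close> a point of the torus.\<close>

lemma local_dim_le_card:
  assumes J: "finite J" and gen: "\<And>e. e \<in> supp \<Longrightarrow> e \<in> (symcl J)\<^sup>*" and A0: "A0 \<in> K"
  shows "local_dim X (coset_of n A0) \<le> enat (card J)"
proof -
  have "\<exists>k :: nat \<times> nat \<Rightarrow> int. \<forall>t :: nat \<Rightarrow> complex. (\<forall>a. t a \<noteq> 0) \<longrightarrow>
      t (snd e) / t (fst e) = (\<Prod>e\<in>J. (t (snd e) / t (fst e)) powi k e)" if "e \<in> supp" for e
    using character_generated[OF J, of "fst e" "snd e"] gen[OF that] by simp
  then obtain k :: "nat \<times> nat \<Rightarrow> nat \<times> nat \<Rightarrow> int" where k: "\<And>e t. e \<in> supp \<Longrightarrow> \<forall>a. t a \<noteq> 0 \<Longrightarrow>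
      t (snd e) / t (fst e) = (\<Prod>e'\<in>J. (t (snd e') / t (fst e') :: complex) powi k e e')"
    by metis
  \<comment> \<open>A common bound for all exponents, which puts every coordinate into the span of
    \<open>B 1\<close>.\<close>
  define c where "c = nat (\<Sum>e\<in>supp. \<Sum>e'\<in>J. \<bar>k e e'\<bar>)"
  have k_le: "\<bar>k e e'\<bar> \<le> int c" if "e \<in> supp" "e' \<in> J" for e e'
  proof -
    have "\<bar>k e e'\<bar> \<le> (\<Sum>e'\<in>J. \<bar>k e e'\<bar>)" using that J by (intro member_le_sum) auto
    also have "\<dots> \<le> (\<Sum>e\<in>supp. \<Sum>e'\<in>J. \<bar>k e e'\<bar>)"
      using that finite_supp by (intro member_le_sum) (auto intro: sum_nonneg)
    also have "\<dots> \<le> int c" by (simp add: c_def)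
    finally show ?thesis .
  qed
  define mono :: "(nat \<times> nat \<Rightarrow> int) \<Rightarrow> (nat \<Rightarrow> complex) \<Rightarrow> complex" where
    "mono m t = (\<Prod>e\<in>J. (nz t (snd e) / nz t (fst e)) powi m e)" for m t
  \<comment> \<open>Exponent vectors are taken extensional on \<open>J\<close> to keep the box
    finite. Its side has \<open>2 * c * r + 1\<close> integers, which is the source of the growth
    constant \<open>2 * c\<close>.\<close>
  define box where "box r = (J \<rightarrow>\<^sub>E {- int (c * r)..int (c * r)})" for r :: nat
  define B where "B r = mono ` box r" for r
  have mono_in_B: "mono m \<in> B r" if m: "\<And>e. e \<in> J \<Longrightarrow> \<bar>m e\<bar> \<le> int (c * r)" for m r
  proof -
    have "mono m = mono (restrict m J)" by (auto simp: mono_def fun_eq_iff intro!: prod.cong)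
    moreover have "m e \<in> {- int (c * r)..int (c * r)}" if "e \<in> J" for e using m[OF that] by auto
    then have "restrict m J \<in> box r" unfolding box_def restrict_PiE_iff by blast
    ultimately show ?thesis by (auto simp: B_def)
  qed
  have box_le: "\<bar>m e\<bar> \<le> int (c * r)" if "m \<in> box r" "e \<in> J" for m e r
  proof -
    have "m e \<in> {- int (c * r)..int (c * r)}" using that unfolding box_def by (rule PiE_mem)
    then show ?thesis by auto
  qed
  show ?thesis
  proof (rule local_dim_le[OF A0, where \<theta> = "\<lambda>t. orbit_pt (nz t)" and B = B and C = "2 * c"])
    fix p assume p: "p \<in> poly_fun n" "\<And>t. p (orbit_pt (nz t)) = 0"
    have "p (orbit_pt t) = 0" if "\<And>a. t a \<noteq> 0" for t
    proof -
      have "nz t = t" using that by (simp add: nz_def fun_eq_iff)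
      then show ?thesis using p(2)[of t] by simp
    qed
    then show "\<forall>A\<in>K. p A = 0" using orbit_dense[OF p(1)] by blast
  next
    show "finite (B r)" for r using J by (auto simp: B_def box_def intro!: finite_PiE)
  next
    fix r
    have "finite (box r)" using J by (auto simp: box_def intro!: finite_PiE)
    then have "card (B r) \<le> card (box r)" unfolding B_def by (rule card_image_le)
    also have "\<dots> = (2 * c * r + 1) ^ card J"
    proof -
      have "card {- int (c * r)..int (c * r)} = 2 * c * r + 1" by (simp add: nat_add_distrib nat_mult_distrib)
      then show ?thesis using J by (simp add: box_def card_PiE)
    qed
    finally show "card (B r) \<le> (2 * c * r + 1) ^ card J" .
  next
    fix r s :: nat assume "r \<le> s"
    then have "c * r \<le> c * s" by simp
    then have "int (c * r) \<le> int (c * s)" by (rule of_nat_mono)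
    then have "box r \<subseteq> box s" unfolding box_def by (intro PiE_mono) auto
    then show "B r \<subseteq> B s" by (auto simp: B_def)
  next
    have "mono (\<lambda>_. 0) \<in> B 0" by (rule mono_in_B) simp
    then show "(\<lambda>_. 1) \<in> B 0" by (simp add: mono_def[abs_def])
  next
    fix r s f g assume "f \<in> B r" "g \<in> B s"
    then obtain m m' where m: "m \<in> box r" "f = mono m" "m' \<in> box s" "g = mono m'" by (auto simp: B_def)
    have "(\<lambda>t. f t * g t) = mono (\<lambda>e. m e + m' e)"
      by (simp add: m fun_eq_iff mono_def prod.distrib[symmetric] power_int_add)
    moreover have "mono (\<lambda>e. m e + m' e) \<in> B (r + s)"
    proof (rule mono_in_B)
      fix e assume "e \<in> J"
      then have "\<bar>m e\<bar> \<le> int (c * r)" "\<bar>m' e\<bar> \<le> int (c * s)" using box_le m by blast+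
      moreover have "int (c * (r + s)) = int (c * r) + int (c * s)" by (simp add: distrib_left)
      ultimately show "\<bar>m e + m' e\<bar> \<le> int (c * (r + s))" by linarith
    qed
    ultimately show "(\<lambda>t. f t * g t) \<in> B (r + s)" by simp
  next
    fix a j assume aj: "a < n" "j < n"
    consider "a = u j" | "a \<noteq> u j" "(u j, a) \<in> supp" | "a \<noteq> u j" "(u j, a) \<notin> supp" by blast
    then show "(\<lambda>t. orbit_pt (nz t) $$ (a, j)) \<in> cfun.span (B 1)"
    proof cases
      case 1
      have "mono (\<lambda>_. 0) \<in> B 1" by (rule mono_in_B) simp
      then have "(\<lambda>t. base $$ (a, j) * mono (\<lambda>_. 0) t) \<in> cfun.span (B 1)"
        by (intro cfun.span_scale cfun.span_base)
      then show ?thesis using 1 aj by (simp add: orbit_pt_index mono_def)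
    next
      case 2
      have "mono (k (u j, a)) \<in> B 1" by (rule mono_in_B) (use k_le[OF 2(2)] in simp)
      then have "(\<lambda>t. base $$ (a, j) * mono (k (u j, a)) t) \<in> cfun.span (B 1)"
        by (intro cfun.span_scale cfun.span_base)
      moreover have "orbit_pt (nz t) $$ (a, j) = base $$ (a, j) * mono (k (u j, a)) t" for t
        using k[OF 2(2), of "nz t"] aj by (simp add: orbit_pt_index mono_def)
      ultimately show ?thesis by simp
    next
      case 3
      then have "orbit_pt (nz t) $$ (a, j) = 0" for t
        using base_outside_supp[OF aj 3] aj by (simp add: orbit_pt_index)
      then show ?thesis using cfun.span_zero[of "B 1"] by (simp add: zero_fun_def)
    qed
  qed
qed

lemma supp_symcl:
  assumes "e \<in> supp" shows "e \<in> (symcl edges)\<^sup>*"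
proof -
  have "e \<in> edges\<^sup>+" using supp_edges_trancl[of "fst e" "snd e"] assms by simp
  then have "e \<in> edges\<^sup>*" by (cases e) (simp add: trancl_into_rtrancl)
  then show ?thesis using rtrancl_mono[of edges "symcl edges"] by blast
qed

lemma not_forest_not_smooth:
  assumes "\<not> is_forest (Gamma n w u)"
  shows "\<not> smooth_at_point n Y (perm_point n u)"
proof
  assume smooth: "smooth_at_point n Y (perm_point n u)"
  obtain e0 where e0: "e0 \<in> edges" "e0 \<in> (symcl (edges - {e0}))\<^sup>*"
    using assms unfolding Gamma_forest_iff by blast
  have A0: "perm_mat n u \<in> K"
    using perm_mat_slice[OF u] perm_point_Y_iff[OF u] u_le by (simp add: K_def perm_point_def)
  \<comment> \<open>The ends of \<open>e0\<close> stay connected without it, so the remaining edges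
    still generate all characters of the support.\<close>
  let ?J = "edges - {e0}"
  have "symcl edges \<subseteq> (symcl ?J)\<^sup>*"
  proof
    fix e assume "e \<in> symcl edges"
    moreover have "(snd e0, fst e0) \<in> (symcl ?J)\<^sup>*" using e0(2) sym_rtrancl_symcl[of "fst e0" "snd e0"] by simp
    ultimately show "e \<in> (symcl ?J)\<^sup>*" using e0(2) by (cases "e = e0 \<or> e = (snd e0, fst e0)") auto
  qed
  then have "(symcl edges)\<^sup>* \<subseteq> (symcl ?J)\<^sup>*" by (rule rtrancl_subset_rtrancl)
  then have "local_dim X (coset_of n (perm_mat n u)) \<le> enat (card ?J)"
    using supp_symcl finite_edges by (intro local_dim_le_card A0) auto
  moreover obtain d where d: "has_complex_dim (tangent_space X F (coset_of n (perm_mat n u))) d"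
    "local_dim X (coset_of n (perm_mat n u)) = enat d"
    using smooth unfolding smooth_at_point_def smooth_at_def perm_point_def by blast
  ultimately have "d \<le> card ?J" by simp
  moreover have "card edges \<le> d"
  proof (rule tangent_dim_ge[where e = entry and \<gamma> = "\<lambda>e. edge_mat n u (pos (fst e)) (pos (snd e))",
        OF finite_edges _ _ _ _ A0 _ d(1)])
    fix e assume e: "e \<in> edges"
    then have eP: "(fst e, snd e) \<in> supp" using edges_supp by simp
    show "fst (entry e) < n \<and> snd (entry e) < n" by (rule entry_less[OF edges_supp[OF e]])
    show "poly_curve n (edge_mat n u (pos (fst e)) (pos (snd e)))" by (rule poly_curve_edge_mat)
    have less: "pos (fst e) < pos (snd e)" "pos (snd e) < n"
      using eP supp_iff[of "fst e" "snd e"] by simp_all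
    show "edge_mat n u (pos (fst e)) (pos (snd e)) s \<in> K" for s
      by (rule edge_curve_K[OF less]) (use e in simp)
    show "edge_mat n u (pos (fst e)) (pos (snd e)) 0 = perm_mat n u" by (rule edge_mat_0)
    fix e' s assume e': "e' \<in> edges"
    have less: "snd e' < n" "pos (fst e') < n" using entry_less[OF edges_supp[OF e']] by auto
    have "pos (fst e') < pos (snd e')" using edges_supp[OF e'] supp_iff[of "fst e'" "snd e'"] by simp
    then have "snd e' \<noteq> fst e'" by auto
    moreover have "pos (fst e') = pos (fst e) \<longleftrightarrow> fst e' = fst e" by (metis u_pos)
    ultimately show "edge_mat n u (pos (fst e)) (pos (snd e)) s $$ entry e' =
        perm_mat n u $$ entry e' + (if e = e' then s else 0)"
      using less by (auto simp: edge_mat_def perm_mat_def prod_eq_iff)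
  qed
  moreover have "card ?J < card edges" using e0(1) finite_edges by (rule card_Diff1_less[rotated])
  ultimately show False by simp
qed

text \<open>When the graph is a forest, the characters of its edges are independent, so the chart is
  the affine space of the edge coordinates; every other coordinate is a monomial in these, read off
  from a path.\<close>

lemma edge_monomial:
  assumes "(b, a) \<in> edges\<^sup>+"
  shows "\<exists>q\<in>mpoly edges. \<exists>c. c \<noteq> 0 \<and> (\<forall>t. (\<forall>a. t a \<noteq> 0) \<longrightarrow>
    q (\<lambda>e. orbit_pt t $$ entry e) = c * (t a / t b))"
proof -
  have edge: "orbit_pt t $$ entry e = base $$ entry e * (t (snd e) / t (fst e)) \<and> base $$ entry e \<noteq> 0"
    if "e \<in> edges" for e t
    using edges_supp[OF that] entry_less[OF edges_supp[OF that]] supp_iff[of "fst e" "snd e"]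
    by (simp add: orbit_pt_index)
  show ?thesis using assms
  proof (induction rule: trancl_induct)
    case (base a)
    then show ?case
      by (intro rev_bexI[OF mpoly.var[OF base]] exI[of _ "base $$ entry (b, a)"])
        (use edge[OF base] in auto)
  next
    case (step a a')
    then obtain q c where q: "q \<in> mpoly edges" "c \<noteq> 0"
      "\<And>t. \<forall>a. t a \<noteq> 0 \<Longrightarrow> q (\<lambda>e. orbit_pt t $$ entry e) = c * (t a / t b)" by blast
    show ?case
      by (intro rev_bexI[OF mpoly.mult[OF q(1) mpoly.var[OF step.hyps(2)]]]
          exI[of _ "c * base $$ entry (a, a')"])
        (use q edge[OF step.hyps(2)] in auto)
  qed
qed

text \<open>For an edge the polynomial has to be the variable itself: the parametrization must have
  the prescribed edge coordinates at every point of affine space, also where these do not come from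
  the torus.\<close>

lemma coordinate_mpoly:
  assumes "e \<in> supp"
  shows "\<exists>q\<in>mpoly edges. (\<forall>t. (\<forall>a. t a \<noteq> 0) \<longrightarrow> q (\<lambda>e. orbit_pt t $$ entry e) = orbit_pt t $$ entry e) \<and>
    (e \<in> edges \<longrightarrow> q = (\<lambda>z. z e))"
proof (cases "e \<in> edges")
  case True
  then show ?thesis by (intro rev_bexI[OF mpoly.var[OF True]]) simp
next
  case False
  have "(fst e, snd e) \<in> edges\<^sup>+" using supp_edges_trancl[of "fst e" "snd e"] assms by simp
  then obtain q c where q: "q \<in> mpoly edges" "c \<noteq> 0"
    "\<And>t. \<forall>a. t a \<noteq> 0 \<Longrightarrow> q (\<lambda>e. orbit_pt t $$ entry e) = c * (t (snd e) / t (fst e))"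
    using edge_monomial by blast
  show ?thesis
    by (intro rev_bexI[OF mpoly.mult[OF mpoly.const[of "base $$ entry e / c"] q(1)]])
      (use q entry_less[OF assms] False in \<open>auto simp: orbit_pt_index\<close>)
qed

lemma forest_smooth:
  assumes forest: "is_forest (Gamma n w u)" and A0: "A0 \<in> K"
  shows "smooth_at_point n Y (coset_of n A0)"
proof -
  have "\<forall>e\<in>supp. \<exists>q. q \<in> mpoly edges \<and>
      (\<forall>t. (\<forall>a. t a \<noteq> 0) \<longrightarrow> q (\<lambda>e. orbit_pt t $$ entry e) = orbit_pt t $$ entry e) \<and>
      (e \<in> edges \<longrightarrow> q = (\<lambda>z. z e))"
    using coordinate_mpoly unfolding Bex_def by (intro ballI)
  from bchoice[OF this] obtain Q where Q0: "\<forall>e\<in>supp. Q e \<in> mpoly edges \<and>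
      (\<forall>t. (\<forall>a. t a \<noteq> 0) \<longrightarrow> Q e (\<lambda>e. orbit_pt t $$ entry e) = orbit_pt t $$ entry e) \<and>
      (e \<in> edges \<longrightarrow> Q e = (\<lambda>z. z e))" by (rule exE)
  have Q: "Q e \<in> mpoly edges"
    "\<forall>a. t a \<noteq> 0 \<Longrightarrow> Q e (\<lambda>e. orbit_pt t $$ entry e) = orbit_pt t $$ entry e"
    "e \<in> edges \<Longrightarrow> Q e = (\<lambda>z. z e)" if "e \<in> supp" for e t
    using bspec[OF Q0 that] by simp_all
  define \<psi> where "\<psi> z = mat n n (\<lambda>(a, j). if a = u j then 1 else if (u j, a) \<in> supp then Q (u j, a) z else 0)"
    for z
  have \<psi>_index: "\<psi> z $$ (a, j) = (if a = u j then 1 else if (u j, a) \<in> supp then Q (u j, a) z else 0)"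
    if "a < n" "j < n" for a j z using that by (simp add: \<psi>_def)
  have \<psi>_mpoly: "(\<lambda>z. \<psi> z $$ (a, j)) \<in> mpoly edges" if "a < n" "j < n" for a j
    unfolding \<psi>_index[OF that] using Q(1) mpoly.const by (cases "a = u j"; cases "(u j, a) \<in> supp") auto
  have \<psi>_slice: "\<psi> z \<in> slice n u" for z
    unfolding slice_def by (auto simp: \<psi>_def supp_iff)
  have \<psi>_cong: "\<psi> z = \<psi> z'" if "\<And>e. e \<in> edges \<Longrightarrow> z e = z' e" for z z'
    unfolding \<psi>_def using mpoly_cong[OF Q(1) that] by (intro eq_matI) auto
  have \<psi>_orbit: "\<psi> (\<lambda>e. orbit_pt t $$ entry e) = orbit_pt t" if t: "\<forall>a. t a \<noteq> 0" for t
  proof (rule eq_matI)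
    fix a j assume "a < dim_row (orbit_pt t)" "j < dim_col (orbit_pt t)"
    then have aj: "a < n" "j < n" by (auto simp: orbit_pt_def torus_scale_def)
    have "base $$ (u j, j) = 1" using base_slice aj by (simp add: slice_def)
    then show "\<psi> (\<lambda>e. orbit_pt t $$ entry e) $$ (a, j) = orbit_pt t $$ (a, j)"
      using aj t Q(2)[of "(u j, a)" t] base_outside_supp[OF aj]
      by (auto simp: \<psi>_index orbit_pt_index)
  qed (auto simp: \<psi>_def orbit_pt_def torus_scale_def)
  \<comment> \<open>Nonzero edge coordinates can be realised by a torus element because the graph is
    a forest, so the value is a point of the orbit.\<close>
  have \<psi>_K_nz: "\<psi> z \<in> K" if z: "\<And>e. e \<in> edges \<Longrightarrow> z e \<noteq> 0" for z
  proof -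
    have base_nz: "base $$ entry e \<noteq> 0" if "e \<in> edges" for e
      using edges_supp[OF that] supp_iff[of "fst e" "snd e"] by simp
    have "\<exists>t. (\<forall>a. t a \<noteq> 0) \<and> (\<forall>e\<in>edges. t (snd e) / t (fst e) = z e / base $$ entry e)"
      by (rule forest_solve[of edges "\<lambda>e. z e / base $$ entry e" edges])
        (use forest Gamma_forest_iff finite_edges base_nz z in auto)
    then obtain t where t: "\<forall>a. t a \<noteq> 0" "\<And>e. e \<in> edges \<Longrightarrow> t (snd e) / t (fst e) = z e / base $$ entry e"
      by blast
    have "orbit_pt t $$ entry e = z e" if "e \<in> edges" for e
      using t(2)[OF that] base_nz[OF that] entry_less[OF edges_supp[OF that]] by (simp add: orbit_pt_index)
    then have "\<psi> z = \<psi> (\<lambda>e. orbit_pt t $$ entry e)" by (intro \<psi>_cong) simp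
    then show ?thesis using \<psi>_orbit[OF t(1)] orbit_pt_K[of t] t(1) by simp
  qed
  \<comment> \<open>Vanishing coordinates are reached as a limit: shifting all coordinates by
    \<open>s\<close> makes the edge coordinates nonzero for all but finitely many
    \<open>s\<close>.\<close>
  have \<psi>_K: "\<psi> z \<in> K" for z
  proof -
    have "poly_curve n (\<lambda>s. \<psi> (\<lambda>e. z e + s * 1))"
      unfolding poly_curve_def
    proof (intro allI impI)
      fix a j assume "a < n" "j < n"
      from mpoly_line[OF \<psi>_mpoly[OF this], of z "\<lambda>_. 1"]
      show "\<exists>P. \<forall>s. \<psi> (\<lambda>e. z e + s * 1) $$ (a, j) = poly P s" .
    qed
    moreover have "\<psi> (\<lambda>e. z e + s * 1) \<in> K" if "s \<notin> (\<lambda>e. - z e) ` edges" for s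
      by (rule \<psi>_K_nz) (use that in \<open>auto simp: add_eq_0_iff\<close>)
    ultimately have "coset_of n (\<psi> (\<lambda>e. z e + 0 * 1)) \<in> Y"
      using poly_curve_closed[OF closedin_Y, of "\<lambda>s. \<psi> (\<lambda>e. z e + s * 1)" "(\<lambda>e. - z e) ` edges" 0]
        finite_edges K_GL K_Y slice_GL[OF u \<psi>_slice] by blast
    then show ?thesis using \<psi>_slice by (simp add: K_def)
  qed
  interpret parametrized_chart n u Y edges entry \<psi>
  proof unfold_locales
    show "finite edges" by (rule finite_edges)
    show "fst (entry e) < n \<and> snd (entry e) < n" if "e \<in> edges" for e
      by (rule entry_less[OF edges_supp[OF that]])
    show "\<psi> z \<in> K" for z by (rule \<psi>_K)
    show "(\<lambda>z. \<psi> z $$ (a, j)) \<in> mpoly edges" if "a < n" "j < n" for a j by (rule \<psi>_mpoly[OF that])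
    show "\<psi> z $$ entry e = z e" if e: "e \<in> edges" for e z
    proof -
      have "pos (fst e) < pos (snd e)" using edges_supp[OF e] supp_iff[of "fst e" "snd e"] by simp
      then have "snd e \<noteq> fst e" by auto
      then show ?thesis using entry_less[OF edges_supp[OF e]] edges_supp[OF e] Q(3)[OF edges_supp[OF e] e]
        by (simp add: \<psi>_index)
    qed
    show "\<psi> (\<lambda>e. A $$ entry e) = A" if A: "A \<in> K" for A
    proof (rule eq_matI)
      fix a j assume "a < dim_row A" "j < dim_col A"
      then have aj: "a < n" "j < n" using slice_carrier_mat[OF K_slice[OF A]] by auto
      \<comment> \<open>The difference of the two entries is a polynomial that vanishes on the
        orbit, hence on the whole chart of \<open>Y\<close> by density.\<close>
      define p where "p A = \<psi> (\<lambda>e. A $$ entry e) $$ (a, j) - A $$ (a, j)" for A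
      have "(\<lambda>A. \<psi> (\<lambda>e. A $$ entry e) $$ (a, j)) \<in> poly_fun n"
        using mpoly_entries[OF \<psi>_mpoly[OF aj], of entry n] entry_less edges_supp by blast
      from poly_fun_diff[OF this poly_fun.entry[OF aj]]
      have "p \<in> poly_fun n" by (simp add: p_def[abs_def])
      moreover have "p (orbit_pt t) = 0" if "\<And>a. t a \<noteq> 0" for t
        using \<psi>_orbit[of t] that by (simp add: p_def)
      ultimately have "p A = 0" using orbit_dense[OF _ _ A] by blast
      then show "\<psi> (\<lambda>e. A $$ entry e) $$ (a, j) = A $$ (a, j)" by (simp add: p_def)
    qed (use slice_carrier_mat[OF K_slice[OF A]] in \<open>auto simp: \<psi>_def\<close>)
  qed
  show ?thesis
    unfolding smooth_at_point_def
    by (rule smooth[OF A0 local_dim_le_card[OF finite_edges supp_symcl A0]])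
qed

lemma smooth_iff_forest: "smooth_at_point n Y (perm_point n u) \<longleftrightarrow> is_forest (Gamma n w u)"
proof -
  have "perm_mat n u \<in> K"
    using perm_mat_slice[OF u] perm_point_Y_iff[OF u] u_le by (simp add: K_def perm_point_def)
  then show ?thesis using not_forest_not_smooth forest_smooth unfolding perm_point_def by blast
qed

end

theorem theorem1p2:
  fixes n :: nat and w :: "nat \<Rightarrow> nat" and Orb Y :: "complex mat set set"
  assumes "w permutes {0..<n}"
    and "generic_torus_orbit n w Orb"
    and "Y = flag_top n closure_of Orb"
  shows "(\<forall>u. u permutes {0..<n} \<and> bruhat_le n u w \<longrightarrow>
            (smooth_at_point n Y (perm_point n u) \<longleftrightarrow> is_forest (Gamma n w u))) \<and>
         (smooth_subvariety n Y \<longleftrightarrow>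
            (\<forall>u. u permutes {0..<n} \<and> bruhat_le n u w \<longrightarrow> is_forest (Gamma n w u)))"
proof -
  interpret generic_orbit n w Orb Y using assms by unfold_locales
  have chart: "generic_chart n w Orb Y u" if "u permutes {0..<n}" "bruhat_le n u w" for u
    using that by unfold_locales
  have iff: "smooth_at_point n Y (perm_point n u) \<longleftrightarrow> is_forest (Gamma n w u)"
    if "u permutes {0..<n}" "bruhat_le n u w" for u
    by (rule generic_chart.smooth_iff_forest[OF chart[OF that]])
  have "is_forest (Gamma n w u)" if "smooth_subvariety n Y" "u permutes {0..<n}" "bruhat_le n u w" for u
    using that iff[OF that(2,3)] perm_point_Y_iff[OF that(2)] by (simp add: smooth_subvariety_def)
  \<comment> \<open>A forest gives smoothness at every point of the chart, not only at its fixed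
    point, and these charts cover \<open>Y\<close>.\<close>
  moreover have "smooth_subvariety n Y"
    if forest: "\<forall>u. u permutes {0..<n} \<and> bruhat_le n u w \<longrightarrow> is_forest (Gamma n w u)"
    unfolding smooth_subvariety_def
  proof
    fix y assume y: "y \<in> Y"
    obtain u A where u: "u permutes {0..<n}" "bruhat_le n u w" and A: "A \<in> slice n u" "y = coset_of n A"
      by (rule Y_charts[OF y])
    interpret generic_chart n w Orb Y u by (rule chart[OF u])
    have "A \<in> K" using A y by (simp add: K_def)
    then show "smooth_at_point n Y y" unfolding A(2) using forest u u_le by (intro forest_smooth) simp_all
  qed
  ultimately show ?thesis using iff by blast
qed

end
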